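(* Consider a deformation $(V,\mathcal B,e,\cdot_q)$ of a framed Frobenius module $(V,\mathcal B,e,* )$ induced by a quantum potential defined over a neighborhood of $0\in\Delta^r$, where $r=\dim V_2$, and assume that $V$ is generated by $V_2$ under $*$. Then for each $\hat s\in(\Delta^* )^r$ near $0$ the family of Frobenius modules generates a germ of a family of algebras at $\hat s$ (that is, $V$ is generated by $V_2$ under $\cdot_q$ for all $q$ near $\hat s$, and hence carries the generated Frobenius algebra multiplications). Moreover, this germ can be unfolded to a germ of a Frobenius manifold.
   Context: **Frobenius modules.** Let $k\in\mathbb N$, let $V=\bigoplus_{p=0}^kV_{2p}$ be a graded finite dimensional $\mathbb C$-vector space and $\mathcal B$ a symmetric nondegenerate bilinear form on $V$ pairing $V_{2p}$ with $V_{2(k-p)}$. $(V,\mathcal B,e,* )$ is a graded $V_2$-Frobenius module of weight $k$ if $e\ne0$, $V_0=\langle e\rangle$; $V$ is a graded $\operatorname{Sym}V_2$-module under $*$; $\mathcal B(w*v_1,v_2)=\mathcal B(v_1,w*v_2)$ for $w\in V_2$, $v_1,v_2\in V$; and $w*e=w$ for $w\in V_2$. It is real if $V$ has a real structure $V_{\mathbb R}$ compatible with the grading, $*$ is real, $e\in V_{\mathbb R}$ and $\mathcal B$ is defined over $\mathbb R$. **Polarization and framing.** To a real module associate the mixed Hodge structure split over $\mathbb R$ with bigrading $I^{p,p}=V_{2(k-p)}$ (so $F^p=\bigoplus_{a\ge p}I^{a,a}$, $W_l=\bigoplus_{2a\le l}I^{a,a}$), and the form $Q(v_a,v_b)=(-1)^{k+\tilde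 a/2}\mathcal B(v_a,v_b)$ for $v_a\in V_{\tilde a}$. An element $w\in V_2\cap V_{\mathbb R}$ is polarizing if, with $N=L_w$ the operator $v\mapsto w*v$, the triple $(I^{*,*},Q,N)$ is a polarized mixed Hodge structure: $N^{k+1}=0$; $W_j=W(N)_{j-k}$, with $W(N)$ the monodromy weight filtration of $N$ centered at $0$; $Q(F^p,F^{k-p+1})=0$; and for every $l\ge0$ the weight $k+l$ Hodge structure on $\ker(N^{l+1}:Gr^W_{k+l}\to Gr^W_{k-l-2})$ is polarized by $Q(\cdot,N^l\cdot)$ (a polarization $S$ in weight $m$ is a $(-1)^m$-symmetric form with $S(F^p,F^{m-p+1})=0$ and $i^{p-q}S(v,\bar v)>0$ for $0\neq v\in H^{p,q}$). The polarizing elements form an open cone in $V_2\cap V_{\mathbb R}$ (if nonempty). A framing is a basis $T_1,\dots,T_r$ of $V_2\cap V_{\mathbb R}$ spanning a simplicial cone contained in the closure of the polarizing cone and containing a polarizing element. A framed Frobenius module is a real module having a polarizing element, together with a framing. **Potentials.** Let $T_0=e,T_1,\dots,T_m$ be a graded basis of $V$, with $T_1,\dots,T_r$ the framing, which is self-dual up to permutation for $\mathcal B$: $\mathcal B(T_{\delta(a)},T_b)=\delta_{ab}$ for a permutation $\delta$ of $\{0,\dots,m\}$. Write $\tilde a=p$ if $T_a\in V_p$, with $a\mapsto\tilde a$ increasing. Let $z_0,\dots,z_m$ be the linear coordinates and $q_j=e^{2\pi iz_j}$ for $1\le j\le r$. The classical potential is $\phi_0=\sum_{\tilde j=2,\;0\le\tilde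 a,\tilde b\le2k}z_jz_az_b\frac{C(\tilde a)}{12}\mathcal B(T_j*T_a,T_b)$, where $C(\tilde a)=2$ if $k=3$ and $\tilde a=2$; $C(\tilde a)=3$ if $k\ne3$ and $\tilde a\in\{2,2k-4\}$; $C(\tilde a)=6$ otherwise. Let $R'$ be the ring of convergent power series in $q_1,\dots,q_r$ vanishing at $q=0$, viewed as functions of $z_1,\dots,z_r$. For $k>3$, a quantum potential is $\phi=\phi_0+\phi_\hbar$ with $\phi_\hbar(z)=\sum_{\tilde a=2k-4}z_a\phi_h^a(z_1,\dots,z_r)+\sum_{2<\tilde a<2k-4,\;\tilde a+\tilde b=2k-2}z_az_b\phi_h^{ab}(z_1,\dots,z_r)$, $\phi_h^a,\phi_h^{ab}\in R'$, such that the action $$T_j\cdot_qT_a:=\sum_{\tilde c=\tilde a+2}\frac{\partial^3\phi}{\partial z_j\,\partial z_a\,\partial z_{\delta(c)}}T_c\qquad(1\le j\le r)$$ makes $(V,\mathcal B,e,\cdot_q)$ a graded $V_2$-Frobenius module for all $q$ in the domain. For $k=3$, $\phi=\phi_0+\phi_\hbar$ with $\phi_\hbar\in R'$ arbitrary. For $k\le2$ the module is determined by $\mathcal B$ and $e$ and has no nontrivial deformations. The family $(V,\mathcal B,e,\cdot_q)$ is the deformation induced by $\phi$; $\cdot_0=*$. **Generation and generated algebras.** $V$ is generated by $V_2$ under an action $*$ if $\operatorname{Sym}V_2\to V$, $P\mapsto P*e$, is onto. Then $(P_a*e)\,\hat\ast\,(P_b*e):=(P_aP_b)*e$ is a well-defined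 commutative, associative, graded multiplication on $V$ with unit $e$ and $\mathcal B(v_1\hat\ast v_2,v_3)=\mathcal B(v_2,v_1\hat\ast v_3)$, i.e. a graded Frobenius algebra. Applied to $\cdot_q$, it gives multiplications $\hat\ast_q$. **Frobenius manifolds.** A Frobenius manifold is a complex manifold $M$ of dimension at least $1$ with a commutative associative multiplication $\hat\cdot$ on the holomorphic tangent bundle $TM$, a unit field, and a symmetric nondegenerate bilinear pairing $g$ on $TM$ such that the Levi-Civita connection $\nabla^g$ is flat, the unit field is $\nabla^g$-flat, $g(X\hat\cdot Y,Z)=g(Y,X\hat\cdot Z)$, and $\nabla^g_X(Y\hat\cdot Z)-\nabla^g_Y(X\hat\cdot Z)+X\hat\cdot\nabla^g_YZ-Y\hat\cdot\nabla^g_XZ-[X,Y]\hat\cdot Z=0$ for all vector fields $X,Y,Z$. **Unfolding.** A germ $(M,x)$ of a Frobenius manifold unfolds the germ at $\hat s$ of the family $(V,\mathcal B,e,\hat\ast_q)$ if there are a closed embedding of germs $\iota:((\Delta^* )^r,\hat s)\to(M,x)$ and an isomorphism of $\iota^*TM$ with the trivial bundle with fiber $V$ which sends $d\iota(\partial/\partial z_j)=d\iota(2\pi iq_j\,\partial/\partial q_j)$ to $T_j$ for $1\le j\le r$, the unit field to $e$, the pairing $g$ to $\mathcal B$, the multiplication to $\hat\ast_q$ at each $q$, and the pulled back Levi-Civita connection to the trivial connection. *)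

theory Defs
  imports "HOL-Analysis.Analysis"
begin

text \<open>
  The finite dimensional complex vector space is the type \<open>complex^'n\<close>, with scalar
  multiplication \<open>(*s)\<close>.  \<open>V d\<close> is the homogeneous part of degree \<open>d\<close>; only even
  degrees \<open>0, 2, \<dots>, 2k\<close> occur.
\<close>

type_synonym 'n cvec = "complex^'n"

abbreviation clin :: "('n::finite cvec \<Rightarrow> 'n cvec) \<Rightarrow> bool" where
  "clin \<equiv> Vector_Spaces.linear (*s) (*s)"

definition bilinear_form :: "('n::finite cvec \<Rightarrow> 'n cvec \<Rightarrow> complex) \<Rightarrow> bool" where
  "bilinear_form B \<longleftrightarrow>
     (\<forall>u. Vector_Spaces.linear (*s) (*) (\<lambda>v. B u v)) \<and>
     (\<forall>v. Vector_Spaces.linear (*s) (*) (\<lambda>u. B u v))"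

definition bilinear_map :: "('n::finite cvec \<Rightarrow> 'n cvec \<Rightarrow> 'n cvec) \<Rightarrow> bool" where
  "bilinear_map f \<longleftrightarrow> (\<forall>u. clin (\<lambda>v. f u v)) \<and> (\<forall>v. clin (\<lambda>u. f u v))"

definition nondegenerate :: "('n::finite cvec \<Rightarrow> 'n cvec \<Rightarrow> complex) \<Rightarrow> bool" where
  "nondegenerate B \<longleftrightarrow> (\<forall>u. (\<forall>v. B u v = 0) \<longrightarrow> u = 0)"

section \<open>Graded Frobenius modules\<close>

definition is_decomp :: "nat \<Rightarrow> (nat \<Rightarrow> 'n::finite cvec set) \<Rightarrow> 'n cvec \<Rightarrow> (nat \<Rightarrow> 'n cvec) \<Rightarrow> bool" where
  "is_decomp k V v f \<longleftrightarrow> (\<forall>d. f d \<in> V d) \<and> v = (\<Sum>p\<le>k. f (2 * p))"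

definition graded_space :: "nat \<Rightarrow> (nat \<Rightarrow> 'n::finite cvec set) \<Rightarrow> bool" where
  "graded_space k V \<longleftrightarrow>
     (\<forall>d. vec.subspace (V d)) \<and>
     (\<forall>d. odd d \<or> 2 * k < d \<longrightarrow> V d = {0}) \<and>
     (\<forall>v. \<exists>!f. is_decomp k V v f)"

definition component :: "nat \<Rightarrow> (nat \<Rightarrow> 'n::finite cvec set) \<Rightarrow> nat \<Rightarrow> 'n cvec \<Rightarrow> 'n cvec" where
  "component k V d v = (THE f. is_decomp k V v f) d"

text \<open>
  Only the values \<open>act w v\<close> with \<open>w \<in> V 2\<close> matter.  A graded module structure over the
  symmetric algebra of \<open>V 2\<close> is a linear family of commuting operators of degree 2.
\<close>

definition sym_module :: "(nat \<Rightarrow> 'n::finite cvec set) \<Rightarrow> ('n cvec \<Rightarrow> 'n cvec \<Rightarrow> 'n cvec) \<Rightarrow> bool" where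
  "sym_module V act \<longleftrightarrow>
     (\<forall>w\<in>V 2. clin (act w)) \<and>
     (\<forall>w\<in>V 2. \<forall>w'\<in>V 2. \<forall>v. act (w + w') v = act w v + act w' v) \<and>
     (\<forall>w\<in>V 2. \<forall>c v. act (c *s w) v = c *s act w v) \<and>
     (\<forall>w\<in>V 2. \<forall>w'\<in>V 2. \<forall>v. act w (act w' v) = act w' (act w v)) \<and>
     (\<forall>w\<in>V 2. \<forall>d. \<forall>v\<in>V d. act w v \<in> V (d + 2))"

definition frobenius_module ::
  "nat \<Rightarrow> (nat \<Rightarrow> 'n::finite cvec set) \<Rightarrow> ('n cvec \<Rightarrow> 'n cvec \<Rightarrow> complex) \<Rightarrow> 'n cvec \<Rightarrow>
   ('n cvec \<Rightarrow> 'n cvec \<Rightarrow> 'n cvec) \<Rightarrow> bool" where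
  "frobenius_module k V B e act \<longleftrightarrow>
     graded_space k V \<and>
     bilinear_form B \<and> (\<forall>u v. B u v = B v u) \<and> nondegenerate B \<and>
     (\<forall>a b. a + b \<noteq> 2 * k \<longrightarrow> (\<forall>u\<in>V a. \<forall>v\<in>V b. B u v = 0)) \<and>
     e \<noteq> 0 \<and> V 0 = vec.span {e} \<and>
     sym_module V act \<and>
     (\<forall>w\<in>V 2. \<forall>u v. B (act w u) v = B u (act w v)) \<and>
     (\<forall>w\<in>V 2. act w e = w)"

text \<open>\<open>VR\<close> is the set of real vectors; \<open>subspace\<close> is the notion over the reals.\<close>

definition real_structure :: "'n::finite cvec set \<Rightarrow> bool" where
  "real_structure VR \<longleftrightarrow>
     subspace VR \<and> (\<forall>v. \<exists>!p. fst p \<in> VR \<and> snd p \<in> VR \<and> v = fst p + \<i> *s snd p)"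

definition conj_of :: "'n::finite cvec set \<Rightarrow> 'n cvec \<Rightarrow> 'n cvec" where
  "conj_of VR v = (THE u. \<exists>x\<in>VR. \<exists>y\<in>VR. v = x + \<i> *s y \<and> u = x - \<i> *s y)"

definition real_frobenius_module ::
  "nat \<Rightarrow> (nat \<Rightarrow> 'n::finite cvec set) \<Rightarrow> ('n cvec \<Rightarrow> 'n cvec \<Rightarrow> complex) \<Rightarrow> 'n cvec \<Rightarrow>
   ('n cvec \<Rightarrow> 'n cvec \<Rightarrow> 'n cvec) \<Rightarrow> 'n cvec set \<Rightarrow> bool" where
  "real_frobenius_module k V B e act VR \<longleftrightarrow>
     frobenius_module k V B e act \<and>
     real_structure VR \<and>
     (\<forall>d. \<forall>v\<in>V d. \<exists>x\<in>V d \<inter> VR. \<exists>y\<in>V d \<inter> VR. v = x + \<i> *s y) \<and>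
     (\<forall>w\<in>V 2 \<inter> VR. \<forall>v\<in>VR. act w v \<in> VR) \<and>
     e \<in> VR \<and>
     (\<forall>u\<in>VR. \<forall>v\<in>VR. B u v \<in> \<real>)"

section \<open>Polarization and framing\<close>

text \<open>The bigrading is \<open>I\<^sup>a\<^sup>,\<^sup>a = V (2 * (k - a))\<close> for \<open>0 \<le> a \<le> k\<close>, all other \<open>I\<^sup>a\<^sup>,\<^sup>b\<close> being 0.\<close>

definition hodge_F :: "nat \<Rightarrow> (nat \<Rightarrow> 'n::finite cvec set) \<Rightarrow> int \<Rightarrow> 'n cvec set" where
  "hodge_F k V p = vec.span (\<Union>a\<in>{a. a \<le> k \<and> p \<le> int a}. V (2 * (k - a)))"

definition weight_W :: "nat \<Rightarrow> (nat \<Rightarrow> 'n::finite cvec set) \<Rightarrow> int \<Rightarrow> 'n cvec set" where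
  "weight_W k V l = vec.span (\<Union>a\<in>{a. a \<le> k \<and> 2 * int a \<le> l}. V (2 * (k - a)))"

text \<open>The bilinear extension of \<open>Q(u,v) = (-1)^(k+p) B(u,v)\<close> for \<open>u \<in> V (2 * p)\<close>.\<close>

definition Q_form ::
  "nat \<Rightarrow> (nat \<Rightarrow> 'n::finite cvec set) \<Rightarrow> ('n cvec \<Rightarrow> 'n cvec \<Rightarrow> complex) \<Rightarrow> 'n cvec \<Rightarrow> 'n cvec \<Rightarrow> complex" where
  "Q_form k V B u v = (\<Sum>p\<le>k. (- 1) ^ (k + p) * B (component k V (2 * p) u) v)"

text \<open>
  \<open>M\<close> is the monodromy weight filtration of \<open>N\<close> centered at 0; the last two conditions say
  that \<open>N ^^ l\<close> induces an injective and surjective map from \<open>M l / M (l - 1)\<close> to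
  \<open>M (- l) / M (- l - 1)\<close>.
\<close>

definition monodromy_weight_filtration ::
  "('n::finite cvec \<Rightarrow> 'n cvec) \<Rightarrow> (int \<Rightarrow> 'n cvec set) \<Rightarrow> bool" where
  "monodromy_weight_filtration N M \<longleftrightarrow>
     (\<forall>l. vec.subspace (M l)) \<and> mono M \<and> (\<exists>l. M l = {0}) \<and> (\<exists>l. M l = UNIV) \<and>
     (\<forall>l. N ` M l \<subseteq> M (l - 2)) \<and>
     (\<forall>l. \<forall>v\<in>M (int l). (N ^^ l) v \<in> M (- int l - 1) \<longrightarrow> v \<in> M (int l - 1)) \<and>
     (\<forall>l. \<forall>u\<in>M (- int l). \<exists>v\<in>M (int l). u - (N ^^ l) v \<in> M (- int l - 1))"

text \<open>
  Subspaces of a graded quotient \<open>W m / W (m - 1)\<close> are represented by their preimages in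
  \<open>W m\<close>; a class is nonzero iff its representatives lie outside \<open>W (m - 1)\<close>.
\<close>

definition gr_F :: "nat \<Rightarrow> (nat \<Rightarrow> 'n::finite cvec set) \<Rightarrow> int \<Rightarrow> int \<Rightarrow> 'n cvec set" where
  "gr_F k V m p =
     {v \<in> weight_W k V m. \<exists>x\<in>hodge_F k V p \<inter> weight_W k V m. v - x \<in> weight_W k V (m - 1)}"

definition gr_primitive ::
  "nat \<Rightarrow> (nat \<Rightarrow> 'n::finite cvec set) \<Rightarrow> ('n cvec \<Rightarrow> 'n cvec) \<Rightarrow> nat \<Rightarrow> 'n cvec set" where
  "gr_primitive k V N l =
     {v \<in> weight_W k V (int k + int l). (N ^^ (l + 1)) v \<in> weight_W k V (int k - int l - 3)}"

definition polarizing ::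
  "nat \<Rightarrow> (nat \<Rightarrow> 'n::finite cvec set) \<Rightarrow> ('n cvec \<Rightarrow> 'n cvec \<Rightarrow> complex) \<Rightarrow>
   ('n cvec \<Rightarrow> 'n cvec \<Rightarrow> 'n cvec) \<Rightarrow> 'n cvec set \<Rightarrow> 'n cvec \<Rightarrow> bool" where
  "polarizing k V B act VR w \<longleftrightarrow>
     w \<in> V 2 \<inter> VR \<and>
     (let N = act w; Q = Q_form k V B in
        (\<forall>v. (N ^^ (k + 1)) v = 0) \<and>
        monodromy_weight_filtration N (\<lambda>j. weight_W k V (j + int k)) \<and>
        (\<forall>p. \<forall>u\<in>hodge_F k V p. \<forall>v\<in>hodge_F k V (int k - p + 1). Q u v = 0) \<and>
        (\<forall>l. let m = k + l; P = gr_primitive k V N l; S = (\<lambda>u v. Q u ((N ^^ l) v)) in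
           (\<forall>u\<in>P. \<forall>v\<in>P. S u v = (- 1) ^ m * S v u) \<and>
           (\<forall>p. \<forall>u\<in>P \<inter> gr_F k V (int m) p. \<forall>v\<in>P \<inter> gr_F k V (int m) (int m - p + 1). S u v = 0) \<and>
           (\<forall>p q. p + q = int m \<longrightarrow>
              (\<forall>v\<in>P \<inter> gr_F k V (int m) p.
                 conj_of VR v \<in> gr_F k V (int m) q \<and> v \<notin> weight_W k V (int m - 1) \<longrightarrow>
                 \<i> powi (p - q) * S v (conj_of VR v) \<in> \<real> \<and>
                 0 < Re (\<i> powi (p - q) * S v (conj_of VR v))))))"

definition framing ::
  "nat \<Rightarrow> (nat \<Rightarrow> 'n::finite cvec set) \<Rightarrow> ('n cvec \<Rightarrow> 'n cvec \<Rightarrow> complex) \<Rightarrow>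
   ('n cvec \<Rightarrow> 'n cvec \<Rightarrow> 'n cvec) \<Rightarrow> 'n cvec set \<Rightarrow> 'i set \<Rightarrow> ('i \<Rightarrow> 'n cvec) \<Rightarrow> bool" where
  "framing k V B act VR J T \<longleftrightarrow>
     finite J \<and> inj_on T J \<and> independent (T ` J) \<and> span (T ` J) = V 2 \<inter> VR \<and>
     (let \<sigma> = {\<Sum>j\<in>J. t j *\<^sub>R T j | t. \<forall>j\<in>J. 0 \<le> t j} in
        \<sigma> \<subseteq> closure {w. polarizing k V B act VR w} \<and>
        (\<exists>w\<in>\<sigma>. polarizing k V B act VR w))"

text \<open>
  The indices \<open>0, \<dots>, m\<close> of the basis are the elements of the finite linear order \<open>'n\<close>, and
  \<open>td a\<close> is the degree of \<open>T a\<close>.  The framing consists of the \<open>T j\<close> with \<open>td j = 2\<close>.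
\<close>

definition framed_frobenius_module ::
  "nat \<Rightarrow> (nat \<Rightarrow> 'n::finite cvec set) \<Rightarrow> ('n cvec \<Rightarrow> 'n cvec \<Rightarrow> complex) \<Rightarrow> 'n cvec \<Rightarrow>
   ('n cvec \<Rightarrow> 'n cvec \<Rightarrow> 'n cvec) \<Rightarrow> 'n cvec set \<Rightarrow> 'i set \<Rightarrow> ('i \<Rightarrow> 'n cvec) \<Rightarrow> bool" where
  "framed_frobenius_module k V B e act VR J T \<longleftrightarrow>
     real_frobenius_module k V B e act VR \<and> (\<exists>w. polarizing k V B act VR w) \<and>
     framing k V B act VR J T"

definition adapted_basis ::
  "(nat \<Rightarrow> 'n::{finite,linorder} cvec set) \<Rightarrow> ('n cvec \<Rightarrow> 'n cvec \<Rightarrow> complex) \<Rightarrow> 'n cvec \<Rightarrow>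
   ('n \<Rightarrow> nat) \<Rightarrow> ('n \<Rightarrow> 'n cvec) \<Rightarrow> ('n \<Rightarrow> 'n) \<Rightarrow> bool" where
  "adapted_basis V B e td T \<delta> \<longleftrightarrow>
     inj T \<and> vec.independent (range T) \<and> vec.span (range T) = UNIV \<and>
     (\<forall>a. T a \<in> V (td a)) \<and> mono td \<and>
     T (Min UNIV) = e \<and>
     bij \<delta> \<and> (\<forall>a b. B (T (\<delta> a)) (T b) = (if a = b then 1 else 0))"

section \<open>Several complex variables\<close>

text \<open>
  On an open set, or on a relatively open subset of a complex subspace, this is the usual
  notion of a holomorphic function of several variables.
\<close>

definition holo_on :: "('n::finite cvec \<Rightarrow> complex) \<Rightarrow> 'n cvec set \<Rightarrow> bool" where
  "holo_on f S \<longleftrightarrow>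
     (\<forall>x\<in>S. \<exists>D. Vector_Spaces.linear (*s) (*) D \<and> (f has_derivative D) (at x within S))"

definition vholo_on :: "('n::finite cvec \<Rightarrow> 'n cvec) \<Rightarrow> 'n cvec set \<Rightarrow> bool" where
  "vholo_on f S \<longleftrightarrow> (\<forall>i. holo_on (\<lambda>x. f x $ i) S)"

definition pd :: "'n::finite \<Rightarrow> ('n cvec \<Rightarrow> complex) \<Rightarrow> 'n cvec \<Rightarrow> complex" where
  "pd i f x = deriv (\<lambda>t. f (x + t *s axis i 1)) 0"

definition vpd :: "'n::finite \<Rightarrow> ('n cvec \<Rightarrow> 'n cvec) \<Rightarrow> 'n cvec \<Rightarrow> 'n cvec" where
  "vpd i f x = (\<chi> l. pd i (\<lambda>y. f y $ l) x)"

section \<open>Potentials\<close>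

text \<open>
  The space of the variables \<open>q\<^sub>1, \<dots>, q\<^sub>r\<close> is realized as the coordinate subspace of
  \<open>complex^'n\<close> belonging to the framing indices.
\<close>

definition qspace :: "('n \<Rightarrow> nat) \<Rightarrow> 'n::finite cvec set" where
  "qspace td = {q. \<forall>a. td a \<noteq> 2 \<longrightarrow> q $ a = 0}"

definition polydisc :: "('n \<Rightarrow> nat) \<Rightarrow> real \<Rightarrow> 'n::finite cvec set" where
  "polydisc td \<rho> = {q \<in> qspace td. \<forall>j. td j = 2 \<longrightarrow> cmod (q $ j) < \<rho>}"

definition punctured_polydisc :: "('n \<Rightarrow> nat) \<Rightarrow> real \<Rightarrow> 'n::finite cvec set" where
  "punctured_polydisc td \<rho> = {q \<in> polydisc td \<rho>. \<forall>j. td j = 2 \<longrightarrow> q $ j \<noteq> 0}"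

definition qexp :: "('n \<Rightarrow> nat) \<Rightarrow> 'n::finite cvec \<Rightarrow> 'n cvec" where
  "qexp td z = (\<chi> a. if td a = 2 then exp (2 * of_real pi * \<i> * z $ a) else 0)"

definition qlog :: "('n \<Rightarrow> nat) \<Rightarrow> 'n::finite cvec \<Rightarrow> 'n cvec" where
  "qlog td q = (\<chi> a. if td a = 2 then Ln (q $ a) / (2 * of_real pi * \<i>) else 0)"

text \<open>Functions of \<open>z\<close> given on the part of \<open>z\<close>-space over \<open>D\<close> by a power series in \<open>q\<close> without constant term.\<close>

definition Rprime :: "('n::finite \<Rightarrow> nat) \<Rightarrow> 'n cvec set \<Rightarrow> ('n cvec \<Rightarrow> complex) set" where
  "Rprime td D =
     {f. \<exists>c :: ('n \<Rightarrow> nat) \<Rightarrow> complex. c (\<lambda>_. 0) = 0 \<and>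
          (\<forall>z. qexp td z \<in> D \<longrightarrow>
             ((\<lambda>\<alpha>. c \<alpha> * (\<Prod>j\<in>{j. td j = 2}. (qexp td z $ j) ^ \<alpha> j)) has_sum f z)
               {\<alpha>. \<forall>a. td a \<noteq> 2 \<longrightarrow> \<alpha> a = 0})}"

definition C_coeff :: "nat \<Rightarrow> nat \<Rightarrow> complex" where
  "C_coeff k d = (if k = 3 \<and> d = 2 then 2
                  else if k \<noteq> 3 \<and> (d = 2 \<or> d + 4 = 2 * k) then 3
                  else 6)"

definition classical_potential ::
  "nat \<Rightarrow> ('n::finite cvec \<Rightarrow> 'n cvec \<Rightarrow> complex) \<Rightarrow> ('n cvec \<Rightarrow> 'n cvec \<Rightarrow> 'n cvec) \<Rightarrow>
   ('n \<Rightarrow> nat) \<Rightarrow> ('n \<Rightarrow> 'n cvec) \<Rightarrow> 'n cvec \<Rightarrow> complex" where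
  "classical_potential k B act td T z =
     (\<Sum>j\<in>{j. td j = 2}. \<Sum>a\<in>UNIV. \<Sum>b\<in>UNIV.
        z $ j * z $ a * z $ b * (C_coeff k (td a) / 12) * B (act (T j) (T a)) (T b))"

definition quantum_act_basis ::
  "('n \<Rightarrow> nat) \<Rightarrow> ('n \<Rightarrow> 'n::finite cvec) \<Rightarrow> ('n \<Rightarrow> 'n) \<Rightarrow> ('n cvec \<Rightarrow> complex) \<Rightarrow>
   'n cvec \<Rightarrow> 'n \<Rightarrow> 'n \<Rightarrow> 'n cvec" where
  "quantum_act_basis td T \<delta> \<phi> z j a =
     (\<Sum>c\<in>{c. td c = td a + 2}. pd j (pd a (pd (\<delta> c) \<phi>)) z *s T c)"

definition coord :: "('n \<Rightarrow> 'n::finite cvec) \<Rightarrow> 'n cvec \<Rightarrow> 'n \<Rightarrow> complex" where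
  "coord T v a = vec.representation (range T) v (T a)"

definition quantum_act_z ::
  "('n \<Rightarrow> nat) \<Rightarrow> ('n \<Rightarrow> 'n::finite cvec) \<Rightarrow> ('n \<Rightarrow> 'n) \<Rightarrow> ('n cvec \<Rightarrow> complex) \<Rightarrow>
   'n cvec \<Rightarrow> 'n cvec \<Rightarrow> 'n cvec \<Rightarrow> 'n cvec" where
  "quantum_act_z td T \<delta> \<phi> z w v =
     (\<Sum>j\<in>{j. td j = 2}. \<Sum>a\<in>UNIV. (coord T w j * coord T v a) *s quantum_act_basis td T \<delta> \<phi> z j a)"

text \<open>
  For a quantum potential the relevant third derivatives depend only on the framing coordinates
  of \<open>z\<close> and are periodic in them, so any other choice of logarithms gives the same action.
\<close>

definition quantum_act ::
  "('n \<Rightarrow> nat) \<Rightarrow> ('n \<Rightarrow> 'n::finite cvec) \<Rightarrow> ('n \<Rightarrow> 'n) \<Rightarrow> ('n cvec \<Rightarrow> complex) \<Rightarrow>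
   'n cvec \<Rightarrow> 'n cvec \<Rightarrow> 'n cvec \<Rightarrow> 'n cvec" where
  "quantum_act td T \<delta> \<phi> q = quantum_act_z td T \<delta> \<phi> (qlog td q)"

text \<open>
  The degree conditions \<open>d = 2 * k - 4\<close> and \<open>d < 2 * k - 4\<close> are written additively because of
  truncated subtraction.  For \<open>k \<le> 2\<close> there are no quantum corrections.
\<close>

definition quantum_potential ::
  "nat \<Rightarrow> (nat \<Rightarrow> 'n::finite cvec set) \<Rightarrow> ('n cvec \<Rightarrow> 'n cvec \<Rightarrow> complex) \<Rightarrow> 'n cvec \<Rightarrow>
   ('n cvec \<Rightarrow> 'n cvec \<Rightarrow> 'n cvec) \<Rightarrow> ('n \<Rightarrow> nat) \<Rightarrow> ('n \<Rightarrow> 'n cvec) \<Rightarrow> ('n \<Rightarrow> 'n) \<Rightarrow>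
   'n cvec set \<Rightarrow> ('n cvec \<Rightarrow> complex) \<Rightarrow> bool" where
  "quantum_potential k V B e act td T \<delta> D \<phi> \<longleftrightarrow>
     openin (top_of_set (qspace td)) D \<and> 0 \<in> D \<and> D \<subseteq> polydisc td 1 \<and>
     (\<exists>\<phi>h. (\<forall>z. qexp td z \<in> D \<longrightarrow> \<phi> z = classical_potential k B act td T z + \<phi>h z) \<and>
        (k \<le> 2 \<longrightarrow> \<phi>h = (\<lambda>_. 0)) \<and>
        (k = 3 \<longrightarrow> \<phi>h \<in> Rprime td D) \<and>
        (k > 3 \<longrightarrow>
           (\<exists>h1 h2. (\<forall>a. h1 a \<in> Rprime td D) \<and> (\<forall>a b. h2 a b \<in> Rprime td D) \<and>
              \<phi>h = (\<lambda>z. (\<Sum>a\<in>{a. td a + 4 = 2 * k}. z $ a * h1 a z) +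
                        (\<Sum>(a, b)\<in>{(a, b). 2 < td a \<and> td a + 4 < 2 * k \<and> td a + td b + 2 = 2 * k}.
                           z $ a * z $ b * h2 a b z))) \<and>
           (\<forall>z. qexp td z \<in> D \<longrightarrow> frobenius_module k V B e (quantum_act_z td T \<delta> \<phi> z))))"

section \<open>Generation and generated algebras\<close>

text \<open>
  An element of the symmetric algebra of \<open>V 2\<close> is represented by a linear combination of words
  in \<open>V 2\<close>; for commuting operators different representatives act in the same way.
\<close>

type_synonym 'v words = "(complex \<times> 'v list) list"

definition words_over :: "'v set \<Rightarrow> 'v words \<Rightarrow> bool" where
  "words_over A P \<longleftrightarrow> (\<forall>(c, ws)\<in>set P. set ws \<subseteq> A)"

definition words_act ::
  "('n::finite cvec \<Rightarrow> 'n cvec \<Rightarrow> 'n cvec) \<Rightarrow> 'n cvec words \<Rightarrow> 'n cvec \<Rightarrow> 'n cvec" where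
  "words_act act P v = (\<Sum>(c, ws)\<leftarrow>P. c *s foldr act ws v)"

definition words_mult :: "'v words \<Rightarrow> 'v words \<Rightarrow> 'v words" where
  "words_mult P R = [(c * d, us @ ws). (c, us) \<leftarrow> P, (d, ws) \<leftarrow> R]"

definition generated_by ::
  "'n::finite cvec set \<Rightarrow> ('n cvec \<Rightarrow> 'n cvec \<Rightarrow> 'n cvec) \<Rightarrow> 'n cvec \<Rightarrow> bool" where
  "generated_by A act e \<longleftrightarrow> (\<forall>v. \<exists>P. words_over A P \<and> words_act act P e = v)"

definition generated_mult ::
  "'n::finite cvec set \<Rightarrow> ('n cvec \<Rightarrow> 'n cvec \<Rightarrow> 'n cvec) \<Rightarrow> 'n cvec \<Rightarrow> 'n cvec \<Rightarrow> 'n cvec \<Rightarrow> 'n cvec" where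
  "generated_mult A act e u v =
     (THE x. \<exists>P R. words_over A P \<and> words_over A R \<and>
        words_act act P e = u \<and> words_act act R e = v \<and> x = words_act act (words_mult P R) e)"

definition graded_frobenius_algebra ::
  "nat \<Rightarrow> (nat \<Rightarrow> 'n::finite cvec set) \<Rightarrow> ('n cvec \<Rightarrow> 'n cvec \<Rightarrow> complex) \<Rightarrow> 'n cvec \<Rightarrow>
   ('n cvec \<Rightarrow> 'n cvec \<Rightarrow> 'n cvec) \<Rightarrow> bool" where
  "graded_frobenius_algebra k V B e mul \<longleftrightarrow>
     graded_space k V \<and> bilinear_map mul \<and>
     (\<forall>u v. mul u v = mul v u) \<and> (\<forall>u v w. mul (mul u v) w = mul u (mul v w)) \<and>
     (\<forall>v. mul e v = v) \<and>
     (\<forall>a b. \<forall>u\<in>V a. \<forall>v\<in>V b. mul u v \<in> V (a + b)) \<and>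
     bilinear_form B \<and> (\<forall>u v. B u v = B v u) \<and> nondegenerate B \<and>
     (\<forall>u v w. B (mul u v) w = B v (mul u w))"

section \<open>Frobenius manifolds and unfoldings\<close>

text \<open>
  A germ of a complex manifold is represented in a holomorphic chart: \<open>M\<close> is an open subset of
  \<open>complex^'n\<close> with arbitrary (not necessarily flat) coordinates, and tangent vectors and
  vector fields are written in the coordinate frame.  Tensor fields are families of multilinear
  maps depending holomorphically on the point.
\<close>

definition dir_deriv :: "('n::finite cvec \<Rightarrow> 'n cvec) \<Rightarrow> ('n cvec \<Rightarrow> complex) \<Rightarrow> 'n cvec \<Rightarrow> complex" where
  "dir_deriv X f x = (\<Sum>i\<in>UNIV. X x $ i * pd i f x)"

definition vdir_deriv :: "('n::finite cvec \<Rightarrow> 'n cvec) \<Rightarrow> ('n cvec \<Rightarrow> 'n cvec) \<Rightarrow> 'n cvec \<Rightarrow> 'n cvec" where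
  "vdir_deriv X Y x = (\<Sum>i\<in>UNIV. X x $ i *s vpd i Y x)"

definition lie_bracket :: "('n::finite cvec \<Rightarrow> 'n cvec) \<Rightarrow> ('n cvec \<Rightarrow> 'n cvec) \<Rightarrow> 'n cvec \<Rightarrow> 'n cvec" where
  "lie_bracket X Y x = vdir_deriv X Y x - vdir_deriv Y X x"

definition holo_tensor12 :: "'n::finite cvec set \<Rightarrow> ('n cvec \<Rightarrow> 'n cvec \<Rightarrow> 'n cvec \<Rightarrow> 'n cvec) \<Rightarrow> bool" where
  "holo_tensor12 M t \<longleftrightarrow>
     (\<forall>x\<in>M. bilinear_map (t x)) \<and> (\<forall>i j. vholo_on (\<lambda>x. t x (axis i 1) (axis j 1)) M)"

definition holo_tensor02 :: "'n::finite cvec set \<Rightarrow> ('n cvec \<Rightarrow> 'n cvec \<Rightarrow> 'n cvec \<Rightarrow> complex) \<Rightarrow> bool" where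
  "holo_tensor02 M g \<longleftrightarrow>
     (\<forall>x\<in>M. bilinear_form (g x)) \<and> (\<forall>i j. holo_on (\<lambda>x. g x (axis i 1) (axis j 1)) M)"

text \<open>A connection is given by its connection form \<open>\<Gamma>\<close> (Christoffel symbols) in the coordinate frame.\<close>

definition nabla ::
  "('n::finite cvec \<Rightarrow> 'n cvec \<Rightarrow> 'n cvec \<Rightarrow> 'n cvec) \<Rightarrow> ('n cvec \<Rightarrow> 'n cvec) \<Rightarrow> ('n cvec \<Rightarrow> 'n cvec) \<Rightarrow>
   'n cvec \<Rightarrow> 'n cvec" where
  "nabla \<Gamma> X Y x = vdir_deriv X Y x + \<Gamma> x (X x) (Y x)"

definition levi_civita ::
  "'n::finite cvec set \<Rightarrow> ('n cvec \<Rightarrow> 'n cvec \<Rightarrow> 'n cvec \<Rightarrow> complex) \<Rightarrow>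
   ('n cvec \<Rightarrow> 'n cvec \<Rightarrow> 'n cvec \<Rightarrow> 'n cvec) \<Rightarrow> bool" where
  "levi_civita M g \<Gamma> \<longleftrightarrow>
     holo_tensor12 M \<Gamma> \<and>
     (\<forall>X Y. vholo_on X M \<and> vholo_on Y M \<longrightarrow>
        (\<forall>x\<in>M. nabla \<Gamma> X Y x - nabla \<Gamma> Y X x = lie_bracket X Y x)) \<and>
     (\<forall>X Y Z. vholo_on X M \<and> vholo_on Y M \<and> vholo_on Z M \<longrightarrow>
        (\<forall>x\<in>M. dir_deriv X (\<lambda>y. g y (Y y) (Z y)) x =
                 g x (nabla \<Gamma> X Y x) (Z x) + g x (Y x) (nabla \<Gamma> X Z x)))"

definition frobenius_manifold ::
  "'n::finite cvec set \<Rightarrow> ('n cvec \<Rightarrow> 'n cvec \<Rightarrow> 'n cvec \<Rightarrow> 'n cvec) \<Rightarrow> ('n cvec \<Rightarrow> 'n cvec) \<Rightarrow>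
   ('n cvec \<Rightarrow> 'n cvec \<Rightarrow> 'n cvec \<Rightarrow> complex) \<Rightarrow> ('n cvec \<Rightarrow> 'n cvec \<Rightarrow> 'n cvec \<Rightarrow> 'n cvec) \<Rightarrow> bool" where
  "frobenius_manifold M mul E g \<Gamma> \<longleftrightarrow>
     open M \<and>
     holo_tensor12 M mul \<and>
     (\<forall>x\<in>M. \<forall>u v. mul x u v = mul x v u) \<and>
     (\<forall>x\<in>M. \<forall>u v w. mul x (mul x u v) w = mul x u (mul x v w)) \<and>
     vholo_on E M \<and> (\<forall>x\<in>M. \<forall>v. mul x (E x) v = v) \<and>
     holo_tensor02 M g \<and> (\<forall>x\<in>M. (\<forall>u v. g x u v = g x v u) \<and> nondegenerate (g x)) \<and>
     levi_civita M g \<Gamma> \<and>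
     (\<forall>X Y Z. vholo_on X M \<and> vholo_on Y M \<and> vholo_on Z M \<longrightarrow>
        (\<forall>x\<in>M. nabla \<Gamma> X (nabla \<Gamma> Y Z) x - nabla \<Gamma> Y (nabla \<Gamma> X Z) x
                 - nabla \<Gamma> (lie_bracket X Y) Z x = 0)) \<and>
     (\<forall>X. vholo_on X M \<longrightarrow> (\<forall>x\<in>M. nabla \<Gamma> X E x = 0)) \<and>
     (\<forall>x\<in>M. \<forall>u v w. g x (mul x u v) w = g x v (mul x u w)) \<and>
     (\<forall>X Y Z. vholo_on X M \<and> vholo_on Y M \<and> vholo_on Z M \<longrightarrow>
        (\<forall>x\<in>M. nabla \<Gamma> X (\<lambda>y. mul y (Y y) (Z y)) x - nabla \<Gamma> Y (\<lambda>y. mul y (X y) (Z y)) x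
                 + mul x (X x) (nabla \<Gamma> Y Z x) - mul x (Y x) (nabla \<Gamma> X Z x)
                 - mul x (lie_bracket X Y x) (Z x) = 0))"

text \<open>
  A closed embedding of the germ of the \<open>q\<close>-space at \<open>s\<close> into the germ of \<open>M\<close> at \<open>x\<close>,
  defined on the neighbourhood \<open>W\<close> of \<open>s\<close>; its image is closed in a neighbourhood of \<open>x\<close>.
\<close>

definition closed_embedding_germ ::
  "('n::finite \<Rightarrow> nat) \<Rightarrow> 'n cvec set \<Rightarrow> 'n cvec \<Rightarrow> 'n cvec set \<Rightarrow> 'n cvec \<Rightarrow> ('n cvec \<Rightarrow> 'n cvec) \<Rightarrow> bool" where
  "closed_embedding_germ td W s M x \<iota> \<longleftrightarrow>
     openin (top_of_set (qspace td)) W \<and> s \<in> W \<and> \<iota> s = x \<and>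
     vholo_on \<iota> W \<and>
     (\<forall>q\<in>W. \<forall>v\<in>qspace td. (\<Sum>j\<in>{j. td j = 2}. v $ j *s vpd j \<iota> q) = 0 \<longrightarrow> v = 0) \<and>
     (\<exists>\<kappa>. homeomorphism W (\<iota> ` W) \<iota> \<kappa>) \<and>
     (\<exists>M'. open M' \<and> x \<in> M' \<and> M' \<subseteq> M \<and> closedin (top_of_set M') (\<iota> ` W))"

text \<open>
  \<open>alg q\<close> is the multiplication of the family of algebras at \<open>q\<close>, the family being defined on
  \<open>S\<close>; \<open>\<Psi> q\<close> is the trivialization of the pulled back tangent bundle at \<open>q\<close>.  The last
  condition compares the pulled back connection with the trivial one on sections \<open>\<sigma>\<close>.
\<close>

definition unfolds ::
  "('n::finite cvec \<Rightarrow> 'n cvec \<Rightarrow> complex) \<Rightarrow> 'n cvec \<Rightarrow> ('n \<Rightarrow> nat) \<Rightarrow> ('n \<Rightarrow> 'n cvec) \<Rightarrow>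
   ('n cvec \<Rightarrow> 'n cvec \<Rightarrow> 'n cvec \<Rightarrow> 'n cvec) \<Rightarrow> 'n cvec set \<Rightarrow> 'n cvec \<Rightarrow>
   'n cvec set \<Rightarrow> 'n cvec \<Rightarrow> ('n cvec \<Rightarrow> 'n cvec \<Rightarrow> 'n cvec \<Rightarrow> 'n cvec) \<Rightarrow> ('n cvec \<Rightarrow> 'n cvec) \<Rightarrow>
   ('n cvec \<Rightarrow> 'n cvec \<Rightarrow> 'n cvec \<Rightarrow> complex) \<Rightarrow> ('n cvec \<Rightarrow> 'n cvec \<Rightarrow> 'n cvec \<Rightarrow> 'n cvec) \<Rightarrow> bool" where
  "unfolds B e td T alg S s M x mul E g \<Gamma> \<longleftrightarrow>
     (\<exists>W \<iota> \<Psi>.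
        W \<subseteq> S \<and> closed_embedding_germ td W s M x \<iota> \<and>
        (\<forall>q\<in>W. clin (\<Psi> q) \<and> bij (\<Psi> q)) \<and> (\<forall>i. vholo_on (\<lambda>q. \<Psi> q (axis i 1)) W) \<and>
        (\<forall>q\<in>W. \<forall>j. td j = 2 \<longrightarrow> \<Psi> q ((2 * of_real pi * \<i> * q $ j) *s vpd j \<iota> q) = T j) \<and>
        (\<forall>q\<in>W. \<Psi> q (E (\<iota> q)) = e) \<and>
        (\<forall>q\<in>W. \<forall>u v. B (\<Psi> q u) (\<Psi> q v) = g (\<iota> q) u v) \<and>
        (\<forall>q\<in>W. \<forall>u v. \<Psi> q (mul (\<iota> q) u v) = alg q (\<Psi> q u) (\<Psi> q v)) \<and>
        (\<forall>\<sigma>. vholo_on \<sigma> W \<longrightarrow>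
           (\<forall>q\<in>W. \<forall>j. td j = 2 \<longrightarrow>
              \<Psi> q (vpd j \<sigma> q + \<Gamma> (\<iota> q) (vpd j \<iota> q) (\<sigma> q)) = vpd j (\<lambda>p. \<Psi> p (\<sigma> p)) q)))"

end

theory Submission
  imports Defs "HOL-Complex_Analysis.Cauchy_Integral_Formula"
begin

text \<open>
  In the flat coordinates \<open>z\<close> attached to the basis \<open>T\<close>, a Frobenius manifold with constant metric
  \<open>B\<close> and constant unit \<open>e\<close> is a family of operators \<open>C a z\<close>, the multiplications by \<open>T a\<close>, which
  commute, are self-adjoint, satisfy \<open>C a z e = T a\<close>, and are closed: the derivative of \<open>C b\<close> in
  direction \<open>a\<close> is the derivative of \<open>C a\<close> in direction \<open>b\<close> (theorem \<open>flat_frobenius_manifold\<close>).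
  The quantum module prescribes \<open>C j\<close> for the \<open>j\<close> of degree 2, as an operator \<open>Q j z\<close> that depends
  only on the coordinates of degree 2.  Where these operators generate, all \<open>C a\<close> are determined on the
  subspace on which the coordinates of degree at least 4 vanish: \<open>C a\<close> is the only operator that commutes
  with the generators and maps \<open>e\<close> to \<open>T a\<close>.  The problem is to extend the operators to the
  remaining coordinates.

  The grading turns this into a terminating algebraic recursion.  Give a coordinate of degree \<open>d\<close> the
  weight \<open>d / 2 - 1\<close>.  Homogeneity with respect to these weights, combined with closedness, says that
  \<open>euler (A j) = A j + \<partial>\<^sub>j U\<close>, where \<open>euler\<close> is the commutator with the grading operator and \<open>U\<close> is the
  sum of the \<open>C c\<close>, each multiplied by its coordinate and by the weight of that coordinate.  The operator
  \<open>U\<close> is an algebraic function of the generators \<open>A j\<close>, and in the equation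
  \<open>A j = Q j + (euler - 1)\<^sup>-\<^sup>1 \<partial>\<^sub>j U\<close> the part of \<open>A j\<close> that raises the degree by a given amount
  depends only on the parts that raise it by less.  Operators that raise the degree by more than \<open>2 * k\<close>
  vanish, so Picard iteration becomes stationary after finitely many steps (\<open>picard_fixed_point\<close>), and
  no question of convergence arises.

  The fixed point has all required properties.  Each possible defect, namely a commutator of two
  generators, the difference of a generator and its adjoint, or the failure of closedness, satisfies a
  linear equation from which one reads off that if it raises degrees by \<open>d\<close>, then it raises them by
  \<open>d + 2\<close>; hence it is zero (\<open>A_comm\<close>, \<open>A_sym\<close>, \<open>flatness_gap\<close>).  The properties pass from the
  generators to all \<open>C a\<close> because an operator which kills \<open>e\<close> and commutes with the generators is zero
  (\<open>centralizer_faithful\<close>).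

  It remains to see that the quantum module provides such initial data.  The third derivatives of the potential
  are the structure constants of the classical module plus functions of \<open>q\<close> that tend to 0 with \<open>q\<close>
  (\<open>quantum_third_derivatives\<close>).  So the vectors that certify generation for the classical module remain
  a basis for small \<open>q\<close>, by continuity of a determinant (\<open>higgs_field\<close>).  Near a point with nonzero
  coordinates the \<open>q\<close>-space is embedded into the flat coordinates by a local branch of the logarithm.
\<close>

section \<open>Holomorphic functions of several variables\<close>

lemma along_coordinate_norm: "norm (t *s axis i 1 :: complex^'n) = norm (t::complex)"
proof -
  have "(t *s axis i 1 :: complex^'n) = axis i t"
    by (simp add: vec_eq_iff axis_def)
  moreover have "norm (axis i t :: complex^'n) = norm t"
    by (simp add: norm_vec_def L2_set_def axis_def if_distrib[of norm] if_distrib[of "\<lambda>x. x\<^sup>2"] cong: if_cong)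
  ultimately show ?thesis by simp
qed

lemma linear_functional_expand:
  assumes "Vector_Spaces.linear (*s) (*) (D :: complex^'n \<Rightarrow> complex)"
  shows "D v = (\<Sum>i\<in>UNIV. v $ i * D (axis i 1))"
proof -
  interpret D: Vector_Spaces.linear "(*s)" "(*)" D by fact
  have "v = (\<Sum>i\<in>UNIV. v $ i *s axis i 1)" by (simp add: basis_expansion)
  then have "D v = D (\<Sum>i\<in>UNIV. v $ i *s axis i 1)" by simp
  also have "\<dots> = (\<Sum>i\<in>UNIV. v $ i * D (axis i 1))" by (simp add: D.sum D.scale)
  finally show ?thesis .
qed

lemma linear_functional_coeffs:
  "Vector_Spaces.linear (*s) (*) (\<lambda>v::complex^'n. \<Sum>i\<in>UNIV. v $ i * d i)"
  by unfold_locales (simp_all add: algebra_simps sum.distrib sum_distrib_left)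

lemma coordinate_line_has_derivative:
  "((\<lambda>t. x + t *s axis i 1 :: complex^'n) has_derivative (\<lambda>t. t *s axis i 1)) (at t0)"
proof -
  have "linear (\<lambda>t::complex. t *s axis i 1 :: complex^'n)"
    by (rule linearI) (simp_all add: vec_eq_iff algebra_simps)
  then have "bounded_linear (\<lambda>t::complex. t *s axis i 1 :: complex^'n)"
    by (simp add: linear_conv_bounded_linear)
  then have "((\<lambda>t::complex. t *s axis i 1 :: complex^'n) has_derivative (\<lambda>t. t *s axis i 1)) (at t0)"
    by (rule bounded_linear.has_derivative[OF _ has_derivative_ident])
  then show ?thesis using has_derivative_add[OF has_derivative_const[of x]] by fastforce
qed

lemma pd_has_field_derivative_at:
  assumes D: "(f has_derivative D) (at (x + t0 *s axis i 1))" and lin: "Vector_Spaces.linear (*s) (*) (D :: complex^'n \<Rightarrow> complex)"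
  shows "((\<lambda>t. f (x + t *s axis i 1)) has_field_derivative D (axis i 1)) (at t0)"
proof -
  interpret D: Vector_Spaces.linear "(*s)" "(*)" D by fact
  have "((\<lambda>t. f (x + t *s axis i 1)) has_derivative (\<lambda>t. D (t *s axis i 1))) (at t0)"
    using has_derivative_compose[OF coordinate_line_has_derivative, of f D x t0 i] D by simp
  moreover have "(\<lambda>t. D (t *s axis i 1)) = (*) (D (axis i 1))"
    by (simp add: D.scale fun_eq_iff)
  ultimately show ?thesis
    by (simp add: has_field_derivative_def)
qed

lemma holo_on_pd:
  assumes "holo_on f Z" "open Z" "x \<in> Z"
  shows "(f has_derivative (\<lambda>v. \<Sum>i\<in>UNIV. v $ i * pd i f x)) (at x)"
    "((\<lambda>t. f (x + t *s axis i 1)) has_field_derivative pd i f x) (at 0)"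
proof -
  obtain D where D: "Vector_Spaces.linear (*s) (*) D" "(f has_derivative D) (at x)"
    using assms by (metis holo_on_def at_within_open)
  have der: "((\<lambda>t. f (x + t *s axis i 1)) has_field_derivative D (axis i 1)) (at 0)" for i
    by (rule pd_has_field_derivative_at) (simp_all add: D)
  have pdD: "pd i f x = D (axis i 1)" for i
    unfolding pd_def by (rule DERIV_imp_deriv[OF der])
  have "D = (\<lambda>v. \<Sum>i\<in>UNIV. v $ i * pd i f x)"
    unfolding pdD by (rule ext) (rule linear_functional_expand[OF D(1)])
  with D(2) show "(f has_derivative (\<lambda>v. \<Sum>i\<in>UNIV. v $ i * pd i f x)) (at x)" by simp
  show "((\<lambda>t. f (x + t *s axis i 1)) has_field_derivative pd i f x) (at 0)"
    using der pdD by simp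
qed

lemma eventually_coordinate_line:
  fixes x :: "complex^'n"
  assumes "open Z" "x + t0 *s axis i 1 \<in> Z"
  shows "eventually (\<lambda>t. x + t *s axis i 1 \<in> Z) (nhds t0)"
proof -
  have "isCont (\<lambda>t. x + t *s axis i 1) t0"
    using coordinate_line_has_derivative by (rule has_derivative_continuous)
  then have "((\<lambda>t. x + t *s axis i 1) \<longlongrightarrow> x + t0 *s axis i 1) (nhds t0)"
    using tendsto_at_iff_tendsto_nhds[of "\<lambda>t. x + t *s axis i 1" t0] by (simp add: isCont_def)
  then show ?thesis using assms by (rule topological_tendstoD)
qed

lemma pd_cong:
  assumes "open Z" "x \<in> Z" "\<And>y. y \<in> Z \<Longrightarrow> f y = g y"
  shows "pd i f x = pd i g x"
  unfolding pd_def
  by (rule deriv_cong_ev) (use eventually_coordinate_line[of Z x 0 i] assms in \<open>auto elim: eventually_mono\<close>)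

text \<open>
  Osgood's notion of holomorphy.  It passes to limits and derivatives by one-variable theory, and it
  turns out to be equivalent to complex Frechet differentiability on open sets.
\<close>
definition sepholo :: "(complex^'n \<Rightarrow> complex) \<Rightarrow> (complex^'n) set \<Rightarrow> bool" where
  "sepholo f Z \<longleftrightarrow> continuous_on Z f \<and>
     (\<forall>x\<in>Z. \<forall>i. (\<lambda>t. f (x + t *s axis i 1)) field_differentiable at 0)"

lemma holo_on_imp_sepholo:
  assumes "holo_on f Z" "open Z" shows "sepholo f Z"
  unfolding sepholo_def
proof (intro conjI ballI allI)
  show "continuous_on Z f"
    using holo_on_pd(1)[OF assms] has_derivative_continuous by (blast intro: continuous_at_imp_continuous_on)
  show "(\<lambda>t. f (x + t *s axis i 1)) field_differentiable at 0" if "x \<in> Z" for x i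
    using holo_on_pd(2)[OF assms that] by (auto simp: field_differentiable_def)
qed

lemma sepholo_line:
  fixes x :: "complex^'n"
  assumes "sepholo f Z" "\<And>t. t \<in> U \<Longrightarrow> x + t *s axis i 1 \<in> Z"
  shows "(\<lambda>t. f (x + t *s axis i 1)) holomorphic_on U"
    and "t \<in> U \<Longrightarrow> ((\<lambda>t. f (x + t *s axis i 1)) has_field_derivative pd i f (x + t *s axis i 1)) (at t)"
proof -
  have *: "((\<lambda>t. f (x + t *s axis i 1)) has_field_derivative pd i f (x + t *s axis i 1)) (at t)"
    if "t \<in> U" for t
  proof -
    have shift: "x + t *s axis i 1 + u *s axis i 1 = x + (u + t) *s axis i 1" for u
      by (simp add: vec_eq_iff algebra_simps)
    have "(\<lambda>u. f ((x + t *s axis i 1) + u *s axis i 1)) field_differentiable at 0"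
      using assms that unfolding sepholo_def by blast
    then have "((\<lambda>u. f ((x + t *s axis i 1) + u *s axis i 1)) has_field_derivative pd i f (x + t *s axis i 1)) (at 0)"
      unfolding pd_def by (simp add: DERIV_deriv_iff_field_differentiable)
    then have "((\<lambda>u. f (x + (u + t) *s axis i 1)) has_field_derivative pd i f (x + t *s axis i 1)) (at 0)"
      using shift by simp
    then show ?thesis using DERIV_shift[of "\<lambda>t. f (x + t *s axis i 1)" _ 0 t] by simp
  qed
  show "t \<in> U \<Longrightarrow> ((\<lambda>t. f (x + t *s axis i 1)) has_field_derivative pd i f (x + t *s axis i 1)) (at t)"
    by (rule *)
  show "(\<lambda>t. f (x + t *s axis i 1)) holomorphic_on U"
    using * by (auto simp: holomorphic_on_def field_differentiable_def intro: has_field_derivative_at_within)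
qed

lemma norm_coordinate_step: "norm (x + t *s axis i 1 - y :: complex^'n) \<le> norm (x - y) + norm t"
proof -
  have "x + t *s axis i 1 - y = (x - y) + t *s axis i 1" by simp
  then show ?thesis
    using norm_triangle_ineq[of "x - y" "t *s axis i 1"] along_coordinate_norm[of t i] by metis
qed

text \<open>
  Cauchy's inequality bounds the second derivative along a coordinate line by a constant that does not
  depend on the base point; by Taylor's formula the error of the difference quotient is at most this
  constant times \<open>norm h\<close>.
\<close>
lemma difference_quotient_uniform_limit:
  fixes x0 :: "complex^'n"
  assumes f: "sepholo f Z" and r: "0 < r" and Z: "cball x0 (3 * r) \<subseteq> Z"
  shows "uniform_limit (cball x0 r) (\<lambda>h x. (f (x + h *s axis i 1) - f x) / h) (pd i f) (at 0)"
proof -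
  have "continuous_on (cball x0 (3 * r)) f"
    using f Z by (auto simp: sepholo_def intro: continuous_on_subset)
  then have "bounded (f ` cball x0 (3 * r))"
    by (intro compact_imp_bounded compact_continuous_image compact_cball)
  then obtain M where M: "0 < M" "\<And>y. y \<in> cball x0 (3 * r) \<Longrightarrow> norm (f y) \<le> M"
    by (auto simp: bounded_pos)
  define C where "C = 2 * M / r\<^sup>2"
  have C: "0 < C" using M r by (simp add: C_def)
  have bound: "norm ((f (x + h *s axis i 1) - f x) / h - pd i f x) \<le> C * norm h"
    if x: "x \<in> cball x0 r" and h: "norm h \<le> r" "h \<noteq> 0" for x h
  proof -
    define \<psi> where "\<psi> = (\<lambda>t. f (x + t *s axis i 1))"
    have inZ: "x + t *s axis i 1 \<in> cball x0 (3 * r)" if "t \<in> cball 0 (2 * r)" for t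
      using norm_coordinate_step[of x t i x0] that x by (simp add: dist_norm norm_minus_commute)
    have hol: "\<psi> holomorphic_on cball 0 (2 * r)"
      unfolding \<psi>_def using inZ Z by (intro sepholo_line[OF f]) auto
    then have hol': "\<psi> holomorphic_on ball 0 (2 * r)" by (rule holomorphic_on_subset) auto
    have d0: "(\<psi> has_field_derivative pd i f (x + t *s axis i 1)) (at t)" if "t \<in> cball 0 r" for t
      unfolding \<psi>_def using inZ Z that r by (intro sepholo_line(2)[OF f, of "cball 0 (2*r)"]) auto
    have d1: "(\<psi> has_field_derivative deriv \<psi> t) (at t)" if "t \<in> cball 0 r" for t
      using hol' that r by (intro holomorphic_derivI[of _ "ball 0 (2*r)"]) auto
    have d2: "(deriv \<psi> has_field_derivative deriv (deriv \<psi>) t) (at t)" if "t \<in> cball 0 r" for t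
      using holomorphic_deriv[OF hol'] that r by (intro holomorphic_derivI[of _ "ball 0 (2*r)"]) auto
    have B: "norm (deriv (deriv \<psi>) t) \<le> C" if "t \<in> cball 0 r" for t
    proof -
      have sub: "cball t r \<subseteq> cball 0 (2 * r)"
      proof
        fix u assume "u \<in> cball t r"
        then have "norm u \<le> norm t + r"
          using norm_triangle_ineq2[of u t] by (auto simp: dist_norm norm_minus_commute)
        then show "u \<in> cball 0 (2 * r)" using that by auto
      qed
      have "norm ((deriv ^^ 2) \<psi> t) \<le> fact 2 * M / r ^ 2"
      proof (rule Cauchy_inequality)
        show "\<psi> holomorphic_on ball t r"
          by (rule holomorphic_on_subset[OF hol]) (use sub in auto)
        show "continuous_on (cball t r) \<psi>"
          using holomorphic_on_imp_continuous_on[OF hol] sub continuous_on_subset by blast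
        show "norm (\<psi> u) \<le> M" if "norm (t - u) = r" for u
          unfolding \<psi>_def using sub that by (intro M inZ) (auto simp: dist_norm)
      qed (use r in auto)
      then show ?thesis by (simp add: C_def eval_nat_numeral)
    qed
    have "cmod (rec_nat \<psi> (\<lambda>_. deriv) 0 h -
        (\<Sum>k\<le>1. rec_nat \<psi> (\<lambda>_. deriv) k 0 * (h - 0) ^ k / fact k)) \<le> C * cmod (h - 0) ^ Suc 1 / fact 1"
      by (rule complex_Taylor[where S = "cball 0 r"])
        (use h r B d1 d2 in \<open>auto simp: le_Suc_eq intro: has_field_derivative_at_within\<close>)
    then have T: "norm (\<psi> h - (\<psi> 0 + deriv \<psi> 0 * h)) \<le> C * (norm h)\<^sup>2"
      by (simp add: eval_nat_numeral)
    have "deriv \<psi> 0 = pd i f x" using d0[of 0] r by (auto intro!: DERIV_imp_deriv)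
    then have "((f (x + h *s axis i 1) - f x) / h - pd i f x) * h = \<psi> h - (\<psi> 0 + deriv \<psi> 0 * h)"
      using h by (simp add: \<psi>_def algebra_simps diff_divide_distrib)
    then have "norm (((f (x + h *s axis i 1) - f x) / h - pd i f x) * h) \<le> C * (norm h)\<^sup>2"
      using T by simp
    then show ?thesis using h by (simp add: norm_mult power2_eq_square)
  qed
  show ?thesis
    unfolding uniform_limit_iff
  proof (intro allI impI)
    fix e :: real assume e: "0 < e"
    define d where "d = min r (e / (2 * C))"
    have d: "0 < d" using e C r by (simp add: d_def)
    show "\<forall>\<^sub>F h in at 0. \<forall>x\<in>cball x0 r. dist ((f (x + h *s axis i 1) - f x) / h) (pd i f x) < e"
      unfolding eventually_at
    proof (intro exI conjI ballI impI, rule d)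
      fix h :: complex and x assume h: "h \<noteq> 0 \<and> dist h 0 < d" and x: "x \<in> cball x0 r"
      then have "norm h \<le> r" "norm h < e / (2 * C)" by (auto simp: d_def)
      then have "C * norm h < e" using C e by (simp add: field_simps)
      then show "dist ((f (x + h *s axis i 1) - f x) / h) (pd i f x) < e"
        using bound[OF x \<open>norm h \<le> r\<close>] h by (auto simp: dist_norm)
    qed
  qed
qed

text \<open>
  A locally uniform limit of holomorphic functions is holomorphic, and its derivative is the limit of the
  derivatives.  Applied to the difference quotients in direction \<open>i\<close> on lines in direction \<open>j\<close>, this
  gives holomorphy of \<open>pd i f\<close>; and since the derivatives are difference quotients of \<open>pd j f\<close>,
  their limit is \<open>pd i (pd j f)\<close>, which proves the symmetry.
\<close>
lemma
  fixes f :: "complex^'n \<Rightarrow> complex"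
  assumes f: "sepholo f Z" and Z: "open Z"
  shows sepholo_pd: "sepholo (pd i f) Z"
    and sepholo_pd_commute: "x \<in> Z \<Longrightarrow> pd j (pd i f) x = pd i (pd j f) x"
proof -
  have main: "isCont (pd i f) x0 \<and> (\<lambda>t. pd i f (x0 + t *s axis j 1)) field_differentiable at 0
      \<and> pd j (pd i f) x0 = pd i (pd j f) x0"
    if x0: "x0 \<in> Z" for x0 j
  proof -
    obtain R where R: "0 < R" "cball x0 R \<subseteq> Z"
      using Z x0 open_contains_cball by blast
    define r where "r = R / 3"
    have r: "0 < r" "cball x0 (3 * r) \<subseteq> Z" using R by (auto simp: r_def)
    have small: "cball x0 r \<subseteq> Z" using r by auto
    note ul = difference_quotient_uniform_limit[OF f r, of i]
    have shift_in: "x + h *s axis l 1 \<in> Z" if "x \<in> cball x0 r" "norm h \<le> r" for x h l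
      using norm_coordinate_step[of x h l x0] that r by (auto simp: dist_norm norm_minus_commute)
    have near: "\<forall>\<^sub>F h in at (0::complex). h \<noteq> 0 \<and> norm h \<le> r"
      unfolding eventually_at using r by (intro exI[of _ r]) auto
    have contf: "continuous_on Z f" using f by (simp add: sepholo_def)
    have "continuous_on (cball x0 r) (pd i f)"
    proof (rule uniform_limit_theorem[OF _ ul])
      show "\<forall>\<^sub>F h in at 0. continuous_on (cball x0 r) (\<lambda>x. (f (x + h *s axis i 1) - f x) / h)"
        using near
      proof eventually_elim
        case (elim h)
        then show ?case
          using small shift_in
          by (intro continuous_intros continuous_on_compose2[OF contf]) (auto intro: continuous_on_subset[OF contf])
      qed
    qed simp
    then have c: "isCont (pd i f) x0"
      using r by (auto intro: continuous_on_interior)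
    define G where "G = (\<lambda>h t. (f (x0 + t *s axis j 1 + h *s axis i 1) - f (x0 + t *s axis j 1)) / h)"
    define G' where "G' = (\<lambda>h t. (pd j f (x0 + t *s axis j 1 + h *s axis i 1) - pd j f (x0 + t *s axis j 1)) / h)"
    have cb: "x0 + t *s axis j 1 \<in> cball x0 r" if "t \<in> cball 0 r" for t
      using norm_coordinate_step[of x0 t j x0] that by (simp add: dist_norm norm_minus_commute)
    have ulG: "uniform_limit (cball 0 r) G (\<lambda>t. pd i f (x0 + t *s axis j 1)) (at 0)"
      using ul cb unfolding uniform_limit_iff G_def by (fast elim: eventually_mono)
    have dG: "(G h has_field_derivative G' h t) (at t)" if "h \<noteq> 0" "norm h \<le> r" "t \<in> cball 0 r" for h t
    proof -
      have sw: "x0 + u *s axis j 1 + h *s axis i 1 = (x0 + h *s axis i 1) + u *s axis j 1" for u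
        by (simp add: algebra_simps)
      have "((\<lambda>t. f ((x0 + h *s axis i 1) + t *s axis j 1)) has_field_derivative
            pd j f ((x0 + h *s axis i 1) + t *s axis j 1)) (at t)"
        by (rule sepholo_line(2)[OF f, of "cball 0 r"])
           (use that shift_in[OF cb] in \<open>auto simp flip: sw\<close>)
      moreover have "((\<lambda>t. f (x0 + t *s axis j 1)) has_field_derivative pd j f (x0 + t *s axis j 1)) (at t)"
        using that cb small by (intro sepholo_line(2)[OF f, of "cball 0 r"]) auto
      ultimately show ?thesis
        unfolding G_def G'_def sw by (intro DERIV_cdivide DERIV_diff)
    qed
    obtain g' where g': "\<And>w. w \<in> ball 0 r \<Longrightarrow>
        ((\<lambda>t. pd i f (x0 + t *s axis j 1)) has_field_derivative g' w) (at w) \<and> ((\<lambda>h. G' h w) \<longlongrightarrow> g' w) (at 0)"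
    proof (rule has_complex_derivative_uniform_limit[of 0 r G G' "at 0"])
      show "\<forall>\<^sub>F h in at 0. continuous_on (cball 0 r) (G h) \<and> (\<forall>w\<in>ball 0 r. (G h has_field_derivative G' h w) (at w))"
        using near
      proof eventually_elim
        case (elim h)
        then have "(G h has_field_derivative G' h w) (at w)" if "w \<in> cball 0 r" for w
          using dG that by auto
        then show ?case
          by (auto intro!: continuous_at_imp_continuous_on DERIV_isCont)
      qed
    qed (use ulG r in auto)
    have *: "((\<lambda>t. pd i f (x0 + t *s axis j 1)) has_field_derivative g' 0) (at 0)" "((\<lambda>h. G' h 0) \<longlongrightarrow> g' 0) (at 0)"
      using g'[of 0] r by auto
    have "((\<lambda>t. pd j f (x0 + t *s axis i 1)) has_field_derivative g' 0) (at 0)"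
      using *(2) by (simp add: DERIV_def G'_def)
    then have "pd i (pd j f) x0 = g' 0" by (simp add: pd_def[of i] DERIV_imp_deriv)
    moreover have "pd j (pd i f) x0 = g' 0" using *(1) by (simp add: pd_def[of j] DERIV_imp_deriv)
    ultimately show ?thesis using c *(1) by (auto simp: field_differentiable_def)
  qed
  show "sepholo (pd i f) Z"
    unfolding sepholo_def using main by (auto intro: continuous_at_imp_continuous_on)
  show "pd j (pd i f) x = pd i (pd j f) x" if "x \<in> Z"
    using main[OF that] by blast
qed

text \<open>
  The partial derivatives are continuous.  Along the path from \<open>x\<close> to \<open>y\<close> that changes one coordinate at
  a time, each step therefore changes \<open>f\<close> by the expected linear term, up to a small multiple of the step.
\<close>
lemma sepholo_imp_holo_on:
  fixes f :: "complex^'n \<Rightarrow> complex"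
  assumes f: "sepholo f Z" and Z: "open Z"
  shows "holo_on f Z"
  unfolding holo_on_def
proof
  fix x assume x: "x \<in> Z"
  define D where "D = (\<lambda>v::complex^'n. \<Sum>i\<in>UNIV. v $ i * pd i f x)"
  have linD: "Vector_Spaces.linear (*s) (*) D" unfolding D_def by (rule linear_functional_coeffs)
  have "(f has_derivative D) (at x)"
    unfolding has_derivative_at_alt
  proof (intro conjI allI impI)
    have "linear D"
    proof (rule linearI)
      interpret D: Vector_Spaces.linear "(*s)" "(*)" D by (rule linD)
      show "D (b1 + b2) = D b1 + D b2" for b1 b2 by (rule D.add)
      show "D (r *\<^sub>R b) = r *\<^sub>R D b" for r b
        unfolding D_def by (simp add: scaleR_sum_right)
    qed
    then show "bounded_linear D" by (simp add: linear_conv_bounded_linear)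
    fix e :: real assume e: "0 < e"
    define N where "N = real (card (UNIV :: 'n set))"
    have N: "0 < N" by (simp add: N_def card_gt_0_iff)
    have ev: "\<forall>\<^sub>F y in nhds x. \<forall>i. y \<in> Z \<and> dist (pd i f y) (pd i f x) < e / N"
    proof (rule eventually_all_finite, rule eventually_conj)
      fix i
      show "\<forall>\<^sub>F y in nhds x. y \<in> Z" using Z x by (rule eventually_nhds_in_open)
      have "isCont (pd i f) x"
        using sepholo_pd[OF f Z, of i] Z x by (auto simp: sepholo_def continuous_on_eq_continuous_at)
      then have "(pd i f \<longlongrightarrow> pd i f x) (nhds x)"
        using tendsto_at_iff_tendsto_nhds[of "pd i f" x] by (simp add: isCont_def)
      then show "\<forall>\<^sub>F y in nhds x. dist (pd i f y) (pd i f x) < e / N"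
        using e N by (intro tendstoD) auto
    qed
    then obtain d where d: "0 < d" "\<And>y i. dist y x < d \<Longrightarrow> y \<in> Z \<and> dist (pd i f y) (pd i f x) < e / N"
      unfolding eventually_nhds_metric by blast
    have "norm (f y - f x - D (y - x)) \<le> e * norm (y - x)" if y: "norm (y - x) < d" for y
    proof -
      define v where "v = y - x"
      \<comment> \<open>the corners of the path from \<open>x\<close> to \<open>y\<close>\<close>
      define xs where "xs S = (\<chi> i. if i \<in> S then y $ i else x $ i)" for S
      have near: "norm (xs S + t *s axis i 1 - x) < d" if "i \<notin> S" "norm (t::complex) \<le> norm (v $ i)" for S i t
      proof -
        have "norm (xs S + t *s axis i 1 - x) \<le> norm v"
          by (rule norm_le_componentwise_cart) (use that in \<open>auto simp: xs_def v_def axis_def\<close>)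
        then show ?thesis using y by (simp add: v_def)
      qed
      have step: "norm (f (xs S) - f x - (\<Sum>i\<in>S. v $ i * pd i f x)) \<le> card S * (e / N * norm v)" for S
      proof (induction S rule: infinite_finite_induct)
        case empty
        have "xs {} = x" by (simp add: xs_def vec_eq_iff)
        then show ?case by simp
      next
        case (insert i S)
        define \<psi> where "\<psi> t = f (xs S + t *s axis i 1) - t * pd i f x" for t
        have "norm (\<psi> (v $ i) - \<psi> 0) \<le> e / N * norm (v $ i - 0)"
        proof (rule field_differentiable_bound[of "cball 0 (norm (v $ i))"])
          fix t :: complex assume t: "t \<in> cball 0 (norm (v $ i))"
          have inZ: "xs S + u *s axis i 1 \<in> Z" if "u \<in> cball 0 (norm (v $ i))" for u :: complex
            using near[of i S u] insert that d by (auto simp: dist_norm)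
          have "((\<lambda>t. f (xs S + t *s axis i 1)) has_field_derivative pd i f (xs S + t *s axis i 1)) (at t)"
            by (rule sepholo_line(2)[OF f inZ t])
          then show "(\<psi> has_field_derivative pd i f (xs S + t *s axis i 1) - pd i f x) (at t within cball 0 (norm (v $ i)))"
            unfolding \<psi>_def by (auto intro!: derivative_eq_intros intro: has_field_derivative_at_within)
          show "norm (pd i f (xs S + t *s axis i 1) - pd i f x) \<le> e / N"
            using d(2)[of "xs S + t *s axis i 1" i] near[of i S t] insert t by (auto simp: dist_norm)
        qed auto
        moreover have "xs (insert i S) = xs S + (v $ i) *s axis i 1"
          using insert by (auto simp: xs_def v_def vec_eq_iff axis_def)
        ultimately have "norm (f (xs (insert i S)) - f (xs S) - v $ i * pd i f x) \<le> e / N * norm (v $ i)"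
          by (simp add: \<psi>_def algebra_simps)
        also have "\<dots> \<le> e / N * norm v"
          using e N by (intro mult_left_mono Finite_Cartesian_Product.norm_nth_le) auto
        finally have *: "norm (f (xs (insert i S)) - f (xs S) - v $ i * pd i f x) \<le> e / N * norm v" .
        have eq: "f (xs (insert i S)) - f x - (\<Sum>i\<in>insert i S. v $ i * pd i f x)
            = (f (xs (insert i S)) - f (xs S) - v $ i * pd i f x) + (f (xs S) - f x - (\<Sum>i\<in>S. v $ i * pd i f x))"
          using insert by simp
        show ?case
          unfolding eq using norm_triangle_mono[OF * insert.IH] insert by (simp add: algebra_simps add_divide_distrib)
      qed simp
      have "xs UNIV = y" by (simp add: xs_def vec_eq_iff)
      then show ?thesis using step[of UNIV] N by (simp add: D_def v_def N_def)
    qed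
    then show "\<exists>d>0. \<forall>y. norm (y - x) < d \<longrightarrow> norm (f y - f x - D (y - x)) \<le> e * norm (y - x)"
      using d(1) by blast
  qed
  then show "\<exists>D. Vector_Spaces.linear (*s) (*) D \<and> (f has_derivative D) (at x within Z)"
    using linD has_derivative_at_withinI by blast
qed

section \<open>Calculus of partial derivatives\<close>

lemma holo_onI:
  assumes "\<And>x. x \<in> Z \<Longrightarrow> (f has_derivative (\<lambda>v. \<Sum>i\<in>UNIV. v $ i * d i x)) (at x)"
  shows "holo_on f Z"
  unfolding holo_on_def
proof
  fix x assume "x \<in> Z"
  then show "\<exists>D. Vector_Spaces.linear (*s) (*) D \<and> (f has_derivative D) (at x within Z)"
    using assms linear_functional_coeffs[of "\<lambda>i. d i x"] has_derivative_at_withinI by blast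
qed

lemma pd_eqI:
  assumes "(f has_derivative (\<lambda>v::complex^'n. \<Sum>i\<in>UNIV. v $ i * d i)) (at x)"
  shows "pd i f x = d i"
proof -
  have "((\<lambda>t. f (x + t *s axis i 1)) has_field_derivative (\<Sum>j\<in>UNIV. (axis i 1 :: complex^'n) $ j * d j)) (at 0)"
    by (rule pd_has_field_derivative_at) (simp_all add: assms linear_functional_coeffs)
  also have "(\<Sum>j\<in>UNIV. (axis i 1 :: complex^'n) $ j * d j) = d i"
    by (simp add: axis_def if_distrib[of "\<lambda>x. x * _"] cong: if_cong)
  finally show ?thesis unfolding pd_def by (rule DERIV_imp_deriv)
qed

lemma holo_on_const: "holo_on (\<lambda>_. c) Z" and pd_const: "pd i (\<lambda>_. c) x = 0"
proof -
  have "((\<lambda>_. c) has_derivative (\<lambda>v. \<Sum>i\<in>UNIV. v $ i * 0)) (at x)" for x :: "complex^'n" by simp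
  then show "holo_on (\<lambda>_. c) Z" "pd i (\<lambda>_. c) x = 0"
    by (rule holo_onI, rule pd_eqI)
qed

lemma coordinate_derivative:
  "((\<lambda>x::complex^'n. x $ a) has_derivative (\<lambda>v. \<Sum>i\<in>UNIV. v $ i * (if i = a then 1 else 0))) (at x)"
proof -
  have "(\<lambda>v::complex^'n. \<Sum>i\<in>UNIV. v $ i * (if i = a then 1 else 0)) = (\<lambda>v. v $ a)"
    by (simp add: fun_eq_iff if_distrib[of "(*) _"] cong: if_cong)
  then show ?thesis by (simp add: bounded_linear_imp_has_derivative bounded_linear_vec_nth)
qed

lemma holo_on_coordinate: "holo_on (\<lambda>x. x $ a) Z"
  and pd_coordinate: "pd i (\<lambda>x. x $ a) x = (if i = a then 1 else 0)"
  by (rule holo_onI, rule coordinate_derivative) (rule pd_eqI, rule coordinate_derivative)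

lemma
  assumes "holo_on f Z" "holo_on g Z" "open Z"
  shows holo_on_add: "holo_on (\<lambda>x. f x + g x) Z"
    and pd_add: "x \<in> Z \<Longrightarrow> pd i (\<lambda>x. f x + g x) x = pd i f x + pd i g x"
proof -
  have *: "((\<lambda>x. f x + g x) has_derivative (\<lambda>v. \<Sum>i\<in>UNIV. v $ i * (pd i f x + pd i g x))) (at x)" if "x \<in> Z" for x
    using has_derivative_add[OF holo_on_pd(1)[OF assms(1,3) that] holo_on_pd(1)[OF assms(2,3) that]]
    by (simp add: algebra_simps sum.distrib)
  show "holo_on (\<lambda>x. f x + g x) Z" by (rule holo_onI, rule *)
  show "x \<in> Z \<Longrightarrow> pd i (\<lambda>x. f x + g x) x = pd i f x + pd i g x" by (rule pd_eqI, rule *)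
qed

lemma
  assumes "holo_on f Z" "holo_on g Z" "open Z"
  shows holo_on_mult: "holo_on (\<lambda>x. f x * g x) Z"
    and pd_mult: "x \<in> Z \<Longrightarrow> pd i (\<lambda>x. f x * g x) x = pd i f x * g x + f x * pd i g x"
proof -
  have *: "((\<lambda>x. f x * g x) has_derivative (\<lambda>v. \<Sum>i\<in>UNIV. v $ i * (pd i f x * g x + f x * pd i g x))) (at x)" if "x \<in> Z" for x
    using has_derivative_mult[OF holo_on_pd(1)[OF assms(1,3) that] holo_on_pd(1)[OF assms(2,3) that]]
    by (simp add: algebra_simps sum.distrib sum_distrib_left)
  show "holo_on (\<lambda>x. f x * g x) Z" by (rule holo_onI, rule *)
  show "x \<in> Z \<Longrightarrow> pd i (\<lambda>x. f x * g x) x = pd i f x * g x + f x * pd i g x" by (rule pd_eqI, rule *)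
qed

lemma holo_on_cmult: "holo_on f Z \<Longrightarrow> open Z \<Longrightarrow> holo_on (\<lambda>x. c * f x) Z"
  by (rule holo_on_mult[OF holo_on_const])

lemma pd_cmult: "holo_on f Z \<Longrightarrow> open Z \<Longrightarrow> x \<in> Z \<Longrightarrow> pd i (\<lambda>x. c * f x) x = c * pd i f x"
  using pd_mult[OF holo_on_const[of c Z], of f x i] by (simp add: pd_const)

lemma holo_on_diff:
  assumes "holo_on f Z" "holo_on g Z" "open Z"
  shows "holo_on (\<lambda>x. f x - g x) Z"
  using holo_on_add[OF assms(1) holo_on_cmult[OF assms(2,3), of "-1"] assms(3)] by simp

lemma pd_diff:
  assumes "holo_on f Z" "holo_on g Z" "open Z" "x \<in> Z"
  shows "pd i (\<lambda>x. f x - g x) x = pd i f x - pd i g x"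
  using pd_add[OF assms(1) holo_on_cmult[OF assms(2,3), of "-1"] assms(3,4)] pd_cmult[OF assms(2-4), of i "-1"] by simp

lemma holo_on_sum:
  assumes "\<And>j. j \<in> S \<Longrightarrow> holo_on (f j) Z" "open Z"
  shows "holo_on (\<lambda>x. \<Sum>j\<in>S. f j x) Z"
  using assms by (induction S rule: infinite_finite_induct) (auto intro: holo_on_const holo_on_add)

lemma pd_sum:
  assumes "\<And>j. j \<in> S \<Longrightarrow> holo_on (f j) Z" "open Z" "x \<in> Z"
  shows "pd i (\<lambda>x. \<Sum>j\<in>S. f j x) x = (\<Sum>j\<in>S. pd i (f j) x)"
  using assms
proof (induction S rule: infinite_finite_induct)
  case (insert a S)
  then show ?case by (simp add: pd_add[of "f a" Z "\<lambda>x. \<Sum>j\<in>S. f j x"] holo_on_sum)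
qed (auto simp: pd_const)

lemma holo_on_prod:
  assumes "\<And>j. j \<in> S \<Longrightarrow> holo_on (f j) Z" "open Z"
  shows "holo_on (\<lambda>x. \<Prod>j\<in>S. f j x) Z"
  using assms by (induction S rule: infinite_finite_induct) (auto intro: holo_on_const holo_on_mult)

lemma holo_on_inverse:
  assumes "holo_on f Z" "open Z" "\<And>x. x \<in> Z \<Longrightarrow> f x \<noteq> 0"
  shows "holo_on (\<lambda>x. inverse (f x)) Z"
proof (rule holo_onI)
  fix x assume "x \<in> Z"
  then show "((\<lambda>x. inverse (f x)) has_derivative (\<lambda>v. \<Sum>i\<in>UNIV. v $ i * (- (inverse (f x) * pd i f x * inverse (f x))))) (at x)"
    using Deriv.has_derivative_inverse[OF assms(3) holo_on_pd(1)[OF assms(1,2)]]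
    by (simp add: algebra_simps sum_distrib_left sum_negf)
qed

lemma holo_on_subset: "holo_on f Z \<Longrightarrow> Y \<subseteq> Z \<Longrightarrow> holo_on f Y"
  unfolding holo_on_def by (meson has_derivative_subset subset_iff)

lemma holo_on_cong: "(\<And>x. x \<in> Z \<Longrightarrow> f x = g x) \<Longrightarrow> holo_on f Z \<longleftrightarrow> holo_on g Z"
  unfolding holo_on_def by (metis has_derivative_transform)

lemma holo_on_partial: "holo_on f Z \<Longrightarrow> open Z \<Longrightarrow> holo_on (pd i f) Z"
  by (simp add: holo_on_imp_sepholo sepholo_imp_holo_on sepholo_pd)

lemma pd_commute: "holo_on f Z \<Longrightarrow> open Z \<Longrightarrow> x \<in> Z \<Longrightarrow> pd j (pd i f) x = pd i (pd j f) x"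
  using sepholo_pd_commute[OF holo_on_imp_sepholo] by blast

lemma pd_norm_le:
  assumes f: "holo_on f Z" and Z: "open Z" and r: "0 < r"
    and line: "\<And>t. norm t \<le> r \<Longrightarrow> x + t *s axis i 1 \<in> Z \<and> norm (f (x + t *s axis i 1)) \<le> M"
  shows "norm (pd i f x) \<le> M / r"
proof -
  let ?\<psi> = "\<lambda>t. f (x + t *s axis i 1)"
  have hol: "?\<psi> holomorphic_on cball 0 r"
    using line by (intro sepholo_line[OF holo_on_imp_sepholo[OF f Z]]) auto
  have "norm ((deriv ^^ 1) ?\<psi> 0) \<le> fact 1 * M / r ^ 1"
    using r line holomorphic_on_imp_continuous_on[OF hol]
    by (intro Cauchy_inequality) (auto intro: holomorphic_on_subset[OF hol])
  then show ?thesis by (simp add: pd_def)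
qed

section \<open>The ring of operators\<close>

text \<open>
  Square matrices in a type of their own, in which composition is the multiplication of a ring, so that
  the rewrite rules for rings apply to operators.
\<close>
typedef 'n op = "UNIV :: ('n \<Rightarrow> 'n \<Rightarrow> complex) set" morphisms entry Op ..

lemma entry_Op [simp]: "entry (Op f) = f" by (simp add: Op_inverse)

lemma op_eqI: "(\<And>c a. entry X c a = entry Y c a) \<Longrightarrow> X = Y"
  by (metis entry_inverse ext)

lemma delta_mult:
  "(if P then 1 else 0) * y = (if P then y else (0::complex))"
  "y * (if P then 1 else 0) = (if P then y else (0::complex))"
  by auto

instantiation op :: (finite) ring_1
begin
definition "0 = Op (\<lambda>_ _. 0)"
definition "1 = Op (\<lambda>c a. if c = a then 1 else 0)"
definition "X + Y = Op (\<lambda>c a. entry X c a + entry Y c a)"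
definition "X - Y = Op (\<lambda>c a. entry X c a - entry Y c a)"
definition "- X = Op (\<lambda>c a. - entry X c a)"
definition "X * Y = Op (\<lambda>c a. \<Sum>b\<in>UNIV. entry X c b * entry Y b a)"
instance
proof
  fix X Y W :: "'a op"
  show "X * Y * W = X * (Y * W)"
    by (rule op_eqI) (simp add: times_op_def sum_distrib_left sum_distrib_right mult.assoc, rule sum.swap)
  show "1 * X = X" "X * 1 = X"
    by (rule op_eqI; simp add: times_op_def one_op_def delta_mult)+
  show "(0::'a op) \<noteq> 1"
  proof
    assume "(0::'a op) = 1"
    then have "entry (0::'a op) undefined undefined = entry 1 undefined undefined" by simp
    then show False by (simp add: zero_op_def one_op_def)
  qed
qed (auto intro!: op_eqI simp: plus_op_def zero_op_def minus_op_def uminus_op_def times_op_def algebra_simps sum.distrib)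
end

definition sc :: "complex \<Rightarrow> 'n op \<Rightarrow> 'n op" where "sc l X = Op (\<lambda>c a. l * entry X c a)"

lemma entry_simps [simp]:
  "entry 0 c a = 0" "entry (X + Y) c a = entry X c a + entry Y c a"
  "entry (X - Y) c a = entry X c a - entry Y c a" "entry (- X) c a = - entry X c a"
  "entry (sc l X) c a = l * entry X c a"
  by (simp_all add: zero_op_def plus_op_def minus_op_def uminus_op_def sc_def)

lemma entry_one: "entry 1 c a = (if c = a then 1 else 0)"
  by (simp add: one_op_def)

lemma entry_mult: "entry (X * Y) c a = (\<Sum>b\<in>UNIV. entry X c b * entry Y b a)"
  by (simp add: times_op_def)

lemma entry_sum [simp]: "entry (\<Sum>i\<in>S. F i) c a = (\<Sum>i\<in>S. entry (F i) c a)"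
  by (induction S rule: infinite_finite_induct) auto

lemma sc_mult_left: "sc l X * Y = sc l (X * Y)" and sc_mult_right: "X * sc l Y = sc l (X * Y)"
  by (rule op_eqI; simp add: entry_mult sum_distrib_left algebra_simps)+

lemma sc_diff: "sc l (X - Y) = sc l X - sc l Y" and sc_diff_left: "sc (l - m) X = sc l X - sc m X"
  and sc_zero [simp]: "sc l 0 = 0" "sc 0 X = 0" and sc_add: "sc l (X + Y) = sc l X + sc l Y"
  and sc_one [simp]: "sc 1 X = X" and sc_sc: "sc l (sc m X) = sc (l * m) X"
  by (rule op_eqI; simp add: algebra_simps)+

lemma sc_sum: "sc l (\<Sum>i\<in>S. F i) = (\<Sum>i\<in>S. sc l (F i))"
  by (rule op_eqI) (simp add: sum_distrib_left)

definition comm :: "'n::finite op \<Rightarrow> 'n op \<Rightarrow> 'n op" where "comm X Y = X * Y - Y * X"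

lemma comm_mult_right: "comm Q (X * Y) = comm Q X * Y + X * comm Q Y"
  by (simp add: comm_def algebra_simps)

lemma comm_sc_left: "comm (sc l X) Y = sc l (comm X Y)" and comm_sc_right: "comm X (sc l Y) = sc l (comm X Y)"
  by (simp_all add: comm_def sc_mult_left sc_mult_right sc_diff)

lemma comm_sum_left: "comm (\<Sum>i\<in>S. F i) Y = (\<Sum>i\<in>S. comm (F i) Y)"
  and comm_sum_right: "comm Y (\<Sum>i\<in>S. F i) = (\<Sum>i\<in>S. comm Y (F i))"
  by (simp_all add: comm_def sum_distrib_left sum_distrib_right sum_subtractf)

lemma comm_swap: "comm X Y = - comm Y X"
  and comm_diff_left: "comm (X - Y) W = comm X W - comm Y W"
  and comm_add_left: "comm (X + Y) W = comm X W + comm Y W"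
  and comm_diff_right: "comm W (X - Y) = comm W X - comm W Y"
  and comm_add_right: "comm W (X + Y) = comm W X + comm W Y"
  and comm_one [simp]: "comm X 1 = 0" "comm 1 X = 0"
  by (simp_all add: comm_def algebra_simps)

section \<open>Inverses of operators\<close>

definition op_det :: "'n::finite op \<Rightarrow> complex" where
  "op_det X = det (\<chi> c a. entry X c a :: complex^'n^'n)"

text \<open>
  Cramer's formula, from which the inverse of a holomorphic family is seen to be holomorphic.
\<close>
definition op_inv :: "'n::finite op \<Rightarrow> 'n op" where
  "op_inv X = Op (\<lambda>a b. det (\<chi> c d. if d = a then (if c = b then 1 else 0) else entry X c d :: complex^'n^'n) * inverse (op_det X))"

lemma matrix_of_mult: "(\<chi> c a. entry (X * Y) c a :: complex^'n^'n) = (\<chi> c a. entry X c a) ** (\<chi> c a. entry Y c a)"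
  by (simp add: vec_eq_iff matrix_matrix_mult_def entry_mult)

lemma op_of_matrix_eq: "(\<chi> c a. entry X c a :: complex^'n^'n) = (\<chi> c a. entry Y c a) \<Longrightarrow> X = Y"
  by (auto simp: vec_eq_iff intro: op_eqI)

lemma matrix_of_one: "(\<chi> c a. entry 1 c a :: complex^'n^'n) = mat 1"
  by (simp add: vec_eq_iff mat_def entry_one)

lemma op_inv:
  fixes X :: "'n::finite op"
  assumes "op_det X \<noteq> 0"
  shows "X * op_inv X = 1" "op_inv X * X = 1"
proof -
  let ?M = "\<chi> c a. entry X c a :: complex^'n^'n"
  have "?M *v (\<chi> a. entry (op_inv X) a b) = axis b 1" for b
  proof -
    have "det ?M \<noteq> 0" using assms by (simp add: op_det_def)
    then show ?thesis
      by (subst cramer) (auto simp: vec_eq_iff op_inv_def op_det_def axis_def divide_inverse cong: if_cong)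
  qed
  then have "entry (X * op_inv X) c b = entry 1 c b" for c b
    by (simp add: vec_eq_iff matrix_vector_mult_def entry_mult entry_one axis_def)
  then show "X * op_inv X = 1" by (rule op_eqI)
  then show "op_inv X * X = 1"
    by (metis matrix_left_right_inverse matrix_of_mult matrix_of_one op_of_matrix_eq)
qed

lemma op_det_nonzero: "X * Y = 1 \<Longrightarrow> op_det X \<noteq> 0"
  unfolding op_det_def by (metis det_I det_mul matrix_of_mult matrix_of_one mult_zero_left zero_neq_one)

lemma op_inv_unique: "X * Y = 1 \<Longrightarrow> op_inv X = Y"
  by (metis mult.assoc mult.left_neutral mult.right_neutral op_det_nonzero op_inv(2))

section \<open>Holomorphic families of operators\<close>

definition holo_op :: "('n::finite cvec \<Rightarrow> 'n op) \<Rightarrow> 'n cvec set \<Rightarrow> bool" where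
  "holo_op F Z \<longleftrightarrow> (\<forall>c a. holo_on (\<lambda>z. entry (F z) c a) Z)"

definition pdo :: "'n::finite \<Rightarrow> ('n cvec \<Rightarrow> 'n op) \<Rightarrow> 'n cvec \<Rightarrow> 'n op" where
  "pdo i F z = Op (\<lambda>c a. pd i (\<lambda>y. entry (F y) c a) z)"

lemma pdo_cong: "open Z \<Longrightarrow> z \<in> Z \<Longrightarrow> (\<And>y. y \<in> Z \<Longrightarrow> F y = G y) \<Longrightarrow> pdo i F z = pdo i G z"
  unfolding pdo_def by (intro arg_cong[of _ _ Op] ext pd_cong) auto

lemma holo_op_const: "holo_op (\<lambda>_. X) Z" and pdo_const [simp]: "pdo i (\<lambda>_. X) z = 0"
  by (auto simp: holo_op_def holo_on_const pdo_def pd_const zero_op_def)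

lemma holo_op_pdo: "holo_op F Z \<Longrightarrow> open Z \<Longrightarrow> holo_op (pdo i F) Z"
  by (simp add: holo_op_def pdo_def holo_on_partial)

lemma pdo_commute: "holo_op F Z \<Longrightarrow> open Z \<Longrightarrow> z \<in> Z \<Longrightarrow> pdo j (pdo i F) z = pdo i (pdo j F) z"
  by (rule op_eqI) (simp add: holo_op_def pdo_def, rule pd_commute, auto)

context
  fixes Z :: "'n::finite cvec set" assumes Z: "open Z"
begin

lemma holo_op_add: "holo_op F Z \<Longrightarrow> holo_op G Z \<Longrightarrow> holo_op (\<lambda>z. F z + G z) Z"
  and holo_op_diff: "holo_op F Z \<Longrightarrow> holo_op G Z \<Longrightarrow> holo_op (\<lambda>z. F z - G z) Z"
  and holo_op_mult: "holo_op F Z \<Longrightarrow> holo_op G Z \<Longrightarrow> holo_op (\<lambda>z. F z * G z) Z"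
  and holo_op_sc: "holo_on f Z \<Longrightarrow> holo_op F Z \<Longrightarrow> holo_op (\<lambda>z. sc (f z) (F z)) Z"
  using Z by (auto simp: holo_op_def entry_mult intro!: holo_on_add holo_on_diff holo_on_mult holo_on_sum)

lemma holo_op_sum: "(\<And>i. i \<in> S \<Longrightarrow> holo_op (F i) Z) \<Longrightarrow> holo_op (\<lambda>z. \<Sum>i\<in>S. F i z) Z"
  using Z by (auto simp: holo_op_def intro!: holo_on_sum)

lemma pdo_add: "holo_op F Z \<Longrightarrow> holo_op G Z \<Longrightarrow> z \<in> Z \<Longrightarrow> pdo i (\<lambda>z. F z + G z) z = pdo i F z + pdo i G z"
  and pdo_diff: "holo_op F Z \<Longrightarrow> holo_op G Z \<Longrightarrow> z \<in> Z \<Longrightarrow> pdo i (\<lambda>z. F z - G z) z = pdo i F z - pdo i G z"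
  and pdo_sc: "holo_on f Z \<Longrightarrow> holo_op F Z \<Longrightarrow> z \<in> Z \<Longrightarrow>
        pdo i (\<lambda>z. sc (f z) (F z)) z = sc (pd i f z) (F z) + sc (f z) (pdo i F z)"
  and pdo_mult: "holo_op F Z \<Longrightarrow> holo_op G Z \<Longrightarrow> z \<in> Z \<Longrightarrow>
        pdo i (\<lambda>z. F z * G z) z = pdo i F z * G z + F z * pdo i G z"
  using Z
  by (auto intro!: op_eqI
      simp: holo_op_def pdo_def entry_mult pd_add[of _ Z] pd_diff[of _ Z] pd_mult[of _ Z] pd_sum[of _ _ Z] holo_on_mult sum.distrib)

lemma pdo_sum: "(\<And>j. j \<in> S \<Longrightarrow> holo_op (F j) Z) \<Longrightarrow> z \<in> Z \<Longrightarrow> pdo i (\<lambda>z. \<Sum>j\<in>S. F j z) z = (\<Sum>j\<in>S. pdo i (F j) z)"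
  using Z by (auto intro!: op_eqI simp: holo_op_def pdo_def pd_sum[of _ _ Z])

lemma pdo_comm: "holo_op F Z \<Longrightarrow> holo_op G Z \<Longrightarrow> z \<in> Z \<Longrightarrow>
        pdo i (\<lambda>z. comm (F z) (G z)) z = comm (pdo i F z) (G z) + comm (F z) (pdo i G z)"
  by (simp add: comm_def pdo_diff pdo_mult holo_op_mult algebra_simps)

lemma holo_op_det: "holo_op F Z \<Longrightarrow> holo_on (\<lambda>z. op_det (F z)) Z"
  using Z by (auto simp: op_det_def det_def holo_op_def intro!: holo_on_sum holo_on_mult holo_on_const holo_on_prod)

lemma holo_op_inv:
  assumes F: "holo_op F Z" and nz: "\<And>z. z \<in> Z \<Longrightarrow> op_det (F z) \<noteq> 0"
  shows "holo_op (\<lambda>z. op_inv (F z)) Z"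
  unfolding holo_op_def
proof (intro allI)
  fix a b
  have "holo_op (\<lambda>z. Op (\<lambda>c d. if d = a then if c = b then 1 else 0 else entry (F z) c d)) Z"
    unfolding holo_op_def
  proof (intro allI)
    fix c d
    show "holo_on (\<lambda>z. entry (Op (\<lambda>c d. if d = a then if c = b then 1 else 0 else entry (F z) c d)) c d) Z"
      using F by (cases "d = a"; cases "c = b") (auto simp: holo_op_def holo_on_const)
  qed
  from holo_op_det[OF this]
  show "holo_on (\<lambda>z. entry (op_inv (F z)) a b) Z"
    unfolding op_inv_def
    using Z F nz by (simp add: op_det_def[of "Op _"] holo_on_mult holo_on_inverse holo_op_det)
qed

end

lemma holo_op_prod_list:
  assumes "open Z" "\<And>j. j \<in> set ws \<Longrightarrow> holo_op (F j) Z"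
  shows "holo_op (\<lambda>z. prod_list (map (\<lambda>j. F j z) ws)) Z"
  using assms(2) by (induction ws) (auto intro: holo_op_const holo_op_mult[OF assms(1)])

section \<open>Operators that raise degrees\<close>

text \<open>
  The indices are those of a graded basis with degrees \<open>td\<close>, and \<open>iu\<close> is the index of the unit.
\<close>
locale grading =
  fixes td :: "'n::finite \<Rightarrow> nat" and k :: nat and iu :: 'n
  assumes td_le: "td a \<le> 2 * k" and td_even: "even (td a)" and td_zero: "td a = 0 \<longleftrightarrow> a = iu"
begin

definition raises :: "nat \<Rightarrow> 'n op \<Rightarrow> bool" where
  "raises d X \<longleftrightarrow> (\<forall>c a. entry X c a \<noteq> 0 \<longrightarrow> td a + d \<le> td c)"

lemma td_iu [simp]: "td iu = 0" using td_zero by blast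

lemma raises_0_op [simp]: "raises d 0"
  and raises_one [simp]: "raises 0 1"
  and raises_uminus [simp]: "raises d (- X) = raises d X"
  and raises_sc: "raises d X \<Longrightarrow> raises d (sc l X)"
  by (auto simp: raises_def entry_one split: if_splits)

lemma raises_add: "raises d X \<Longrightarrow> raises d Y \<Longrightarrow> raises d (X + Y)"
  unfolding raises_def by (metis add.right_neutral entry_simps(2))

lemma raises_diff: "raises d X \<Longrightarrow> raises d Y \<Longrightarrow> raises d (X - Y)"
  using raises_add[of d X "- Y"] by simp

lemma raises_mono: "raises d X \<Longrightarrow> d' \<le> d \<Longrightarrow> raises d' X"
  unfolding raises_def by (meson add_left_mono order_trans)

lemma raises_sum: "(\<And>i. i \<in> S \<Longrightarrow> raises d (F i)) \<Longrightarrow> raises d (\<Sum>i\<in>S. F i)"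
  by (induction S rule: infinite_finite_induct) (auto intro: raises_add)

lemma raises_mult:
  assumes X: "raises d X" and Y: "raises d' Y" shows "raises (d + d') (X * Y)"
  unfolding raises_def
proof (intro allI impI)
  fix c a assume "entry (X * Y) c a \<noteq> 0"
  then obtain b where "entry X c b * entry Y b a \<noteq> 0"
    unfolding entry_mult by (metis (mono_tags) sum.not_neutral_contains_not_neutral)
  then show "td a + (d + d') \<le> td c"
    using X Y by (fastforce simp: raises_def)
qed

lemma raises_comm: "raises d X \<Longrightarrow> raises d' Y \<Longrightarrow> raises (d + d') (comm X Y)"
  unfolding comm_def using raises_mult[of d X d' Y] raises_mult[of d' Y d X] by (simp add: add.commute raises_diff)

text \<open>
  This turns estimates of degrees into equalities.
\<close>
lemma raises_eq_0: "raises d X \<Longrightarrow> 2 * k < d \<Longrightarrow> X = 0"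
proof (rule op_eqI)
  fix c a assume "raises d X" "2 * k < d"
  then show "entry X c a = entry 0 c a" using td_le[of c] by (fastforce simp: raises_def)
qed

lemma raises_all_eq_0:
  assumes "\<And>n. raises (m + 2 * n) X" shows "X = 0"
  using raises_eq_0[OF assms[of "Suc k"]] by simp

lemma raises_power: "raises d X \<Longrightarrow> raises (n * d) (X ^ n)"
  by (induction n) (auto dest: raises_mult)

lemma raises_pdo:
  assumes "open Z" "z \<in> Z" "\<And>y. y \<in> Z \<Longrightarrow> raises d (F y)" shows "raises d (pdo i F z)"
  unfolding raises_def
proof (intro allI impI)
  fix c a assume nz: "entry (pdo i F z) c a \<noteq> 0"
  show "td a + d \<le> td c"
  proof (rule ccontr)
    assume "\<not> td a + d \<le> td c"
    then have "entry (F y) c a = 0" if "y \<in> Z" for y using assms(3)[OF that] by (auto simp: raises_def)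
    then have "pd i (\<lambda>y. entry (F y) c a) z = pd i (\<lambda>_. 0) z" by (intro pd_cong[OF assms(1,2)])
    then show False using nz by (simp add: pdo_def pd_const)
  qed
qed

definition edeg :: "'n \<Rightarrow> 'n \<Rightarrow> complex" where
  "edeg c a = (of_nat (td c) - of_nat (td a)) / 2"

lemma edeg_eq_iff: "edeg c a = of_nat l \<longleftrightarrow> td c = td a + 2 * l"
proof -
  have "edeg c a = of_nat l \<longleftrightarrow> (of_nat (td c) :: complex) = of_nat (td a + 2 * l)"
    by (simp add: edeg_def field_simps)
  then show ?thesis by (simp only: of_nat_eq_iff)
qed

lemma edeg_self [simp]: "edeg c c = 0" and edeg_add: "edeg c b + edeg b a = edeg c a"
  by (simp_all add: edeg_def field_simps)

text \<open>
  The commutator with the grading operator, which multiplies a vector of degree \<open>d\<close> by \<open>d / 2\<close>.  As a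
  derivation of the ring of operators it takes the place of the Lie derivative along the Euler field.
\<close>
definition euler :: "'n op \<Rightarrow> 'n op" where
  "euler X = Op (\<lambda>c a. edeg c a * entry X c a)"

lemma euler_mult: "euler (X * Y) = euler X * Y + X * euler Y"
proof (rule op_eqI)
  fix c a
  have "edeg c a * (entry X c b * entry Y b a) =
      edeg c b * entry X c b * entry Y b a + entry X c b * (edeg b a * entry Y b a)" for b
    unfolding edeg_add[of c b a, symmetric] by (simp add: algebra_simps)
  then show "entry (euler (X * Y)) c a = entry (euler X * Y + X * euler Y) c a"
    by (simp add: euler_def entry_mult sum_distrib_left flip: sum.distrib)
qed

lemma euler_simps: "euler (X + Y) = euler X + euler Y" "euler (X - Y) = euler X - euler Y"
  "euler (sc l X) = sc l (euler X)" "euler 0 = 0" "euler 1 = 0"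
  by (rule op_eqI; simp add: euler_def algebra_simps entry_one)+

lemma euler_comm: "euler (comm X Y) = comm (euler X) Y + comm X (euler Y)"
  by (simp add: comm_def euler_simps euler_mult algebra_simps)

lemma pdo_euler: "open Z \<Longrightarrow> holo_op F Z \<Longrightarrow> z \<in> Z \<Longrightarrow> pdo i (\<lambda>y. euler (F y)) z = euler (pdo i F z)"
  by (rule op_eqI) (simp add: pdo_def euler_def holo_op_def pd_cmult[of _ Z])

lemma holo_op_euler: "open Z \<Longrightarrow> holo_op F Z \<Longrightarrow> holo_op (\<lambda>y. euler (F y)) Z"
  by (simp add: holo_op_def euler_def holo_on_cmult)

text \<open>
  On operators that raise the degree by exactly \<open>m\<close>, \<open>euler\<close> is multiplication by \<open>m / 2\<close>.  For
  \<open>m \<ge> d\<close> this differs from \<open>l\<close>, so that such a part of \<open>X\<close> can be recovered from the corresponding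
  part of \<open>euler X - l X\<close>.  All bootstrap arguments below end with this lemma.
\<close>
lemma euler_gain:
  assumes X: "raises d X" and E: "raises d' (euler X - sc (of_nat l) X)" and l: "2 * l < d"
  shows "raises d' X"
  unfolding raises_def
proof (intro allI impI)
  fix c a assume nz: "entry X c a \<noteq> 0"
  show "td a + d' \<le> td c"
  proof (rule ccontr)
    assume "\<not> td a + d' \<le> td c"
    then have "entry (euler X - sc (of_nat l) X) c a = 0" using E by (auto simp: raises_def)
    then have "edeg c a = of_nat l" using nz by (simp add: euler_def)
    then have "td c = td a + 2 * l" by (simp add: edeg_eq_iff)
    then show False using X nz l by (force simp: raises_def)
  qed
qed

text \<open>
  The operators of degree 0 are the kernel of the derivation \<open>euler\<close>, which is closed under inverses.
\<close>
lemma homogeneous_inverse: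
  assumes X: "\<And>c a. entry X c a \<noteq> 0 \<Longrightarrow> td c = td a" and nz: "op_det X \<noteq> 0"
  shows "raises 0 (op_inv X)"
proof -
  have "euler X = 0" using X edeg_eq_iff[of _ _ 0] by (intro op_eqI) (auto simp: euler_def)
  then have "0 = euler (op_inv X * X) - op_inv X * euler X" by (simp add: op_inv(2)[OF nz] euler_simps)
  also have "\<dots> = euler (op_inv X) * X" by (simp add: euler_mult)
  finally have "0 = (euler (op_inv X) * X) * op_inv X" by simp
  then have "euler (op_inv X) = 0" by (simp add: mult.assoc op_inv(1)[OF nz])
  then have "entry (euler (op_inv X)) c a = 0" for c a by simp
  then have "entry (op_inv X) c a \<noteq> 0 \<Longrightarrow> td c = td a" for c a
    using edeg_eq_iff[of c a 0] by (auto simp: euler_def)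
  then show ?thesis by (auto simp: raises_def)
qed

text \<open>
  \<open>X = Y (1 - N)\<close> where \<open>N\<close> raises degrees and is therefore nilpotent; the geometric series for the
  inverse of \<open>1 - N\<close> is finite.
\<close>
lemma unipotent_inverse:
  assumes Y: "op_det Y \<noteq> 0" "raises 0 (op_inv Y)" and XY: "raises 2 (X - Y)"
  shows "op_det X \<noteq> 0" "raises 0 (op_inv X)"
proof -
  define N where "N = op_inv Y * (Y - X)"
  have N: "raises 2 N"
    using raises_mult[OF Y(2) raises_uminus[THEN iffD2, OF XY]] unfolding N_def minus_diff_eq add_0 .
  have "N ^ Suc k = 0"
    using raises_power[OF N, of "Suc k"] by (rule raises_eq_0) simp
  moreover have "(1 - N) * (\<Sum>i<K. N ^ i) = 1 - N ^ K" for K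
  proof (induction K)
    case (Suc K)
    have "(1 - N) * (\<Sum>i<Suc K. N ^ i) = (1 - N) * (\<Sum>i<K. N ^ i) + (1 - N) * N ^ K"
      by (simp only: sum.lessThan_Suc distrib_left)
    also have "\<dots> = 1 - N ^ Suc K" unfolding Suc by (simp add: left_diff_distrib)
    finally show ?case .
  qed simp
  ultimately have geom: "(1 - N) * (\<Sum>i<Suc k. N ^ i) = 1" by (metis diff_zero)
  have "X = Y * (1 - N)"
    by (simp add: N_def algebra_simps op_inv(1)[OF Y(1)] flip: mult.assoc)
  then have "X * ((\<Sum>i<Suc k. N ^ i) * op_inv Y) = Y * ((1 - N) * (\<Sum>i<Suc k. N ^ i)) * op_inv Y"
    by (simp only: mult.assoc)
  also have "\<dots> = 1" by (simp only: geom mult_1_right op_inv(1)[OF Y(1)])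
  finally have *: "X * ((\<Sum>i<Suc k. N ^ i) * op_inv Y) = 1" .
  then show "op_det X \<noteq> 0" by (rule op_det_nonzero)
  have "raises 0 (N ^ i)" for i using raises_power[OF N, of i] raises_mono by blast
  then have "raises (0 + 0) ((\<Sum>i<Suc k. N ^ i) * op_inv Y)" by (intro raises_mult raises_sum Y)
  then show "raises 0 (op_inv X)" using op_inv_unique[OF *] by simp
qed

section \<open>Words in the generators\<close>

definition J :: "'n set" where "J = {j. td j = 2}"

lemma J_iff: "j \<in> J \<longleftrightarrow> td j = 2" by (simp add: J_def)

definition wprod :: "('n \<Rightarrow> 'n op) \<Rightarrow> 'n list \<Rightarrow> 'n op" where "wprod X ws = prod_list (map X ws)"

lemma wprod_simps [simp]: "wprod X [] = 1" "wprod X (j # ws) = X j * wprod X ws"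
  by (simp_all add: wprod_def)

lemma raises_wprod:
  assumes "\<And>j. j \<in> J \<Longrightarrow> raises 2 (X j)" "set ws \<subseteq> J"
  shows "raises (2 * length ws) (wprod X ws)"
  using assms(2)
proof (induction ws)
  case (Cons j ws)
  then have "raises (2 + 2 * length ws) (X j * wprod X ws)" by (intro raises_mult assms(1)) auto
  then show ?case by simp
qed simp

text \<open>
  One letter is exchanged at a time; each of the other letters still raises degrees by 2.
\<close>
lemma raises_wprod_diff:
  assumes X: "\<And>j. j \<in> J \<Longrightarrow> raises 2 (X j)" and Y: "\<And>j. j \<in> J \<Longrightarrow> raises 2 (Y j)"
    and XY: "\<And>j. j \<in> J \<Longrightarrow> raises (d + 2) (X j - Y j)" and ws: "set ws \<subseteq> J"
  shows "raises (d + 2 * length ws) (wprod X ws - wprod Y ws)"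
  using ws
proof (induction ws)
  case (Cons j ws)
  have "raises ((d + 2) + 2 * length ws) ((X j - Y j) * wprod X ws)"
    using Cons by (intro raises_mult XY raises_wprod X) auto
  moreover have "raises (2 + (d + 2 * length ws)) (Y j * (wprod X ws - wprod Y ws))"
    using Cons by (intro raises_mult Y) auto
  ultimately have "raises (d + 2 * length (j # ws)) ((X j - Y j) * wprod X ws + Y j * (wprod X ws - wprod Y ws))"
    by (intro raises_add) (simp_all add: algebra_simps)
  then show ?case by (simp add: algebra_simps)
qed simp

lemma raises_comm_wprod:
  assumes X: "\<And>j. j \<in> J \<Longrightarrow> raises 2 (X j)"
    and Q: "\<And>j. j \<in> J \<Longrightarrow> raises (d + 2) (comm Q (X j))" and ws: "set ws \<subseteq> J"
  shows "raises (d + 2 * length ws) (comm Q (wprod X ws))"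
  using ws
proof (induction ws)
  case (Cons j ws)
  have "raises ((d + 2) + 2 * length ws) (comm Q (X j) * wprod X ws)"
    using Cons by (intro raises_mult Q raises_wprod X) auto
  moreover have "raises (2 + (d + 2 * length ws)) (X j * comm Q (wprod X ws))"
    using Cons by (intro raises_mult X) auto
  ultimately show ?case
    unfolding wprod_simps comm_mult_right by (intro raises_add) (simp_all add: algebra_simps)
qed simp

lemma comm_wprod_eq_0:
  assumes "\<And>j. j \<in> J \<Longrightarrow> comm Q (X j) = 0" "set ws \<subseteq> J"
  shows "comm Q (wprod X ws) = 0"
  using assms(2) by (induction ws) (auto simp: comm_mult_right assms(1))

lemma wprod_append: "wprod X (us @ ws) = wprod X us * wprod X ws"
  by (simp add: wprod_def)

lemma wprod_rev:
  assumes "\<And>i j. i \<in> J \<Longrightarrow> j \<in> J \<Longrightarrow> comm (X i) (X j) = 0" "set ws \<subseteq> J"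
  shows "wprod X (rev ws) = wprod X ws"
  using assms(2)
proof (induction ws)
  case (Cons j ws)
  then have "comm (X j) (wprod X ws) = 0" by (intro comm_wprod_eq_0 assms(1)) auto
  then show ?case using Cons by (simp add: wprod_append comm_def)
qed simp

text \<open>
  The words whose product maps the unit into the degree of the basis vector \<open>a\<close>.
\<close>
definition wordset :: "'n \<Rightarrow> 'n list set" where
  "wordset a = {ws. set ws \<subseteq> J \<and> length ws = td a div 2}"

lemma wordset_length: "ws \<in> wordset a \<Longrightarrow> 2 * length ws = td a" "ws \<in> wordset a \<Longrightarrow> set ws \<subseteq> J"
  using td_even by (auto simp: wordset_def)

end

section \<open>Multiplication operators generated by commuting operators\<close>

text \<open>
  The coefficients \<open>p a\<close> fix, for each basis vector, a homogeneous noncommutative polynomial \<open>pw a\<close> in the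
  generators.  The generators are known to generate when the vectors \<open>pw a X e\<close> form a basis, that is, when
  the matrix \<open>frame X\<close> of these vectors is invertible.
\<close>
locale word_polynomials = grading td k iu for td :: "'n::finite \<Rightarrow> nat" and k iu +
  fixes p :: "'n \<Rightarrow> 'n list \<Rightarrow> complex"
begin

definition pw :: "'n \<Rightarrow> ('n \<Rightarrow> 'n op) \<Rightarrow> 'n op" where
  "pw a X = (\<Sum>ws\<in>wordset a. sc (p a ws) (wprod X ws))"

definition frame :: "('n \<Rightarrow> 'n op) \<Rightarrow> 'n op" where
  "frame X = Op (\<lambda>c a. entry (pw a X) c iu)"

text \<open>
  The combination of the \<open>pw a X\<close> that maps the unit to the basis vector \<open>c\<close>; for commuting generators this
  is multiplication by that vector.
\<close>
definition mulop :: "('n \<Rightarrow> 'n op) \<Rightarrow> 'n \<Rightarrow> 'n op" where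
  "mulop X c = (\<Sum>a\<in>UNIV. sc (entry (op_inv (frame X)) a c) (pw a X))"

text \<open>
  Multiplication by the part of the Euler field in degrees at least 4, up to sign.
\<close>
definition eulerop :: "('n \<Rightarrow> 'n op) \<Rightarrow> 'n cvec \<Rightarrow> 'n op" where
  "eulerop X z = (\<Sum>c | 4 \<le> td c. sc ((of_nat (td c) / 2 - 1) * z $ c) (mulop X c))"

lemma raises_pw:
  assumes "\<And>j. j \<in> J \<Longrightarrow> raises 2 (X j)" shows "raises (td a) (pw a X)"
  unfolding pw_def
proof (rule raises_sum, rule raises_sc)
  fix ws assume "ws \<in> wordset a"
  then show "raises (td a) (wprod X ws)"
    using raises_wprod[OF assms wordset_length(2)] wordset_length(1) by fastforce
qed

lemma raises_pw_diff:
  assumes "\<And>j. j \<in> J \<Longrightarrow> raises 2 (X j)" "\<And>j. j \<in> J \<Longrightarrow> raises 2 (Y j)"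
    and "\<And>j. j \<in> J \<Longrightarrow> raises (d + 2) (X j - Y j)"
  shows "raises (d + td a) (pw a X - pw a Y)"
proof -
  have "raises (d + td a) (sc (p a ws) (wprod X ws - wprod Y ws))" if "ws \<in> wordset a" for ws
    using raises_wprod_diff[OF assms wordset_length(2)[OF that]] wordset_length(1)[OF that]
    by (intro raises_sc) simp
  then have "raises (d + td a) (\<Sum>ws\<in>wordset a. sc (p a ws) (wprod X ws - wprod Y ws))"
    by (rule raises_sum)
  then show ?thesis by (simp add: pw_def sc_diff sum_subtractf)
qed

lemma raises_comm_pw:
  assumes "\<And>j. j \<in> J \<Longrightarrow> raises 2 (X j)" "\<And>j. j \<in> J \<Longrightarrow> raises (d + 2) (comm Q (X j))"
  shows "raises (d + td a) (comm Q (pw a X))"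
  unfolding pw_def comm_sum_right comm_sc_right
proof (rule raises_sum, rule raises_sc)
  fix ws assume ws: "ws \<in> wordset a"
  show "raises (d + td a) (comm Q (wprod X ws))"
    using raises_comm_wprod[OF assms wordset_length(2)[OF ws]] wordset_length(1)[OF ws] by simp
qed

lemma comm_pw_eq_0: "(\<And>j. j \<in> J \<Longrightarrow> comm Q (X j) = 0) \<Longrightarrow> comm Q (pw a X) = 0"
  unfolding pw_def comm_sum_right comm_sc_right
  by (intro sum.neutral ballI) (metis comm_wprod_eq_0 wordset_length(2) sc_zero(1))

lemma raises_frame_diff:
  assumes "\<And>j. j \<in> J \<Longrightarrow> raises 2 (X j)" "\<And>j. j \<in> J \<Longrightarrow> raises 2 (Y j)"
    and "\<And>j. j \<in> J \<Longrightarrow> raises (d + 2) (X j - Y j)"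
  shows "raises d (frame X - frame Y)"
  unfolding raises_def
proof (intro allI impI)
  fix c a assume "entry (frame X - frame Y) c a \<noteq> 0"
  then have "entry (pw a X - pw a Y) c iu \<noteq> 0" by (simp add: frame_def)
  moreover have "raises (d + td a) (pw a X - pw a Y)" by (rule raises_pw_diff) (fact assms)+
  ultimately have "td iu + (d + td a) \<le> td c" unfolding raises_def by blast
  then show "td a + d \<le> td c" by simp
qed

lemma mulop_unit:
  assumes "op_det (frame X) \<noteq> 0"
  shows "entry (mulop X c) a iu = (if a = c then 1 else 0)"
proof -
  have "entry (mulop X c) a iu = entry (frame X * op_inv (frame X)) a c"
    by (simp add: mulop_def frame_def entry_mult mult.commute)
  then show ?thesis by (simp add: op_inv(1)[OF assms] entry_one)
qed

lemma raises_mulop: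
  assumes X: "\<And>j. j \<in> J \<Longrightarrow> raises 2 (X j)" and inv: "raises 0 (op_inv (frame X))"
  shows "raises (td c) (mulop X c)"
  unfolding mulop_def
proof (rule raises_sum)
  fix a
  show "raises (td c) (sc (entry (op_inv (frame X)) a c) (pw a X))"
  proof (cases "entry (op_inv (frame X)) a c = 0")
    case False
    then have "td c \<le> td a" using inv by (auto simp: raises_def)
    then show ?thesis by (intro raises_sc raises_mono[OF raises_pw[where X = X and a = a, OF X]])
  qed simp
qed

text \<open>
  Both the \<open>pw a\<close> and the inverse of the frame depend on the generators.  Because \<open>c\<close> has degree at least 4,
  only words with at least two letters contribute, and the second letter is responsible for the gain of
  two degrees over the difference of the generators.
\<close>
lemma raises_mulop_diff:
  assumes X: "\<And>j. j \<in> J \<Longrightarrow> raises 2 (X j)" and Y: "\<And>j. j \<in> J \<Longrightarrow> raises 2 (Y j)"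
    and XY: "\<And>j. j \<in> J \<Longrightarrow> raises (d + 2) (X j - Y j)"
    and invX: "op_det (frame X) \<noteq> 0" "raises 0 (op_inv (frame X))"
    and invY: "op_det (frame Y) \<noteq> 0" "raises 0 (op_inv (frame Y))"
    and c: "4 \<le> td c"
  shows "raises (d + 4) (mulop X c - mulop Y c)"
proof -
  let ?x = "op_inv (frame X)" and ?y = "op_inv (frame Y)"
  have "?x - ?y = - (?x * (frame X - frame Y) * ?y)"
    by (simp add: algebra_simps op_inv(2)[OF invX(1)]) (simp add: mult.assoc op_inv(1)[OF invY(1)])
  moreover have "raises (0 + d + 0) (?x * (frame X - frame Y) * ?y)"
    by (intro raises_mult invX invY raises_frame_diff X Y XY)
  ultimately have xy: "raises d (?x - ?y)" by simp
  have "mulop X c - mulop Y c = (\<Sum>a\<in>UNIV. sc (entry (?x - ?y) a c) (pw a X) + sc (entry ?y a c) (pw a X - pw a Y))"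
    by (simp add: mulop_def sc_diff sc_diff_left flip: sum_subtractf)
  moreover have "raises (d + 4) (sc (entry (?x - ?y) a c) (pw a X))" for a
  proof (cases "entry (?x - ?y) a c = 0")
    case False
    then have "td c + d \<le> td a" using xy unfolding raises_def by blast
    then show ?thesis using c by (intro raises_sc raises_mono[OF raises_pw[where X = X and a = a, OF X]]) auto
  qed simp
  moreover have "raises (d + 4) (sc (entry ?y a c) (pw a X - pw a Y))" for a
  proof (cases "entry ?y a c = 0")
    case False
    then have "td c \<le> td a" using invY(2) by (auto simp: raises_def)
    then show ?thesis using c
      by (intro raises_sc raises_mono[OF raises_pw_diff[where X = X and Y = Y and a = a, OF X Y XY]]) auto
  qed simp
  ultimately show ?thesis by (simp add: raises_sum raises_add)
qed

lemma raises_eulerop: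
  assumes X: "\<And>j. j \<in> J \<Longrightarrow> raises 2 (X j)" and inv: "raises 0 (op_inv (frame X))"
  shows "raises 4 (eulerop X z)"
  unfolding eulerop_def
  by (intro raises_sum raises_sc raises_mono[OF raises_mulop[OF X inv]]) auto

lemma raises_eulerop_diff:
  assumes X: "\<And>j. j \<in> J \<Longrightarrow> raises 2 (X j)" and Y: "\<And>j. j \<in> J \<Longrightarrow> raises 2 (Y j)"
    and XY: "\<And>j. j \<in> J \<Longrightarrow> raises (d + 2) (X j - Y j)"
    and invX: "op_det (frame X) \<noteq> 0" "raises 0 (op_inv (frame X))"
    and invY: "op_det (frame Y) \<noteq> 0" "raises 0 (op_inv (frame Y))"
  shows "raises (d + 4) (eulerop X z - eulerop Y z)"
proof -
  have "eulerop X z - eulerop Y z = (\<Sum>c | 4 \<le> td c. sc ((of_nat (td c) / 2 - 1) * z $ c) (mulop X c - mulop Y c))"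
    by (simp add: eulerop_def sc_diff sum_subtractf)
  then show ?thesis
    using raises_mulop_diff[OF X Y XY invX invY] by (auto intro!: raises_sum raises_sc)
qed

text \<open>
  The inverse of \<open>euler - 1\<close> on the operators that raise degrees by at least 4; the eigenvalue 1 belongs to
  the operators that raise them by exactly 2.
\<close>
definition resolvent :: "'n op \<Rightarrow> 'n op" where
  "resolvent X = Op (\<lambda>c a. if td a + 4 \<le> td c then entry X c a / (edeg c a - 1) else 0)"

lemma edeg_nonresonant: "td a + 4 \<le> td c \<Longrightarrow> edeg c a \<noteq> 1"
  using edeg_eq_iff[of c a 1] by auto

lemma euler_resolvent: "raises 4 X \<Longrightarrow> euler (resolvent X) = resolvent X + X"
proof (rule op_eqI)
  fix c a assume X: "raises 4 X"
  show "entry (euler (resolvent X)) c a = entry (resolvent X + X) c a"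
  proof (cases "td a + 4 \<le> td c")
    case True
    then have "edeg c a - 1 \<noteq> 0" using edeg_nonresonant by simp
    then show ?thesis using True by (simp add: euler_def resolvent_def field_simps)
  next
    case False
    then show ?thesis using X by (auto simp: euler_def resolvent_def raises_def)
  qed
qed

lemma raises_resolvent: "raises d X \<Longrightarrow> raises d (resolvent X)" and raises_4_resolvent: "raises 4 (resolvent X)"
  by (auto simp: raises_def resolvent_def)

lemma resolvent_diff: "resolvent (X - Y) = resolvent X - resolvent Y" and resolvent_0 [simp]: "resolvent 0 = 0"
  by (rule op_eqI; simp add: resolvent_def diff_divide_distrib)+

lemma
  assumes "open Z" "holo_op F Z"
  shows holo_op_resolvent: "holo_op (\<lambda>y. resolvent (F y)) Z"
    and pdo_resolvent: "z \<in> Z \<Longrightarrow> pdo i (\<lambda>y. resolvent (F y)) z = resolvent (pdo i F z)"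
proof -
  define r where "r c a = (if td a + 4 \<le> td c then inverse (edeg c a - 1) else 0)" for c a
  have r: "resolvent = (\<lambda>X. Op (\<lambda>c a. r c a * entry X c a))"
    by (auto simp: r_def resolvent_def fun_eq_iff divide_inverse intro!: op_eqI)
  show "holo_op (\<lambda>y. resolvent (F y)) Z" 
    using assms by (auto simp: r holo_op_def holo_on_cmult)
  show "z \<in> Z \<Longrightarrow> pdo i (\<lambda>y. resolvent (F y)) z = resolvent (pdo i F z)"
    using assms by (auto simp: r holo_op_def pdo_def pd_cmult[of _ Z] intro!: op_eqI)
qed

lemma holo_op_pw:
  assumes "open Z" "\<And>j. j \<in> J \<Longrightarrow> holo_op (A j) Z" shows "holo_op (\<lambda>z. pw a (\<lambda>j. A j z)) Z"
  unfolding pw_def wprod_def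
  by (intro holo_op_sum holo_op_sc holo_op_prod_list holo_on_const assms) (use wordset_length(2) in auto)

lemma holo_op_mulop:
  assumes Z: "open Z" and A: "\<And>j. j \<in> J \<Longrightarrow> holo_op (A j) Z"
    and inv: "\<And>z. z \<in> Z \<Longrightarrow> op_det (frame (\<lambda>j. A j z)) \<noteq> 0"
  shows "holo_op (\<lambda>z. mulop (\<lambda>j. A j z) c) Z"
proof -
  have "holo_op (\<lambda>z. frame (\<lambda>j. A j z)) Z"
    using holo_op_pw[OF Z A] by (simp add: holo_op_def frame_def)
  from holo_op_inv[OF Z this inv]
  have "holo_on (\<lambda>z. entry (op_inv (frame (\<lambda>j. A j z))) a c) Z" for a by (simp add: holo_op_def)
  then show ?thesis
    unfolding mulop_def by (intro holo_op_sum holo_op_sc holo_op_pw Z A)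
qed

lemma holo_op_eulerop:
  assumes Z: "open Z" and A: "\<And>j. j \<in> J \<Longrightarrow> holo_op (A j) Z"
    and inv: "\<And>z. z \<in> Z \<Longrightarrow> op_det (frame (\<lambda>j. A j z)) \<noteq> 0"
  shows "holo_op (\<lambda>z. eulerop (\<lambda>j. A j z) z) Z"
  unfolding eulerop_def
  by (intro holo_op_sum holo_op_sc holo_op_mulop holo_on_cmult holo_on_coordinate Z A inv)

lemma raises_comm_eulerop:
  assumes X: "\<And>j. j \<in> J \<Longrightarrow> raises 2 (X j)" and inv: "raises 0 (op_inv (frame X))"
    and Q: "\<And>j. j \<in> J \<Longrightarrow> raises (d + 2) (comm Q (X j))"
  shows "raises (d + 4) (comm Q (eulerop X z))"
  unfolding eulerop_def mulop_def comm_sum_right comm_sc_right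
proof (rule raises_sum, rule raises_sc, rule raises_sum)
  fix c a assume c: "c \<in> {c. 4 \<le> td c}"
  show "raises (d + 4) (sc (entry (op_inv (frame X)) a c) (comm Q (pw a X)))"
  proof (cases "entry (op_inv (frame X)) a c = 0")
    case False
    then have "td c \<le> td a" using inv by (auto simp: raises_def)
    then show ?thesis
      using c by (intro raises_sc raises_mono[OF raises_comm_pw[where X = X and a = a, OF X Q]]) auto
  qed simp
qed

lemma comm_mulop_eq_0:
  "(\<And>j. j \<in> J \<Longrightarrow> comm Q (X j) = 0) \<Longrightarrow> comm Q (mulop X c) = 0"
  unfolding mulop_def comm_sum_right comm_sc_right by (intro sum.neutral ballI) (metis comm_pw_eq_0 sc_zero(1))

text \<open>
  If \<open>Q\<close> kills the unit, then it maps the frame vector \<open>pw a X e\<close> to \<open>comm Q (pw a X) e\<close>, so it is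
  controlled by its commutators with the generators.
\<close>
lemma raises_of_commutators:
  assumes X: "\<And>j. j \<in> J \<Longrightarrow> raises 2 (X j)"
    and inv: "op_det (frame X) \<noteq> 0" "raises 0 (op_inv (frame X))"
    and Q: "\<And>j. j \<in> J \<Longrightarrow> raises (d + 2) (comm Q (X j))" and unit: "\<And>c. entry Q c iu = 0"
  shows "raises d Q"
proof -
  have "raises d (Q * frame X)"
    unfolding raises_def
  proof (intro allI impI)
    fix c a
    have "entry (Q * frame X) c a = entry (comm Q (pw a X)) c iu"
      by (simp add: comm_def entry_mult frame_def unit)
    moreover assume "entry (Q * frame X) c a \<noteq> 0"
    moreover have "raises (d + td a) (comm Q (pw a X))" by (rule raises_comm_pw[OF X Q])
    ultimately show "td a + d \<le> td c" unfolding raises_def by fastforce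
  qed
  then have "raises (d + 0) (Q * frame X * op_inv (frame X))" by (intro raises_mult inv)
  then show ?thesis by (simp add: mult.assoc op_inv(1)[OF inv(1)])
qed

end

section \<open>Extension of the generators by a terminating iteration\<close>

lemma sc_two: "sc (of_nat 2) X = X + X"
  by (rule op_eqI; simp)+

text \<open>
  The initial data.  The operators \<open>A0 j\<close> are what is called a Higgs field: they commute and are closed.
  The pairing is represented by the involution \<open>\<delta>\<close>, which sends each basis vector to the one dual to it.
\<close>
locale graded_higgs = word_polynomials td k iu p for td :: "'n::finite \<Rightarrow> nat" and k iu p +
  fixes \<delta> :: "'n \<Rightarrow> 'n" and Z :: "'n cvec set" and A0 :: "'n \<Rightarrow> 'n cvec \<Rightarrow> 'n op"
  assumes Z: "open Z"
    and delta: "\<delta> (\<delta> a) = a" "td (\<delta> a) + td a = 2 * k"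
    and A0_holo: "j \<in> J \<Longrightarrow> holo_op (A0 j) Z"
    and A0_deg: "j \<in> J \<Longrightarrow> z \<in> Z \<Longrightarrow> entry (A0 j z) c a \<noteq> 0 \<Longrightarrow> td c = td a + 2"
    and A0_const: "j \<in> J \<Longrightarrow> z \<in> Z \<Longrightarrow> c \<notin> J \<Longrightarrow> pdo c (A0 j) z = 0"
    and A0_comm: "i \<in> J \<Longrightarrow> j \<in> J \<Longrightarrow> z \<in> Z \<Longrightarrow> comm (A0 i z) (A0 j z) = 0"
    and A0_closed: "i \<in> J \<Longrightarrow> j \<in> J \<Longrightarrow> z \<in> Z \<Longrightarrow> pdo i (A0 j) z = pdo j (A0 i) z"
    and A0_unit: "j \<in> J \<Longrightarrow> z \<in> Z \<Longrightarrow> entry (A0 j z) c iu = (if c = j then 1 else 0)"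
    and A0_sym: "j \<in> J \<Longrightarrow> z \<in> Z \<Longrightarrow> entry (A0 j z) (\<delta> a) (\<delta> c) = entry (A0 j z) c a"
    and A0_gen: "z \<in> Z \<Longrightarrow> op_det (frame (\<lambda>j. A0 j z)) \<noteq> 0"
begin

definition admissible :: "('n \<Rightarrow> 'n cvec \<Rightarrow> 'n op) \<Rightarrow> bool" where
  "admissible A \<longleftrightarrow> (\<forall>j\<in>J. holo_op (A j) Z \<and> (\<forall>z\<in>Z. raises 4 (A j z - A0 j z)))"

lemma raises_A0: "j \<in> J \<Longrightarrow> z \<in> Z \<Longrightarrow> raises 2 (A0 j z)"
  using A0_deg by (fastforce simp: raises_def)

text \<open>
  The frame of \<open>A0\<close> is homogeneous of degree 0, since each word in \<open>wordset a\<close> produces a vector of the degree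
  of \<open>a\<close>.  The frame of \<open>A\<close> differs from it by an operator that raises degrees.
\<close>
lemma
  assumes "admissible A" and z: "z \<in> Z"
  shows admissible_raises: "j \<in> J \<Longrightarrow> raises 2 (A j z)"
    and admissible_det: "op_det (frame (\<lambda>j. A j z)) \<noteq> 0"
    and admissible_inv: "raises 0 (op_inv (frame (\<lambda>j. A j z)))"
proof -
  have 4: "raises 4 (A j z - A0 j z)" if "j \<in> J" for j
    using assms that by (auto simp: admissible_def)
  have 2: "raises 2 (A j z)" if "j \<in> J" for j
    using raises_add[OF raises_mono[OF 4[OF that], of 2] raises_A0[OF that z]] by simp
  then show "j \<in> J \<Longrightarrow> raises 2 (A j z)" .
  have "td c = td a" if "entry (frame (\<lambda>j. A0 j z)) c a \<noteq> 0" for c a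
  proof -
    have word: "td c = td b + 2 * length ws"
      if "set ws \<subseteq> J" "entry (wprod (\<lambda>j. A0 j z) ws) c b \<noteq> 0" for c b ws
      using that
    proof (induction ws arbitrary: c)
      case Nil
      then show ?case by (simp add: entry_one split: if_splits)
    next
      case (Cons j ws)
      then have "(\<Sum>x\<in>UNIV. entry (A0 j z) c x * entry (wprod (\<lambda>j. A0 j z) ws) x b) \<noteq> 0"
        by (simp add: entry_mult)
      then obtain x where x: "entry (A0 j z) c x * entry (wprod (\<lambda>j. A0 j z) ws) x b \<noteq> 0"
        by (metis (mono_tags) sum.not_neutral_contains_not_neutral)
      then have "td x = td b + 2 * length ws" using Cons by auto
      moreover have "td c = td x + 2" using x Cons.prems z by (intro A0_deg[of j z]) auto
      ultimately show ?case by simp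
    qed
    have "(\<Sum>ws\<in>wordset a. p a ws * entry (wprod (\<lambda>j. A0 j z) ws) c iu) \<noteq> 0"
      using that by (simp add: frame_def pw_def)
    then obtain ws where "ws \<in> wordset a" "entry (wprod (\<lambda>j. A0 j z) ws) c iu \<noteq> 0"
      by (metis (mono_tags) mult_eq_0_iff sum.not_neutral_contains_not_neutral)
    then show ?thesis using word[of ws c iu] wordset_length[of ws a] by simp
  qed
  then have inv0: "raises 0 (op_inv (frame (\<lambda>j. A0 j z)))"
    by (rule homogeneous_inverse[OF _ A0_gen[OF z]])
  have "raises 2 (frame (\<lambda>j. A j z) - frame (\<lambda>j. A0 j z))"
    by (intro raises_frame_diff 2 raises_A0 z) (use 4 in auto)
  from unipotent_inverse[OF A0_gen[OF z] inv0 this]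
  show "op_det (frame (\<lambda>j. A j z)) \<noteq> 0" "raises 0 (op_inv (frame (\<lambda>j. A j z)))" .
qed

text \<open>
  The equation \<open>euler (A j) = A j + \<partial>\<^sub>j U\<close>, solved for the part of \<open>A j\<close> that raises degrees by at least 4.
  The remaining part, on which the equation puts no condition, is the prescribed \<open>A0 j\<close>.
\<close>
definition picard :: "('n \<Rightarrow> 'n cvec \<Rightarrow> 'n op) \<Rightarrow> 'n \<Rightarrow> 'n cvec \<Rightarrow> 'n op" where
  "picard A j z = A0 j z + resolvent (pdo j (\<lambda>y. eulerop (\<lambda>i. A i y) y) z)"

lemma admissible_A0: "admissible A0"
  by (auto simp: admissible_def A0_holo)

lemma admissible_eulerop: "admissible A \<Longrightarrow> holo_op (\<lambda>y. eulerop (\<lambda>i. A i y) y) Z"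
  by (intro holo_op_eulerop Z admissible_det) (auto simp: admissible_def)

lemma admissible_picard:
  assumes "admissible A" shows "admissible (picard A)"
  unfolding admissible_def
proof (intro ballI conjI)
  fix j assume j: "j \<in> J"
  show "holo_op (picard A j) Z"
    unfolding picard_def
    by (intro holo_op_add[OF Z] holo_op_resolvent Z A0_holo j holo_op_pdo admissible_eulerop assms)
  show "raises 4 (picard A j z - A0 j z)" if "z \<in> Z" for z
    by (simp add: picard_def raises_4_resolvent)
qed

lemma picard_contraction:
  assumes A: "admissible A" and A': "admissible A'" and z: "z \<in> Z" and j: "j \<in> J"
    and d: "\<And>j z. j \<in> J \<Longrightarrow> z \<in> Z \<Longrightarrow> raises (d + 2) (A j z - A' j z)"
  shows "raises (d + 4) (picard A j z - picard A' j z)"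
proof -
  have "picard A j z - picard A' j z =
      resolvent (pdo j (\<lambda>y. eulerop (\<lambda>i. A i y) y - eulerop (\<lambda>i. A' i y) y) z)"
    by (simp add: picard_def resolvent_diff pdo_diff[OF Z] admissible_eulerop A A' z)
  moreover have "raises (d + 4) \<dots>"
    by (intro raises_resolvent raises_pdo[OF Z z] raises_eulerop_diff admissible_raises admissible_det
        admissible_inv A A' d)
  ultimately show ?thesis by simp
qed

text \<open>
  Each step improves the agreement of successive iterates by two degrees, so that the iteration is
  stationary after \<open>k\<close> steps.
\<close>
lemma picard_fixed_point:
  obtains A where "admissible A" "\<And>j z. j \<in> J \<Longrightarrow> z \<in> Z \<Longrightarrow> A j z = picard A j z"
proof -
  define P where "P n = (picard ^^ n) A0" for n
  have adm: "admissible (P n)" for n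
    by (induction n) (auto simp: P_def admissible_A0 admissible_picard)
  have close: "raises (2 * n + 4) (P (Suc n) j z - P n j z)" if "j \<in> J" "z \<in> Z" for n j z
    using that
  proof (induction n arbitrary: j z)
    case 0
    then show ?case using adm[of 1] by (auto simp: admissible_def P_def)
  next
    case (Suc n)
    have "raises ((2 * n + 2) + 4) (picard (P (Suc n)) j z - picard (P n) j z)"
      by (intro picard_contraction adm Suc) (rule raises_mono[OF Suc.IH], simp_all)
    then show ?case by (simp add: P_def numeral_eq_Suc)
  qed
  show thesis
  proof
    show "admissible (P k)" by (rule adm)
    fix j z assume "j \<in> J" "z \<in> Z"
    then have "P (Suc k) j z - P k j z = 0"
      by (intro raises_eq_0[OF close]) auto
    then show "P k j z = picard (P k) j z" by (simp add: P_def)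
  qed
qed

end

section \<open>Properties of the extension\<close>

locale higgs_solution = graded_higgs +
  fixes A
  assumes adm: "admissible A"
    and fixed: "\<And>j z. j \<in> J \<Longrightarrow> z \<in> Z \<Longrightarrow> A j z = picard A j z"
begin

definition U where "U z = eulerop (\<lambda>j. A j z) z"
definition C where "C c z = mulop (\<lambda>j. A j z) c"

lemmas A_raises = admissible_raises[OF adm] and A_det = admissible_det[OF adm] and A_inv = admissible_inv[OF adm]

lemma A_holo: "j \<in> J \<Longrightarrow> holo_op (A j) Z" using adm by (simp add: admissible_def)
lemma A_near: "j \<in> J \<Longrightarrow> z \<in> Z \<Longrightarrow> raises 4 (A j z - A0 j z)" using adm by (simp add: admissible_def)
lemma U_holo: "holo_op U Z" unfolding U_def[abs_def] by (rule admissible_eulerop[OF adm])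
lemma C_holo: "holo_op (C c) Z" unfolding C_def[abs_def] by (intro holo_op_mulop Z A_holo A_det)
lemma U_raises: "z \<in> Z \<Longrightarrow> raises 4 (U z)" unfolding U_def by (intro raises_eulerop A_raises A_inv)
lemma C_raises: "z \<in> Z \<Longrightarrow> raises (td c) (C c z)" unfolding C_def by (intro raises_mulop A_raises A_inv)

lemma A_eq: "j \<in> J \<Longrightarrow> z \<in> Z \<Longrightarrow> A j z = A0 j z + resolvent (pdo j U z)"
  using fixed by (simp add: picard_def U_def[abs_def])

lemma euler_A: assumes "j \<in> J" "z \<in> Z" shows "euler (A j z) = A j z + pdo j U z"
proof -
  have "euler (A0 j z) = A0 j z"
  proof (rule op_eqI)
    fix c a
    show "entry (euler (A0 j z)) c a = entry (A0 j z) c a"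
      using A0_deg[OF assms, of c a] edeg_eq_iff[of c a 1] by (auto simp: euler_def)
  qed
  moreover have "raises 4 (pdo j U z)" by (intro raises_pdo[OF Z] assms U_raises)
  ultimately show ?thesis by (simp add: A_eq assms euler_simps euler_resolvent algebra_simps)
qed

lemma pdo_A:
  assumes "j \<in> J" "z \<in> Z" shows "pdo i (A j) z = pdo i (A0 j) z + resolvent (pdo i (pdo j U) z)"
proof -
  have "pdo i (A j) z = pdo i (\<lambda>z. A0 j z + resolvent (pdo j U z)) z"
    by (rule pdo_cong[OF Z assms(2)]) (simp add: A_eq assms)
  also have "\<dots> = pdo i (A0 j) z + resolvent (pdo i (pdo j U) z)"
    by (simp add: pdo_add[OF Z] pdo_resolvent[OF Z] A0_holo assms holo_op_resolvent Z holo_op_pdo U_holo)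
  finally show ?thesis .
qed

lemma A_closed: "i \<in> J \<Longrightarrow> j \<in> J \<Longrightarrow> z \<in> Z \<Longrightarrow> pdo i (A j) z = pdo j (A i) z"
  by (simp add: pdo_A A0_closed[of i j] pdo_commute[OF U_holo Z, of z i j])

text \<open>
  By the derivation property, the commutator \<open>\<kappa>\<close> of \<open>A i\<close> and \<open>A j\<close> satisfies
  \<open>euler \<kappa> - 2 \<kappa> = \<partial>\<^sub>i (comm U (A j)) - \<partial>\<^sub>j (comm U (A i))\<close>.  As \<open>U\<close> is made of words with at least two
  letters, the right side raises degrees by two more than the commutators of the generators.  The
  eigenvalue 2 excludes raising by exactly 4; that part of \<open>\<kappa>\<close> is the commutator of the initial data.
\<close>
lemma A_comm: assumes "i \<in> J" "j \<in> J" "z \<in> Z" shows "comm (A i z) (A j z) = 0"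
proof -
  have "raises (6 + 2 * n) (comm (A i z) (A j z))" if "i \<in> J" "j \<in> J" "z \<in> Z" for i j z n
    using that
  proof (induction n arbitrary: i j z)
    case 0
    have "comm (A i z) (A j z) = comm (A i z - A0 i z) (A j z) + comm (A0 i z) (A j z - A0 j z) + comm (A0 i z) (A0 j z)"
      by (simp add: comm_def algebra_simps)
    moreover have "raises (4 + 2) (comm (A i z - A0 i z) (A j z))"
      by (intro raises_comm A_near A_raises 0)
    moreover have "raises (2 + 4) (comm (A0 i z) (A j z - A0 j z))"
      by (intro raises_comm A_near raises_A0 0)
    ultimately show ?case by (simp add: A0_comm 0 raises_add)
  next
    case (Suc n)
    let ?\<kappa> = "comm (A i z) (A j z)"
    have UA: "raises (8 + 2 * n) (comm (U y) (A l y))" if "l \<in> J" "y \<in> Z" for l y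
    proof -
      have "raises ((4 + 2 * n) + 4) (comm (A l y) (U y))"
        unfolding U_def
        by (intro raises_comm_eulerop A_raises A_inv that) (assumption | rule raises_mono[OF Suc.IH[OF that(1) _ that(2)]] | simp)+
      then show ?thesis by (simp add: comm_swap[of "U y"])
    qed
    \<comment> \<open>the contribution \<open>comm U (\<partial>\<^sub>i A\<^sub>j - \<partial>\<^sub>j A\<^sub>i)\<close> vanishes because the generators are closed\<close>
    have "euler ?\<kappa> - sc (of_nat 2) ?\<kappa> =
        pdo i (\<lambda>y. comm (U y) (A j y)) z - pdo j (\<lambda>y. comm (U y) (A i y)) z"
      unfolding sc_two
      by (simp add: euler_comm euler_A pdo_comm[OF Z] U_holo A_holo Suc.prems A_closed[of i j])
         (simp add: comm_def algebra_simps)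
    moreover have "raises (8 + 2 * n) \<dots>"
      by (intro raises_diff raises_pdo[OF Z] UA Suc.prems)
    ultimately show ?case
      using euler_gain[OF Suc.IH[OF Suc.prems], of "8 + 2 * n" 2] by simp
  qed
  then show ?thesis using assms by (intro raises_all_eq_0) 
qed

lemma C_comm_A: "j \<in> J \<Longrightarrow> z \<in> Z \<Longrightarrow> comm (C c z) (A j z) = 0"
  using comm_mulop_eq_0[of "A j z" "\<lambda>j. A j z" c] A_comm by (simp add: C_def comm_swap[of "mulop _ _"])

lemma C_comm: "z \<in> Z \<Longrightarrow> comm (C c z) (C d z) = 0"
  using comm_mulop_eq_0[of "C c z" "\<lambda>j. A j z" d] C_comm_A by (simp add: C_def)

lemma U_as_sum: "U z = (\<Sum>c | 4 \<le> td c. sc ((of_nat (td c) / 2 - 1) * z $ c) (C c z))"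
  by (simp add: U_def eulerop_def C_def)

lemma U_comm_A: "j \<in> J \<Longrightarrow> z \<in> Z \<Longrightarrow> comm (U z) (A j z) = 0"
  by (simp add: U_as_sum comm_sum_left comm_sc_left C_comm_A)

lemma U_comm_C: "z \<in> Z \<Longrightarrow> comm (U z) (C c z) = 0"
  by (simp add: U_as_sum comm_sum_left comm_sc_left C_comm)

lemma C_unit: "z \<in> Z \<Longrightarrow> entry (C c z) a iu = (if a = c then 1 else 0)"
  by (simp add: C_def mulop_unit A_det)

lemma U_unit: "z \<in> Z \<Longrightarrow> entry (U z) a iu = (if 4 \<le> td a then (of_nat (td a) / 2 - 1) * z $ a else 0)"
  by (simp add: U_as_sum C_unit delta_mult cong: if_cong)

lemma pdo_U_unit:
  assumes "z \<in> Z"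
  shows "entry (pdo i U z) a iu = (if 4 \<le> td a \<and> i = a then of_nat (td a) / 2 - 1 else 0)"
proof -
  have "entry (pdo i U z) a iu = pd i (\<lambda>y. (if 4 \<le> td a then of_nat (td a) / 2 - 1 else 0) * y $ a) z"
    unfolding pdo_def entry_Op by (rule pd_cong[OF Z assms]) (simp add: U_unit)
  also have "\<dots> = (if 4 \<le> td a then of_nat (td a) / 2 - 1 else 0) * (if i = a then 1 else 0)"
    by (simp only: pd_cmult[OF holo_on_coordinate open_UNIV UNIV_I] pd_coordinate)
  finally show ?thesis by auto
qed

lemma A_unit: assumes "j \<in> J" "z \<in> Z" shows "entry (A j z) c iu = (if c = j then 1 else 0)"
proof -
  have "entry (resolvent (pdo j U z)) c iu = 0"
    using pdo_U_unit[OF assms(2), of j c] assms(1) by (auto simp: resolvent_def J_iff)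
  then show ?thesis by (simp add: A_eq assms A0_unit)
qed

lemma raises_of_comm_A:
  assumes "z \<in> Z" "\<And>j. j \<in> J \<Longrightarrow> raises (d + 2) (comm Q (A j z))" "\<And>c. entry Q c iu = 0"
  shows "raises d Q"
  by (rule raises_of_commutators[of "\<lambda>j. A j z"]) (use assms A_raises A_det A_inv in auto)

lemma centralizer_faithful:
  assumes "z \<in> Z" "\<And>j. j \<in> J \<Longrightarrow> comm Q (A j z) = 0" "\<And>c. entry Q c iu = 0"
  shows "Q = 0"
proof -
  have "raises (2 * k + 1) Q" by (rule raises_of_comm_A[OF assms(1)]) (simp_all add: assms)
  then show ?thesis by (rule raises_eq_0) simp
qed

lemma C_framing: "j \<in> J \<Longrightarrow> z \<in> Z \<Longrightarrow> C j z = A j z"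
  using centralizer_faithful[of z "C j z - A j z"] by (simp add: comm_diff_left C_comm_A A_comm C_unit A_unit)

lemma C_one: "z \<in> Z \<Longrightarrow> C iu z = 1"
  using centralizer_faithful[of z "C iu z - 1"] by (simp add: comm_diff_left C_comm_A C_unit entry_one)

lemma C_mult: assumes "z \<in> Z" shows "C a z * C b z = (\<Sum>c\<in>UNIV. sc (entry (C a z) c b) (C c z))"
proof -
  let ?Q = "C a z * C b z - (\<Sum>c\<in>UNIV. sc (entry (C a z) c b) (C c z))"
  have "?Q = 0"
  proof (rule centralizer_faithful[OF assms])
    fix j assume "j \<in> J"
    then have "comm (A j z) ?Q = 0"
      using C_comm_A[OF _ assms] 
      by (simp add: comm_def algebra_simps sum_distrib_left sum_distrib_right sc_mult_left sc_mult_right)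
         (metis (no_types, lifting) mult.assoc)
    then show "comm ?Q (A j z) = 0" by (simp add: comm_swap[of ?Q])
  next
    show "entry ?Q c iu = 0" for c
      by (simp add: entry_mult C_unit assms delta_mult cong: if_cong)
  qed
  then show ?thesis by simp
qed

text \<open>
  In the applications \<open>D j\<close> is a defect of closedness and \<open>X\<close> the corresponding defect for \<open>U\<close>.  Since \<open>X\<close>
  kills the unit, it is determined by its commutators with the generators, hence by \<open>D\<close>, with a gain of
  two degrees because \<open>U\<close> raises degrees by 4; and \<open>D\<close> is determined by \<open>X\<close> through \<open>euler\<close>.
\<close>
lemma flatness_gap:
  assumes X: "holo_op X Z" and unit: "\<And>z c. z \<in> Z \<Longrightarrow> entry (X z) c iu = 0"
    and comm: "\<And>j z. j \<in> J \<Longrightarrow> z \<in> Z \<Longrightarrow> comm (X z) (A j z) = - comm (U z) (D j z)"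
    and base: "\<And>j z. j \<in> J \<Longrightarrow> z \<in> Z \<Longrightarrow> raises 4 (D j z)"
    and euler: "\<And>j z. j \<in> J \<Longrightarrow> z \<in> Z \<Longrightarrow> euler (D j z) = D j z + pdo j X z"
    and "j \<in> J" "z \<in> Z"
  shows "D j z = 0"
proof -
  have "raises (4 + 2 * n) (D j z)" if "j \<in> J" "z \<in> Z" for n j z
    using that
  proof (induction n arbitrary: j z)
    case (Suc n)
    have "raises (6 + 2 * n) (X y)" if y: "y \<in> Z" for y
    proof (rule raises_of_comm_A[OF y _ unit[OF y]])
      fix i assume "i \<in> J"
      then have "raises (4 + (4 + 2 * n)) (comm (U y) (D i y))"
        using y by (intro raises_comm U_raises Suc.IH)
      then show "raises (6 + 2 * n + 2) (comm (X y) (A i y))"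
        using \<open>i \<in> J\<close> y by (simp add: comm)
    qed
    then have "raises (6 + 2 * n) (euler (D j z) - sc (of_nat 1) (D j z))"
      using Suc.prems by (simp add: euler raises_pdo[OF Z])
    from euler_gain[OF Suc.IH[OF Suc.prems] this] show ?case by simp
  qed (simp add: base)
  then show ?thesis using assms(6,7) by (intro raises_all_eq_0)
qed

lemma pdo_comm_zero:
  assumes "holo_op F Z" "holo_op G Z" "z \<in> Z" "\<And>y. y \<in> Z \<Longrightarrow> comm (F y) (G y) = 0"
  shows "comm (pdo i F z) (G z) = - comm (F z) (pdo i G z)"
proof -
  have "0 = pdo i (\<lambda>y. comm (F y) (G y)) z"
    using pdo_cong[OF Z assms(3), of "\<lambda>y. comm (F y) (G y)" "\<lambda>_. 0"] assms(4) by simp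
  then show ?thesis
    unfolding pdo_comm[OF Z assms(1,2,3)] by (simp add: eq_neg_iff_add_eq_0)
qed

text \<open>
  For an index of degree 2 this is closedness of the generators.  For the unit and in degrees at least 4
  both sides are compared by \<open>flatness_gap\<close>; its hypothesis on \<open>comm (X z) (A j z)\<close> comes from
  differentiating \<open>comm U (A j) = 0\<close> and \<open>comm U (C c) = 0\<close>, and from applying \<open>euler\<close> to
  \<open>comm (C c) (A j) = 0\<close>.
\<close>
lemma closed_framing:
  assumes j: "j \<in> J" and z: "z \<in> Z" shows "pdo c (A j) z = pdo j (C c) z"
proof -
  consider "c \<in> J" | "c = iu" | "4 \<le> td c"
  proof -
    have "td c = 0 \<or> td c = 2 \<or> 4 \<le> td c" using td_even[of c] by presburger
    then show thesis using that td_zero J_iff by blast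
  qed
  then show ?thesis
  proof cases
    case 1
    then have "pdo j (C c) z = pdo j (A c) z" by (intro pdo_cong[OF Z z]) (simp add: C_framing)
    then show ?thesis using A_closed[of c j] 1 j z by simp
  next
    case 2
    have "pdo iu (A j) z = 0"
    proof (rule flatness_gap[of "pdo iu U" "\<lambda>j. pdo iu (A j)"])
      show "holo_op (pdo iu U) Z" by (intro holo_op_pdo U_holo Z)
      fix z assume z: "z \<in> Z"
      show "entry (pdo iu U z) c iu = 0" for c by (cases "c = iu") (simp_all add: pdo_U_unit[OF z])
      fix j assume j: "j \<in> J"
      show "comm (pdo iu U z) (A j z) = - comm (U z) (pdo iu (A j) z)"
        by (intro pdo_comm_zero U_holo A_holo j z U_comm_A)
      have "pdo iu (\<lambda>y. A j y - A0 j y) z = pdo iu (A j) z - pdo iu (A0 j) z"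
        by (simp add: pdo_diff[OF Z] A_holo A0_holo j z)
      also have "pdo iu (A0 j) z = 0" using j z by (intro A0_const) (auto simp: J_iff)
      finally show "raises 4 (pdo iu (A j) z)"
        using raises_pdo[OF Z z, of 4 "\<lambda>y. A j y - A0 j y" iu] A_near[OF j] by simp
      have "euler (pdo iu (A j) z) = pdo iu (\<lambda>y. euler (A j y)) z"
        by (simp add: pdo_euler[OF Z] A_holo j z)
      also have "\<dots> = pdo iu (\<lambda>y. A j y + pdo j U y) z"
        by (rule pdo_cong[OF Z z]) (simp add: euler_A j)
      also have "\<dots> = pdo iu (A j) z + pdo j (pdo iu U) z"
        by (simp add: pdo_add[OF Z] A_holo j z holo_op_pdo U_holo Z pdo_commute[OF U_holo Z z, of j iu])
      finally show "euler (pdo iu (A j) z) = pdo iu (A j) z + pdo j (pdo iu U) z" .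
    qed (use j z in auto)
    moreover have "pdo j (C c) z = pdo j (\<lambda>_. 1) z"
      by (rule pdo_cong[OF Z z]) (simp add: 2 C_one)
    ultimately show ?thesis by (simp add: 2)
  next
    case 3
    \<comment> \<open>the difference of \<open>\<partial>\<^sub>c U\<close> and its value \<open>(euler - 1) C\<^sub>c\<close> for a homogeneous closed family\<close>
    define X where "X y = pdo c U y - euler (C c y) + C c y" for y
    have holoX: "holo_op X Z"
      unfolding X_def by (intro holo_op_add[OF Z] holo_op_diff[OF Z] holo_op_pdo U_holo Z holo_op_euler C_holo)
    have "pdo c (A j) z - pdo j (C c) z = 0"
    proof (rule flatness_gap[of X "\<lambda>j z. pdo c (A j) z - pdo j (C c) z"])
      show "holo_op X Z" by (rule holoX)
      fix z assume z: "z \<in> Z"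
      have deg: "edeg c iu = of_nat (td c) / 2" by (simp add: edeg_def)
      show "entry (X z) a iu = 0" for a
        using 3 deg by (simp add: X_def euler_def pdo_U_unit C_unit z)
      fix j assume j: "j \<in> J"
      have "comm (pdo c U z) (A j z) = - comm (U z) (pdo c (A j) z)"
        by (intro pdo_comm_zero U_holo A_holo j z U_comm_A)
      moreover have "comm (pdo j U z) (C c z) = - comm (U z) (pdo j (C c) z)"
        by (intro pdo_comm_zero U_holo C_holo z U_comm_C)
      moreover have "comm (euler (C c z)) (A j z) = - comm (C c z) (A j z + pdo j U z)"
        using euler_comm[of "C c z" "A j z"]
        by (simp add: C_comm_A j z euler_simps euler_A eq_neg_iff_add_eq_0)
      moreover have "comm (C c z) (pdo j U z) = - comm (pdo j U z) (C c z)" by (rule comm_swap)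
      ultimately show "comm (X z) (A j z) = - comm (U z) (pdo c (A j) z - pdo j (C c) z)"
        by (simp add: X_def comm_add_left comm_diff_left comm_add_right comm_diff_right C_comm_A[OF j z])
      have "pdo c (\<lambda>y. A j y - A0 j y) z = pdo c (A j) z - pdo c (A0 j) z"
        by (simp add: pdo_diff[OF Z] A_holo A0_holo j z)
      also have "pdo c (A0 j) z = 0" using j z 3 by (intro A0_const) (auto simp: J_iff)
      finally have "raises 4 (pdo c (A j) z)"
        using raises_pdo[OF Z z, of 4 "\<lambda>y. A j y - A0 j y" c] A_near[OF j] by simp
      moreover have "raises 4 (pdo j (C c) z)"
        by (intro raises_pdo[OF Z z] raises_mono[OF C_raises 3])
      ultimately show "raises 4 (pdo c (A j) z - pdo j (C c) z)" by (rule raises_diff)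
      have "euler (pdo c (A j) z) = pdo c (\<lambda>y. euler (A j y)) z"
        by (simp add: pdo_euler[OF Z] A_holo j z)
      also have "\<dots> = pdo c (\<lambda>y. A j y + pdo j U y) z"
        by (rule pdo_cong[OF Z z]) (simp add: euler_A j)
      also have "\<dots> = pdo c (A j) z + pdo j (pdo c U) z"
        by (simp add: pdo_add[OF Z] A_holo j z holo_op_pdo U_holo Z pdo_commute[OF U_holo Z z, of j c])
      finally have 1: "euler (pdo c (A j) z) = pdo c (A j) z + pdo j (pdo c U) z" .
      have 2: "euler (pdo j (C c) z) = pdo j (\<lambda>y. euler (C c y)) z"
        by (simp add: pdo_euler[OF Z] C_holo z)
      have "pdo j X z = pdo j (pdo c U) z - pdo j (\<lambda>y. euler (C c y)) z + pdo j (C c) z"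
        unfolding X_def
        by (simp add: pdo_add[OF Z] pdo_diff[OF Z] z holo_op_diff[OF Z] holo_op_pdo U_holo Z holo_op_euler C_holo)
      then show "euler (pdo c (A j) z - pdo j (C c) z) = pdo c (A j) z - pdo j (C c) z + pdo j X z"
        by (simp add: euler_simps 1 2)
    qed (use j z in auto)
    then show ?thesis by simp
  qed
qed

text \<open>
  The difference of the two sides kills the unit, because \<open>C a e\<close> is constant.  It commutes with the
  generators: after differentiating \<open>comm (C a) (A j) = 0\<close>, the closedness relative to the generators reduces
  this to the derivative of \<open>comm (C a) (C b) = 0\<close> in direction \<open>j\<close>.
\<close>
lemma closed: assumes z: "z \<in> Z" shows "pdo a (C b) z = pdo b (C a) z"
proof -
  have "pdo a (C b) z - pdo b (C a) z = 0"
  proof (rule centralizer_faithful[OF z])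
    have "entry (pdo a (C b) z) c iu = 0" for a b c
    proof -
      have "pd a (\<lambda>y. entry (C b y) c iu) z = pd a (\<lambda>_. if c = b then 1 else 0) z"
        by (rule pd_cong[OF Z z]) (simp add: C_unit)
      then show ?thesis by (simp add: pdo_def pd_const)
    qed
    then show "entry (pdo a (C b) z - pdo b (C a) z) c iu = 0" for c by simp
    fix j assume j: "j \<in> J"
    have "comm (pdo a (C b) z) (A j z) = - comm (C b z) (pdo j (C a) z)" for a b
      unfolding closed_framing[OF j z, symmetric]
      by (intro pdo_comm_zero C_holo A_holo j z C_comm_A)
    moreover have "comm (pdo j (C a) z) (C b z) = - comm (C a z) (pdo j (C b) z)"
      by (intro pdo_comm_zero C_holo z C_comm)
    ultimately show "comm (pdo a (C b) z - pdo b (C a) z) (A j z) = 0"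
      by (simp add: comm_diff_left) (simp add: comm_def algebra_simps)
  qed
  then show ?thesis by simp
qed

text \<open>
  The adjoint with respect to the pairing of \<open>T a\<close> with \<open>T (\<delta> a)\<close>.
\<close>
definition adj :: "'a op \<Rightarrow> 'a op" where
  "adj X = Op (\<lambda>c a. entry X (\<delta> a) (\<delta> c))"

lemma adj_simps: "adj (X - Y) = adj X - adj Y" "adj (X + Y) = adj X + adj Y" "adj (sc l X) = sc l (adj X)" "adj 0 = 0"
  "adj (\<Sum>i\<in>S. F i) = (\<Sum>i\<in>S. adj (F i))"
  by (rule op_eqI; simp add: adj_def)+

lemma inj_delta: "inj \<delta>" by (metis delta(1) injI)

lemma adj_one: "adj 1 = 1"
  by (rule op_eqI) (auto simp: adj_def entry_one inj_eq[OF inj_delta])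

lemma adj_mult: "adj (X * Y) = adj Y * adj X"
proof (rule op_eqI)
  fix c a
  have "bij \<delta>" using delta(1) by (metis bijI' )
  then have "(\<Sum>b\<in>UNIV. entry X (\<delta> a) b * entry Y b (\<delta> c)) = (\<Sum>b\<in>UNIV. entry X (\<delta> a) (\<delta> b) * entry Y (\<delta> b) (\<delta> c))"
    by (intro sum.reindex_bij_betw[symmetric])
  then show "entry (adj (X * Y)) c a = entry (adj Y * adj X) c a"
    by (simp add: adj_def entry_mult mult.commute)
qed

lemma adj_comm: "adj (comm X Y) = - comm (adj X) (adj Y)"
  by (simp add: comm_def adj_simps adj_mult)

lemma adj_wprod: "adj (wprod X ws) = wprod (\<lambda>j. adj (X j)) (rev ws)"
  by (induction ws) (simp_all add: adj_one adj_mult wprod_append)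

lemma raises_adj: "raises d X \<Longrightarrow> raises d (adj X)"
  unfolding raises_def adj_def entry_Op
proof (intro allI impI)
  fix c a assume X: "\<forall>c a. entry X c a \<noteq> 0 \<longrightarrow> td a + d \<le> td c" "entry X (\<delta> a) (\<delta> c) \<noteq> 0"
  then have "td (\<delta> c) + d \<le> td (\<delta> a)" by blast
  then show "td a + d \<le> td c" using delta(2)[of a] delta(2)[of c] by linarith
qed

lemma euler_adj: "euler (adj X) = adj (euler X)"
proof (rule op_eqI)
  fix c a
  have "of_nat (td (\<delta> a)) + of_nat (td a) = (of_nat (td (\<delta> c)) + of_nat (td c) :: complex)"
    using delta(2)[of a] delta(2)[of c] by (simp flip: of_nat_add)
  moreover have "edeg (\<delta> a) (\<delta> c) - edeg c a = ((of_nat (td (\<delta> a)) + of_nat (td a)) - (of_nat (td (\<delta> c)) + of_nat (td c))) / 2"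
    by (simp add: edeg_def diff_divide_distrib add_divide_distrib)
  ultimately have "edeg (\<delta> a) (\<delta> c) = edeg c a" by simp
  then show "entry (euler (adj X)) c a = entry (adj (euler X)) c a" by (simp add: euler_def adj_def)
qed

lemma pdo_adj: "pdo i (\<lambda>y. adj (F y)) z = adj (pdo i F z)" and holo_op_adj: "holo_op F Z \<Longrightarrow> holo_op (\<lambda>y. adj (F y)) Z"
  by (simp_all add: pdo_def adj_def holo_op_def)

lemma adj_pw:
  assumes "z \<in> Z" shows "adj (pw a (\<lambda>j. A j z)) = pw a (\<lambda>j. adj (A j z))"
proof -
  have "adj (wprod (\<lambda>j. A j z) ws) = wprod (\<lambda>j. adj (A j z)) ws" if "ws \<in> wordset a" for ws
    unfolding adj_wprod
  proof (rule wprod_rev)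
    fix i j assume "i \<in> J" "j \<in> J"
    then show "comm (adj (A i z)) (adj (A j z)) = 0"
      using adj_comm[of "A i z" "A j z"] A_comm[OF _ _ assms] by (simp add: adj_simps)
  qed (rule wordset_length(2)[OF that])
  then show ?thesis by (simp add: pw_def adj_simps)
qed

text \<open>
  Reversing a word of commuting letters does not change it, so the adjoint of \<open>pw a\<close> in the generators is
  \<open>pw a\<close> in the adjoint generators.  Hence \<open>U\<close> differs from its adjoint by terms that raise degrees by two
  more than the difference of \<open>A j\<close> and its adjoint.
\<close>
lemma A_sym: assumes "j \<in> J" "z \<in> Z" shows "adj (A j z) = A j z"
proof -
  have "raises (4 + 2 * n) (A j z - adj (A j z))" if "j \<in> J" "z \<in> Z" for n j z
    using that
  proof (induction n arbitrary: j z)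
    case 0
    have "adj (A0 j z) = A0 j z" by (rule op_eqI) (simp add: adj_def A0_sym 0)
    then have eq: "A j z - adj (A j z) = (A j z - A0 j z) - adj (A j z - A0 j z)" by (simp add: adj_simps)
    have "raises 4 (A j z - adj (A j z))" unfolding eq by (intro raises_diff raises_adj A_near 0)
    then show ?case by simp
  next
    case (Suc n)
    have C: "raises (6 + 2 * n) (C c y - adj (C c y))" if c: "4 \<le> td c" and y: "y \<in> Z" for c y
    proof -
      have "C c y - adj (C c y) = (\<Sum>a\<in>UNIV. sc (entry (op_inv (frame (\<lambda>j. A j y))) a c)
          (pw a (\<lambda>j. A j y) - pw a (\<lambda>j. adj (A j y))))"
        by (simp add: C_def mulop_def adj_simps adj_pw y sc_diff sum_subtractf)
      moreover have "raises (6 + 2 * n) (sc (entry (op_inv (frame (\<lambda>j. A j y))) a c)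
          (pw a (\<lambda>j. A j y) - pw a (\<lambda>j. adj (A j y))))" for a
      proof (cases "entry (op_inv (frame (\<lambda>j. A j y))) a c = 0")
        case False
        then have "td c \<le> td a" using A_inv[OF y] by (auto simp: raises_def)
        moreover have "raises ((2 + 2 * n) + td a) (pw a (\<lambda>j. A j y) - pw a (\<lambda>j. adj (A j y)))"
          by (intro raises_pw_diff A_raises raises_adj y) (assumption | rule raises_mono[OF Suc.IH[OF _ y]] | simp)+
        ultimately show ?thesis
          using c by (intro raises_sc) (erule raises_mono, simp)
      qed simp
      ultimately show ?thesis by (simp add: raises_sum)
    qed
    have U: "raises (6 + 2 * n) (U y - adj (U y))" if "y \<in> Z" for y
    proof -
      have "U y - adj (U y) = (\<Sum>c | 4 \<le> td c. sc ((of_nat (td c) / 2 - 1) * y $ c) (C c y - adj (C c y)))"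
        by (simp add: U_as_sum adj_simps sc_diff sum_subtractf)
      then show ?thesis using C that by (auto intro!: raises_sum raises_sc)
    qed
    have "euler (A j z - adj (A j z)) - sc (of_nat 1) (A j z - adj (A j z)) = pdo j (\<lambda>y. U y - adj (U y)) z"
      by (simp add: euler_simps euler_adj euler_A Suc.prems adj_simps pdo_diff[OF Z] U_holo holo_op_adj pdo_adj)
    moreover have "raises (6 + 2 * n) \<dots>" by (intro raises_pdo[OF Z] U Suc.prems)
    ultimately show ?case
      using euler_gain[OF Suc.IH[OF Suc.prems], of "6 + 2 * n" 1] by simp
  qed
  then have "A j z - adj (A j z) = 0" using assms by (intro raises_all_eq_0)
  then show ?thesis by simp
qed

lemma C_sym: assumes z: "z \<in> Z" shows "adj (C c z) = C c z"
proof -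
  have "wprod (\<lambda>j. adj (A j z)) ws = wprod (\<lambda>j. A j z) ws" if "set ws \<subseteq> J" for ws
    using that by (induction ws) (simp_all add: A_sym z)
  then have "pw a (\<lambda>j. adj (A j z)) = pw a (\<lambda>j. A j z)" for a
    by (simp add: pw_def wordset_length(2))
  then show ?thesis by (simp add: C_def mulop_def adj_simps adj_pw z)
qed

text \<open>
  \<open>U\<close> is a sum of terms that contain a coordinate of degree at least 4 as a factor, and differentiation in
  direction \<open>j\<close> does not touch this factor.
\<close>
lemma A_initial:
  assumes j: "j \<in> J" and z: "z \<in> Z" and t: "\<And>c. 4 \<le> td c \<Longrightarrow> z $ c = 0"
  shows "A j z = A0 j z"
proof -
  have "pdo j (\<lambda>y. sc ((of_nat (td c) / 2 - 1) * y $ c) (C c y)) z = 0" if c: "4 \<le> td c" for c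
  proof -
    have "c \<noteq> j" using c j by (auto simp: J_iff)
    then have "pd j (\<lambda>y. (of_nat (td c) / 2 - 1) * y $ c) z = 0"
      using pd_cmult[OF holo_on_coordinate open_UNIV UNIV_I, of j _ c z] by (simp add: pd_coordinate)
    then show ?thesis
      using pdo_sc[OF Z holo_on_cmult[OF holo_on_coordinate Z] C_holo z] t[OF c] by simp
  qed
  then have "pdo j U z = 0"
    unfolding U_as_sum[abs_def]
    using pdo_sum[OF Z, of "{c. 4 \<le> td c}" "\<lambda>c y. sc ((of_nat (td c) / 2 - 1) * y $ c) (C c y)" z j]
    by (simp add: holo_op_sc[OF Z] holo_on_cmult[OF holo_on_coordinate Z] C_holo z)
  then show ?thesis by (simp add: A_eq j z)
qed

end

theorem (in graded_higgs) potential_multiplication_exists: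
  obtains C where
    "\<And>c. holo_op (C c) Z"
    "\<And>z a b. z \<in> Z \<Longrightarrow> C a z * C b z = C b z * C a z"
    "\<And>z. z \<in> Z \<Longrightarrow> C iu z = 1"
    "\<And>z a c. z \<in> Z \<Longrightarrow> entry (C a z) c iu = (if c = a then 1 else 0)"
    "\<And>z a b. z \<in> Z \<Longrightarrow> C a z * C b z = (\<Sum>c\<in>UNIV. sc (entry (C a z) c b) (C c z))"
    "\<And>z a b. z \<in> Z \<Longrightarrow> pdo a (C b) z = pdo b (C a) z"
    "\<And>z a b c. z \<in> Z \<Longrightarrow> entry (C c z) (\<delta> a) (\<delta> b) = entry (C c z) b a"
    "\<And>z j c. z \<in> Z \<Longrightarrow> j \<in> J \<Longrightarrow> (\<And>c. 4 \<le> td c \<Longrightarrow> z $ c = 0) \<Longrightarrow> C c z * A0 j z = A0 j z * C c z"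
proof -
  obtain A where "admissible A" "\<And>j z. j \<in> J \<Longrightarrow> z \<in> Z \<Longrightarrow> A j z = picard A j z"
    using picard_fixed_point by blast
  then interpret higgs_solution td k iu p \<delta> Z A0 A by unfold_locales
  show thesis
  proof
    show "holo_op (C c) Z" for c by (rule C_holo)
    fix z assume z: "z \<in> Z"
    show "C a z * C b z = C b z * C a z" for a b using C_comm[OF z, of a b] by (simp add: comm_def)
    show "C iu z = 1" by (rule C_one[OF z])
    show "entry (C a z) c iu = (if c = a then 1 else 0)" for a c by (rule C_unit[OF z])
    show "C a z * C b z = (\<Sum>c\<in>UNIV. sc (entry (C a z) c b) (C c z))" for a b by (rule C_mult[OF z])
    show "pdo a (C b) z = pdo b (C a) z" for a b by (rule closed[OF z])
    show "entry (C c z) (\<delta> a) (\<delta> b) = entry (C c z) b a" for a b c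
      using arg_cong[OF C_sym[OF z, of c], of "\<lambda>X. entry X b a"] by (simp add: adj_def)
    show "C c z * A0 j z = A0 j z * C c z" if "j \<in> J" "\<And>c. 4 \<le> td c \<Longrightarrow> z $ c = 0" for j c
      using C_comm_A[OF that(1) z, of c] A_initial[OF that(1) z that(2)] by (simp add: comm_def)
  qed
qed

section \<open>Flat Frobenius manifolds\<close>

lemma clin_iff: "clin f \<longleftrightarrow> (\<forall>x y. f (x + y) = f x + f y) \<and> (\<forall>c x. f (c *s x) = c *s f x)"
  by (simp add: Vector_Spaces.linear_iff_module_hom module_hom_iff vec.module_axioms)

lemma functional_iff:
  "Vector_Spaces.linear (*s) (*) f \<longleftrightarrow> (\<forall>x y. f (x + y) = f x + f y) \<and> (\<forall>c x. f (c *s x) = c * f (x :: complex^'n))"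
  by (simp add: Vector_Spaces.linear_iff_module_hom module_hom_iff vec.module_axioms module_def algebra_simps)

definition app :: "'n::finite op \<Rightarrow> 'n cvec \<Rightarrow> 'n cvec" where
  "app X v = (\<chi> c. \<Sum>b\<in>UNIV. entry X c b * v $ b)"

lemma app_nth: "app X v $ c = (\<Sum>b\<in>UNIV. entry X c b * v $ b)" by (simp add: app_def)

lemma app_simps: "app (X + Y) v = app X v + app Y v" "app (sc l X) v = l *s app X v" "app 0 v = 0"
  "app X (v + w) = app X v + app X w" "app X (l *s v) = l *s app X v" "app 1 v = v" "app (X * Y) v = app X (app Y v)"
proof -
  show "app (X * Y) v = app X (app Y v)"
    by (simp add: vec_eq_iff app_nth entry_mult sum_distrib_left sum_distrib_right mult.assoc) 
      (intro allI sum.swap)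
qed (simp_all add: vec_eq_iff app_nth entry_one delta_mult algebra_simps sum.distrib sum_distrib_left cong: if_cong)

lemma app_sum: "app (\<Sum>i\<in>S. F i) v = (\<Sum>i\<in>S. app (F i) v)"
  by (induction S rule: infinite_finite_induct) (simp_all add: app_simps)

lemma app_axis: "app X (axis b 1) $ c = entry X c b"
  by (simp add: app_nth axis_def delta_mult cong: if_cong)

lemma dir_deriv_sum:
  "(\<And>j. j \<in> S \<Longrightarrow> holo_on (f j) M) \<Longrightarrow> open M \<Longrightarrow> x \<in> M \<Longrightarrow>
    dir_deriv X (\<lambda>x. \<Sum>j\<in>S. f j x) x = (\<Sum>j\<in>S. dir_deriv X (f j) x)"
  by (simp add: dir_deriv_def pd_sum[of _ _ M] sum_distrib_left) (rule sum.swap)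

lemma dir_deriv_mult:
  "holo_on f M \<Longrightarrow> holo_on g M \<Longrightarrow> open M \<Longrightarrow> x \<in> M \<Longrightarrow>
    dir_deriv X (\<lambda>x. f x * g x) x = dir_deriv X f x * g x + f x * dir_deriv X g x"
  by (simp add: dir_deriv_def pd_mult[of _ M] sum_distrib_left sum_distrib_right sum.distrib algebra_simps)

lemma vdir_deriv_nth: "vdir_deriv X Y x $ l = dir_deriv X (\<lambda>y. Y y $ l) x"
  by (simp add: vdir_deriv_def dir_deriv_def vpd_def)

text \<open>
  Flatness of the standard connection, from the symmetry of second partial derivatives.
\<close>
lemma dir_deriv_bracket:
  assumes X: "vholo_on X M" and Y: "vholo_on Y M" and f: "holo_on f M" and M: "open M" "x \<in> M"
  shows "dir_deriv X (dir_deriv Y f) x - dir_deriv Y (dir_deriv X f) x = dir_deriv (lie_bracket X Y) f x"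
proof -
  have expand: "dir_deriv X (dir_deriv Y f) x =
      (\<Sum>j\<in>UNIV. dir_deriv X (\<lambda>y. Y y $ j) x * pd j f x) + (\<Sum>j\<in>UNIV. \<Sum>i\<in>UNIV. Y x $ j * X x $ i * pd i (pd j f) x)"
    if "vholo_on X M" "vholo_on Y M" for X Y
  proof -
    have "dir_deriv X (dir_deriv Y f) x = (\<Sum>j\<in>UNIV. dir_deriv X (\<lambda>x. Y x $ j * pd j f x) x)"
      unfolding dir_deriv_def[of Y f, abs_def]
      using that f M by (intro dir_deriv_sum[of _ _ M] holo_on_mult holo_on_partial) (auto simp: vholo_on_def)
    also have "\<dots> = (\<Sum>j\<in>UNIV. dir_deriv X (\<lambda>y. Y y $ j) x * pd j f x + Y x $ j * dir_deriv X (pd j f) x)"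
      using that f M by (intro sum.cong refl dir_deriv_mult[of _ M] holo_on_partial) (auto simp: vholo_on_def)
    finally show ?thesis
      by (simp add: sum.distrib dir_deriv_def[of X "pd _ f"] sum_distrib_left mult.assoc)
  qed
  have "(\<Sum>j\<in>UNIV. \<Sum>i\<in>UNIV. Y x $ j * X x $ i * pd i (pd j f) x) = (\<Sum>j\<in>UNIV. \<Sum>i\<in>UNIV. X x $ j * Y x $ i * pd i (pd j f) x)"
    by (subst sum.swap) (simp add: pd_commute[OF f M] mult.commute)
  then show ?thesis
    unfolding expand[OF X Y] expand[OF Y X]
    by (simp add: dir_deriv_def[of "lie_bracket X Y"] lie_bracket_def vdir_deriv_nth sum_subtractf algebra_simps)
qed

locale flat_potential =
  fixes M :: "'n::finite cvec set" and C :: "'n \<Rightarrow> 'n cvec \<Rightarrow> 'n op" and \<delta> :: "'n \<Rightarrow> 'n" and iu :: 'n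
  assumes M: "open M" and delta: "\<And>a. \<delta> (\<delta> a) = a"
    and C_holo: "\<And>c. holo_op (C c) M"
    and C_comm: "\<And>z a b. z \<in> M \<Longrightarrow> C a z * C b z = C b z * C a z"
    and C_one: "\<And>z. z \<in> M \<Longrightarrow> C iu z = 1"
    and C_unit: "\<And>z a c. z \<in> M \<Longrightarrow> entry (C a z) c iu = (if c = a then 1 else 0)"
    and C_mult: "\<And>z a b. z \<in> M \<Longrightarrow> C a z * C b z = (\<Sum>c\<in>UNIV. sc (entry (C a z) c b) (C c z))"
    and C_closed: "\<And>z a b. z \<in> M \<Longrightarrow> pdo a (C b) z = pdo b (C a) z"
    and C_sym: "\<And>z a b c. z \<in> M \<Longrightarrow> entry (C c z) (\<delta> a) (\<delta> b) = entry (C c z) b a"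
begin

definition mulvec :: "'n cvec \<Rightarrow> 'n cvec \<Rightarrow> 'n op" where
  "mulvec z u = (\<Sum>a\<in>UNIV. sc (u $ a) (C a z))"

definition mul :: "'n cvec \<Rightarrow> 'n cvec \<Rightarrow> 'n cvec \<Rightarrow> 'n cvec" where
  "mul z u v = app (mulvec z u) v"

definition metric :: "'n cvec \<Rightarrow> 'n cvec \<Rightarrow> 'n cvec \<Rightarrow> complex" where
  "metric z u v = (\<Sum>a\<in>UNIV. u $ a * v $ \<delta> a)"

lemma mulvec_linear: "mulvec z (u + v) = mulvec z u + mulvec z v" "mulvec z (l *s u) = sc l (mulvec z u)"
  by (rule op_eqI; simp add: mulvec_def algebra_simps sum.distrib sum_distrib_left)+

lemma mul_nth: "mul z u v $ c = (\<Sum>a\<in>UNIV. \<Sum>b\<in>UNIV. u $ a * v $ b * entry (C a z) c b)"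
  by (simp add: mul_def app_nth mulvec_def sum_distrib_left sum_distrib_right) (subst sum.swap, simp add: algebra_simps)

lemma C_swap: assumes "z \<in> M" shows "entry (C a z) c b = entry (C b z) c a"
proof -
  have "entry (C a z * C b z) c iu = entry (C a z) c b" for a b
    by (simp add: entry_mult C_unit assms delta_mult cong: if_cong)
  then show ?thesis using C_comm[OF assms, of a b] by metis
qed

lemma mul_commute: "z \<in> M \<Longrightarrow> mul z u v = mul z v u"
proof (rule vec_eq_iff[THEN iffD2], rule allI)
  fix c assume "z \<in> M"
  then show "mul z u v $ c = mul z v u $ c"
    unfolding mul_nth by (subst sum.swap) (simp add: C_swap[of z _ c] mult.commute[of "u $ _"])
qed

lemma mulvec_mul: assumes "z \<in> M" shows "mulvec z u * mulvec z v = mulvec z (mul z u v)"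
proof -
  have "mulvec z u * mulvec z v = (\<Sum>a\<in>UNIV. \<Sum>b\<in>UNIV. sc (u $ a * v $ b) (C a z * C b z))"
    by (simp add: mulvec_def sum_distrib_left sum_distrib_right sc_mult_left sc_mult_right sc_sum sc_sc)
      (subst sum.swap, simp add: mult.commute)
  also have "\<dots> = (\<Sum>a\<in>UNIV. \<Sum>b\<in>UNIV. \<Sum>c\<in>UNIV. sc (u $ a * v $ b * entry (C a z) c b) (C c z))"
    by (simp add: C_mult assms sc_sum sc_sc)
  also have "\<dots> = (\<Sum>c\<in>UNIV. \<Sum>a\<in>UNIV. \<Sum>b\<in>UNIV. sc (u $ a * v $ b * entry (C a z) c b) (C c z))"
    by (subst sum.swap[of _ UNIV UNIV], subst sum.swap[of _ UNIV UNIV]) (rule refl)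
  also have "\<dots> = mulvec z (mul z u v)"
    unfolding mulvec_def mul_nth by (rule op_eqI) (simp add: sum_distrib_left sum_distrib_right)
  finally show ?thesis .
qed

lemma metric_sym: "metric z u v = metric z v u"
proof -
  have "bij \<delta>" using delta by (metis bijI')
  from sum.reindex_bij_betw[OF this, of "\<lambda>a. v $ a * u $ \<delta> a"]
  show ?thesis by (simp add: metric_def delta mult.commute)
qed

lemma metric_app:
  assumes "\<And>a b. entry X (\<delta> a) (\<delta> b) = entry X b a"
  shows "metric z (app X v) w = metric z v (app X w)"
proof -
  have bij: "bij \<delta>" using delta by (metis bijI')
  have "metric z v (app X w) = (\<Sum>b\<in>UNIV. \<Sum>c\<in>UNIV. v $ b * (entry X (\<delta> b) c * w $ c))"
    by (simp add: metric_def app_nth sum_distrib_left)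
  also have "\<dots> = (\<Sum>b\<in>UNIV. \<Sum>a\<in>UNIV. v $ b * (entry X (\<delta> b) (\<delta> a) * w $ \<delta> a))"
    using sum.reindex_bij_betw[OF bij, of "\<lambda>c. v $ _ * (entry X (\<delta> _) c * w $ c)"] by simp
  also have "\<dots> = (\<Sum>b\<in>UNIV. \<Sum>a\<in>UNIV. entry X a b * v $ b * w $ \<delta> a)"
    by (simp add: assms algebra_simps)
  also have "\<dots> = metric z (app X v) w"
    by (subst sum.swap) (simp add: metric_def app_nth sum_distrib_right)
  finally show ?thesis by simp
qed

lemma mulvec_sym: "z \<in> M \<Longrightarrow> entry (mulvec z u) (\<delta> a) (\<delta> b) = entry (mulvec z u) b a"
  by (simp add: mulvec_def C_sym)

lemma metric_axis: "metric z u (axis (\<delta> a) 1) = u $ a"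
proof -
  have "\<delta> b = \<delta> a \<longleftrightarrow> b = a" for b by (metis delta)
  then have "(axis (\<delta> a) 1 :: 'n cvec) $ \<delta> b = (if b = a then 1 else 0)" for b
    by (simp add: axis_def)
  then show ?thesis by (simp add: metric_def delta_mult cong: if_cong)
qed

lemma mul_holo: "vholo_on Y M \<Longrightarrow> vholo_on Z M \<Longrightarrow> vholo_on (\<lambda>z. mul z (Y z) (Z z)) M"
  unfolding vholo_on_def mul_nth
  using C_holo M by (auto simp: holo_op_def intro!: holo_on_sum holo_on_mult)

text \<open>
  By the Leibniz rule all terms that contain derivatives of the fields cancel.  What is left is the
  difference of two sums over the derivatives of the structure constants, which are symmetric in the
  direction of differentiation and the first factor because the operators \<open>C a\<close> are closed.
\<close>
lemma potentiality:
  assumes X: "vholo_on X M" and Y: "vholo_on Y M" and Z: "vholo_on Z M" and x: "x \<in> M"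
  shows "vdir_deriv X (\<lambda>y. mul y (Y y) (Z y)) x - vdir_deriv Y (\<lambda>y. mul y (X y) (Z y)) x
    + mul x (X x) (vdir_deriv Y Z x) - mul x (Y x) (vdir_deriv X Z x) - mul x (lie_bracket X Y x) (Z x) = 0"
proof (rule vec_eq_iff[THEN iffD2], rule allI)
  fix l
  let ?m = "\<lambda>a b y. entry (C a y) l b"
  have leibniz: "dir_deriv X (\<lambda>y. mul y (Y y) (Z y) $ l) x = (\<Sum>a\<in>UNIV. \<Sum>b\<in>UNIV.
      dir_deriv X (\<lambda>y. Y y $ a) x * Z x $ b * ?m a b x + Y x $ a * dir_deriv X (\<lambda>y. Z y $ b) x * ?m a b x
      + Y x $ a * Z x $ b * dir_deriv X (?m a b) x)"
    if "vholo_on X M" "vholo_on Y M" for X Y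
  proof -
    have h: "holo_on (\<lambda>y. Y y $ a) M" "holo_on (\<lambda>y. Z y $ b) M" "holo_on (?m a b) M" for a b
      using that Z C_holo by (auto simp: vholo_on_def holo_op_def)
    show ?thesis
      unfolding mul_nth
      by (simp add: dir_deriv_sum[OF _ M x] holo_on_sum holo_on_mult h M x dir_deriv_mult[of _ M] distrib_right)
  qed
  have "(\<Sum>a\<in>UNIV. \<Sum>b\<in>UNIV. Y x $ a * Z x $ b * dir_deriv X (?m a b) x)
      = (\<Sum>a\<in>UNIV. \<Sum>b\<in>UNIV. X x $ a * Z x $ b * dir_deriv Y (?m a b) x)"
  proof -
    have closed: "pd i (?m a b) x = pd a (?m i b) x" for i a b
      using arg_cong[OF C_closed[OF x, of i a], of "\<lambda>W. entry W l b"] by (simp add: pdo_def)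
    have "(\<Sum>a\<in>UNIV. \<Sum>b\<in>UNIV. Y x $ a * Z x $ b * dir_deriv X (?m a b) x)
        = (\<Sum>b\<in>UNIV. \<Sum>a\<in>UNIV. \<Sum>i\<in>UNIV. Y x $ a * Z x $ b * X x $ i * pd i (?m a b) x)"
      by (subst sum.swap) (simp add: dir_deriv_def sum_distrib_left mult.assoc)
    also have "\<dots> = (\<Sum>b\<in>UNIV. \<Sum>i\<in>UNIV. \<Sum>a\<in>UNIV. Y x $ a * Z x $ b * X x $ i * pd i (?m a b) x)"
      by (intro sum.cong refl sum.swap)
    also have "\<dots> = (\<Sum>b\<in>UNIV. \<Sum>i\<in>UNIV. \<Sum>a\<in>UNIV. X x $ i * Z x $ b * Y x $ a * pd a (?m i b) x)"
      by (intro sum.cong refl) (simp add: closed)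
    also have "\<dots> = (\<Sum>a\<in>UNIV. \<Sum>b\<in>UNIV. X x $ a * Z x $ b * dir_deriv Y (?m a b) x)"
      by (subst sum.swap) (simp add: dir_deriv_def sum_distrib_left mult.assoc)
    finally show ?thesis .
  qed
  then show "(vdir_deriv X (\<lambda>y. mul y (Y y) (Z y)) x - vdir_deriv Y (\<lambda>y. mul y (X y) (Z y)) x
    + mul x (X x) (vdir_deriv Y Z x) - mul x (Y x) (vdir_deriv X Z x) - mul x (lie_bracket X Y x) (Z x)) $ l = 0 $ l"
    unfolding vector_minus_component vector_add_component vdir_deriv_nth leibniz[OF X Y] leibniz[OF Y X]
    by (simp add: vdir_deriv_nth mul_nth lie_bracket_def sum.distrib sum_subtractf algebra_simps)
qed

theorem flat_frobenius_manifold: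
  "frobenius_manifold M mul (\<lambda>_. axis iu 1) metric (\<lambda>_ _ _. 0)"
  unfolding frobenius_manifold_def
proof (intro conjI ballI allI impI)
  have nab: "nabla (\<lambda>_ _ _. 0) X Y = vdir_deriv X Y" for X Y :: "'n cvec \<Rightarrow> 'n cvec"
    by (simp add: nabla_def fun_eq_iff)
  have vconst: "vholo_on (\<lambda>_. v) M" for v :: "'n cvec" by (simp add: vholo_on_def holo_on_const)
  have lin: "bilinear_map (mul x)" for x
    by (simp add: bilinear_map_def clin_iff mul_def mulvec_linear app_simps)
  show "open M" by (rule M)
  show "holo_tensor12 M mul"
    unfolding holo_tensor12_def using lin mul_holo[OF vconst vconst] by blast
  show "mul x u v = mul x v u" if "x \<in> M" for x u v by (rule mul_commute[OF that])
  show "mul x (mul x u v) w = mul x u (mul x v w)" if "x \<in> M" for x u v w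
    unfolding mul_def[of x _ w] mul_def[of x u "app _ _"]
    by (simp add: mulvec_mul[OF that, symmetric] app_simps)
  show "vholo_on (\<lambda>_. axis iu 1) M" by (rule vconst)
  show "mul x (axis iu 1) v = v" if "x \<in> M" for x v
  proof -
    have "mulvec x (axis iu 1) = C iu x"
      by (rule op_eqI) (simp add: mulvec_def axis_def delta_mult cong: if_cong)
    then show ?thesis by (simp add: mul_def C_one that app_simps)
  qed
  have bil: "bilinear_form (metric x)" for x
    by (auto simp: bilinear_form_def functional_iff metric_def algebra_simps sum.distrib sum_distrib_left)
  show "holo_tensor02 M metric"
    unfolding holo_tensor02_def using bil by (simp add: metric_def holo_on_const)
  show "metric x u v = metric x v u" for x u v by (rule metric_sym)
  show "nondegenerate (metric x)" for x
    unfolding nondegenerate_def using metric_axis by (metis vec_eq_iff zero_index)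
  show "levi_civita M metric (\<lambda>_ _ _. 0)"
    unfolding levi_civita_def nab
  proof (intro conjI ballI allI impI)
    show "holo_tensor12 M (\<lambda>_ _ _. 0)"
      by (simp add: holo_tensor12_def bilinear_map_def clin_iff vconst)
    show "vdir_deriv X Y x - vdir_deriv Y X x = lie_bracket X Y x" for X Y :: "'n cvec \<Rightarrow> 'n cvec" and x
      by (simp add: lie_bracket_def)
    fix X Y Z :: "'n cvec \<Rightarrow> 'n cvec" and x
    assume "vholo_on X M \<and> vholo_on Y M \<and> vholo_on Z M" and x: "x \<in> M"
    then have h: "holo_on (\<lambda>y. Y y $ a) M" "holo_on (\<lambda>y. Z y $ a) M" for a by (auto simp: vholo_on_def)
    show "dir_deriv X (\<lambda>y. metric y (Y y) (Z y)) x = metric x (vdir_deriv X Y x) (Z x) + metric x (Y x) (vdir_deriv X Z x)"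
      unfolding metric_def
      by (simp add: dir_deriv_sum[OF _ M x] holo_on_mult h M x dir_deriv_mult[of _ M] vdir_deriv_nth sum.distrib)
  qed
  show "nabla (\<lambda>_ _ _. 0) X (nabla (\<lambda>_ _ _. 0) Y Z) x - nabla (\<lambda>_ _ _. 0) Y (nabla (\<lambda>_ _ _. 0) X Z) x
      - nabla (\<lambda>_ _ _. 0) (lie_bracket X Y) Z x = 0"
    if "vholo_on X M \<and> vholo_on Y M \<and> vholo_on Z M" "x \<in> M" for X Y Z x
    unfolding nab vec_eq_iff
    using that dir_deriv_bracket[of X M Y "\<lambda>y. Z y $ l" x for l] M
    by (auto simp: vdir_deriv_nth vholo_on_def)
  show "nabla (\<lambda>_ _ _. 0) X (\<lambda>_. axis iu 1) x = 0" for X x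
    unfolding nab by (simp add: vec_eq_iff vdir_deriv_nth dir_deriv_def pd_const)
  show "metric x (mul x u v) w = metric x v (mul x u w)" if "x \<in> M" for x u v w
    unfolding mul_def by (rule metric_app) (rule mulvec_sym[OF that])
  show "nabla (\<lambda>_ _ _. 0) X (\<lambda>y. mul y (Y y) (Z y)) x - nabla (\<lambda>_ _ _. 0) Y (\<lambda>y. mul y (X y) (Z y)) x
      + mul x (X x) (nabla (\<lambda>_ _ _. 0) Y Z x) - mul x (Y x) (nabla (\<lambda>_ _ _. 0) X Z x)
      - mul x (lie_bracket X Y x) (Z x) = 0"
    if "vholo_on X M \<and> vholo_on Y M \<and> vholo_on Z M" "x \<in> M" for X Y Z x
    unfolding nab using that by (intro potentiality) auto
qed

end

section \<open>Algebras generated by commuting operators\<close>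

lemma clinD: assumes "clin f" shows "f (x + y) = f x + f y" "f (c *s x) = c *s f x" "f 0 = 0"
proof -
  show "f (x + y) = f x + f y" "f (c *s x) = c *s f x" using assms by (auto simp: clin_iff)
  have "f (0 *s x) = 0 *s f x" for x using assms unfolding clin_iff by blast
  then show "f 0 = 0" by simp
qed

lemma clin_sum: "clin f \<Longrightarrow> f (\<Sum>i\<in>S. g i) = (\<Sum>i\<in>S. f (g i))"
  by (induction S rule: infinite_finite_induct) (simp_all add: clinD)

locale commuting_action =
  fixes A :: "'n::finite cvec set" and act :: "'n cvec \<Rightarrow> 'n cvec \<Rightarrow> 'n cvec"
  assumes act_clin: "w \<in> A \<Longrightarrow> clin (act w)"
    and act_commute: "w \<in> A \<Longrightarrow> w' \<in> A \<Longrightarrow> act w (act w' v) = act w' (act w v)"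
begin

lemma word_clin: "set ws \<subseteq> A \<Longrightarrow> clin (foldr act ws)"
proof (induction ws)
  case (Cons w ws)
  then have "clin (act w)" "clin (foldr act ws)" using act_clin by auto
  then show ?case by (simp add: clin_iff)
qed (simp add: clin_iff)

lemma words_act_Cons: "words_act act ((c, ws) # P) v = c *s foldr act ws v + words_act act P v"
  by (simp add: words_act_def)

lemma words_act_Nil: "words_act act [] v = 0" by (simp add: words_act_def)

lemma words_act_append: "words_act act (P @ R) v = words_act act P v + words_act act R v"
  by (simp add: words_act_def)

lemma words_over_simps: "words_over A []" "words_over A ((c, ws) # P) \<longleftrightarrow> set ws \<subseteq> A \<and> words_over A P"
  "words_over A (P @ R) \<longleftrightarrow> words_over A P \<and> words_over A R"
  by (auto simp: words_over_def)

lemma words_clin: "words_over A P \<Longrightarrow> clin (words_act act P)"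
proof (induction P)
  case (Cons a P)
  obtain c ws where a: "a = (c, ws)" by (cases a)
  then show ?case
    using Cons word_clin[of ws] by (simp add: words_over_simps words_act_Cons clin_iff algebra_simps vec.scale_right_distrib)
qed (simp add: clin_iff words_act_Nil)

lemma word_intertwine:
  assumes "clin X" "\<And>w v. w \<in> A \<Longrightarrow> X (act w v) = act w (X v)" "set ws \<subseteq> A"
  shows "X (foldr act ws v) = foldr act ws (X v)"
  using assms(3) by (induction ws) (simp_all add: assms(2))

lemma words_intertwine:
  assumes "clin X" "\<And>w v. w \<in> A \<Longrightarrow> X (act w v) = act w (X v)" "words_over A P"
  shows "X (words_act act P v) = words_act act P (X v)"
  using assms(3)
proof (induction P)
  case (Cons a P)
  obtain c ws where a: "a = (c, ws)" by (cases a)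
  then show ?case
    using Cons word_intertwine[OF assms(1,2), of ws] clinD[OF assms(1)]
    by (simp add: words_over_simps words_act_Cons)
qed (simp add: words_act_Nil clinD[OF assms(1)])

lemma words_act_commute_letter: "words_over A P \<Longrightarrow> w \<in> A \<Longrightarrow> words_act act P (act w v) = act w (words_act act P v)"
  using words_intertwine[of "act w" P v] act_clin act_commute by metis

lemma words_act_commute:
  "words_over A P \<Longrightarrow> words_over A R \<Longrightarrow> words_act act P (words_act act R v) = words_act act R (words_act act P v)"
  by (rule words_intertwine) (auto intro: words_clin words_act_commute_letter)

lemma words_mult_Cons: "words_mult ((c, us) # P) R = map (\<lambda>(d, ws). (c * d, us @ ws)) R @ words_mult P R"
  by (simp add: words_mult_def)

lemma words_act_mult: "words_over A P \<Longrightarrow> words_over A R \<Longrightarrow>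
    words_act act (words_mult P R) v = words_act act P (words_act act R v)"
proof (induction P)
  case (Cons a P)
  obtain c us where a: "a = (c, us)" by (cases a)
  then have us: "set us \<subseteq> A" using Cons by (simp add: words_over_simps)
  have "words_act act (map (\<lambda>(d, ws). (c * d, us @ ws)) R) v = c *s foldr act us (words_act act R v)"
    using Cons.prems(2)
  proof (induction R)
    case (Cons b R)
    obtain d ws where "b = (d, ws)" by (cases b)
    then show ?case using Cons
      by (simp add: words_act_Cons words_over_simps clinD[OF word_clin[OF us]] vec.scale_right_distrib)
  qed (simp add: words_act_Nil clinD[OF word_clin[OF us]])
  then show ?case using Cons a by (simp add: words_mult_Cons words_act_append words_act_Cons words_over_simps)
qed (simp add: words_mult_def words_act_Nil)

text \<open>
  If \<open>P e = u\<close> and \<open>R e = v\<close>, then \<open>P R e = R P e = R X e = X R e = X v\<close>.  Thus the product does not depend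
  on the representing words, and any operator that commutes with the action can be used to compute it.
\<close>
lemma generated_mult_eq:
  assumes gen: "generated_by A act e"
    and X: "clin X" "\<And>w v. w \<in> A \<Longrightarrow> X (act w v) = act w (X v)" and u: "X e = u"
  shows "generated_mult A act e u v = X v"
  unfolding generated_mult_def
proof (rule the_equality)
  have val: "words_act act (words_mult P R) e = X v"
    if "words_over A P" "words_over A R" "words_act act P e = u" "words_act act R e = v" for P R
  proof -
    have "words_act act (words_mult P R) e = words_act act P (words_act act R e)"
      by (rule words_act_mult[OF that(1,2)])
    also have "\<dots> = words_act act R (words_act act P e)" by (rule words_act_commute[OF that(1,2)])
    also have "\<dots> = words_act act R (X e)" by (simp add: that u)
    also have "\<dots> = X (words_act act R e)" by (rule words_intertwine[OF X that(2), symmetric])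
    finally show ?thesis by (simp add: that)
  qed
  obtain P R where "words_over A P" "words_act act P e = u" "words_over A R" "words_act act R e = v"
    using gen by (metis generated_by_def)
  then show "\<exists>P R. words_over A P \<and> words_over A R \<and> words_act act P e = u \<and> words_act act R e = v \<and>
      X v = words_act act (words_mult P R) e"
    using val by metis
  show "x = X v" if "\<exists>P R. words_over A P \<and> words_over A R \<and> words_act act P e = u \<and> words_act act R e = v \<and>
      x = words_act act (words_mult P R) e" for x
    using that val by metis
qed

lemma generated_mult_words:
  assumes "generated_by A act e" "words_over A P"
  shows "generated_mult A act e (words_act act P e) v = words_act act P v"
  by (rule generated_mult_eq) (auto intro: assms words_clin words_act_commute_letter)

lemma generated_byI:
  assumes span: "\<And>S. \<lbrakk>\<And>x y. x \<in> S \<Longrightarrow> y \<in> S \<Longrightarrow> x + y \<in> S; \<And>c x. x \<in> S \<Longrightarrow> c *s x \<in> S; e \<in> S;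
      \<And>w x. w \<in> A \<Longrightarrow> x \<in> S \<Longrightarrow> act w x \<in> S; 0 \<in> S\<rbrakk> \<Longrightarrow> S = UNIV"
  shows "generated_by A act e"
proof -
  let ?S = "{words_act act P e | P. words_over A P}"
  have S: "?S = UNIV"
  proof (rule span)
    fix x y assume "x \<in> ?S" "y \<in> ?S"
    then obtain P R where "words_over A P" "words_over A R" "x = words_act act P e" "y = words_act act R e" by auto
    then have "words_over A (P @ R)" "x + y = words_act act (P @ R) e"
      by (simp_all add: words_over_simps words_act_append)
    then show "x + y \<in> ?S" by blast
  next
    fix c x assume "x \<in> ?S"
    then obtain P where P: "words_over A P" "x = words_act act P e" by auto
    have "words_over A (map (\<lambda>(d, ws). (c * d, ws)) P) \<and> words_act act (map (\<lambda>(d, ws). (c * d, ws)) P) e = c *s words_act act P e"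
      using P(1)
      by (induction P) (auto simp: words_over_simps words_act_Nil words_act_Cons vec.scale_right_distrib)
    then show "c *s x \<in> ?S" unfolding P(2) by (metis (mono_tags, lifting) mem_Collect_eq)
  next
    have "words_over A [(1, [])] \<and> words_act act [(1, [])] e = e"
      by (simp add: words_over_simps words_act_Cons words_act_Nil)
    then show "e \<in> ?S" by (metis (mono_tags, lifting) mem_Collect_eq)
  next
    fix w x assume w: "w \<in> A" and "x \<in> ?S"
    then obtain P where P: "words_over A P" "x = words_act act P e" by auto
    have "words_over A (map (\<lambda>(d, ws). (d, w # ws)) P) \<and> words_act act (map (\<lambda>(d, ws). (d, w # ws)) P) e = act w (words_act act P e)"
      using P(1) w
      by (induction P) (auto simp: words_over_simps words_act_Nil words_act_Cons clinD[OF act_clin])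
    then show "act w x \<in> ?S" unfolding P(2) by (metis (mono_tags, lifting) mem_Collect_eq)
  next
    have "words_over A [] \<and> words_act act [] e = 0" by (simp add: words_over_simps words_act_Nil)
    then show "0 \<in> ?S" by (metis (mono_tags, lifting) mem_Collect_eq)
  qed
  show ?thesis
    unfolding generated_by_def
  proof
    fix v
    have "v \<in> ?S" unfolding S by (rule UNIV_I)
    then show "\<exists>P. words_over A P \<and> words_act act P e = v" by fastforce
  qed
qed

end

section \<open>Generated algebras of Frobenius modules\<close>

lemma graded_space_zero:
  assumes gs: "graded_space k V" and f: "\<And>d. f d \<in> V d" and s: "(\<Sum>p\<le>k. f (2 * p)) = 0" and "p \<le> k"
  shows "f (2 * p) = 0"
proof -
  have "is_decomp k V 0 f" using f s by (simp add: is_decomp_def)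
  moreover have "is_decomp k V 0 (\<lambda>_. 0)"
    using gs by (simp add: is_decomp_def graded_space_def vec.subspace_0)
  moreover have "\<exists>!f. is_decomp k V 0 f" using gs by (simp add: graded_space_def)
  ultimately have "f = (\<lambda>_. 0)" by blast
  then show ?thesis by simp
qed

lemma graded_space_part:
  assumes gs: "graded_space k V" and f: "\<And>d. f d \<in> V d" and v: "v = (\<Sum>p\<le>k. f (2 * p))" "v \<in> V (2 * l)"
  shows "f (2 * l) = v"
proof (cases "l \<le> k")
  case True
  have sub: "vec.subspace (V d)" for d using gs by (simp add: graded_space_def)
  define g where "g d = (if d = 2 * l then f d - v else f d)" for d
  have "g (2 * l) = 0"
  proof (rule graded_space_zero[OF gs _ _ True])
    show "g d \<in> V d" for d
      using f v(2) sub by (auto simp: g_def intro: vec.subspace_diff)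
    have "(\<Sum>p\<le>k. g (2 * p)) = (\<Sum>p\<le>k. f (2 * p) - (if p = l then v else 0))"
      by (intro sum.cong refl) (simp add: g_def)
    also have "\<dots> = 0" using True v(1) by (simp add: sum_subtractf)
    finally show "(\<Sum>p\<le>k. g (2 * p)) = 0" .
  qed
  then show ?thesis by (simp add: g_def)
next
  case False
  then have "V (2 * l) = {0}" using gs by (simp add: graded_space_def)
  then show ?thesis using f[of "2 * l"] v(2) by simp
qed

lemma frobenius_module_action: "frobenius_module k V B e act \<Longrightarrow> commuting_action (V 2) act"
  by (rule commuting_action.intro) (auto simp: frobenius_module_def sym_module_def)

context
  fixes k V B e act
  assumes fm: "frobenius_module k V B e act"
begin

interpretation commuting_action "V 2" act by (rule frobenius_module_action[OF fm])

lemma fm_graded: "graded_space k V" using fm by (simp add: frobenius_module_def)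

lemma fm_subspace: "vec.subspace (V d)" using fm_graded by (simp add: graded_space_def)

lemma word_degree: "set ws \<subseteq> V 2 \<Longrightarrow> v \<in> V d \<Longrightarrow> foldr act ws v \<in> V (d + 2 * length ws)"
proof (induction ws)
  case (Cons w ws)
  then have "act w (foldr act ws v) \<in> V ((d + 2 * length ws) + 2)"
    using fm by (simp add: frobenius_module_def sym_module_def)
  then show ?case by (simp add: algebra_simps)
qed simp

lemma words_degree:
  assumes "words_over (V 2) P" "\<And>c ws. (c, ws) \<in> set P \<Longrightarrow> length ws = l" "v \<in> V d"
  shows "words_act act P v \<in> V (d + 2 * l)"
  using assms(1,2)
proof (induction P)
  case Nil
  then show ?case by (simp add: words_act_Nil vec.subspace_0 fm_subspace)
next
  case (Cons a P)
  obtain c ws where a: "a = (c, ws)" by (cases a)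
  then have "foldr act ws v \<in> V (d + 2 * l)"
    using Cons.prems word_degree[OF _ assms(3), of ws] by (auto simp: words_over_simps)
  moreover have "words_act act P v \<in> V (d + 2 * l)" using Cons a by (auto simp: words_over_simps)
  ultimately show ?case
    by (simp add: a words_act_Cons vec.subspace_add vec.subspace_scale fm_subspace)
qed

text \<open>
  The words of a given length map \<open>e\<close> into a single degree, so the other lengths contribute to other
  homogeneous components, which are zero here.
\<close>
lemma words_homogeneous_part:
  assumes P: "words_over (V 2) P" and u: "words_act act P e \<in> V (2 * l)"
  shows "words_act act (filter (\<lambda>(c, ws). length ws = l) P) e = words_act act P e"
proof -
  define H where "H m = filter (\<lambda>(c, ws). length ws = m) P" for m
  have "V 0 = vec.span {e}" using fm unfolding frobenius_module_def by blast
  then have e: "e \<in> V 0" using vec.span_base[of e "{e}"] by simp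
  have deg: "words_act act (H m) e \<in> V (2 * m)" for m
  proof -
    have "words_over (V 2) (H m)" using P by (auto simp: H_def words_over_def)
    then have "words_act act (H m) e \<in> V (0 + 2 * m)"
      by (rule words_degree) (auto simp: H_def e)
    then show ?thesis by simp
  qed
  define f where "f d = (if even d then words_act act (H (d div 2)) e else 0)" for d
  have fV: "f d \<in> V d" for d
    using deg[of "d div 2"] by (auto simp: f_def vec.subspace_0 fm_subspace)
  have split: "words_act act P v = (\<Sum>m\<le>N. words_act act (filter (\<lambda>(c, ws). length ws = m) P) v)"
    if "\<forall>(c, ws)\<in>set P. length ws \<le> N" for N v and P :: "'a cvec words"
    using that
  proof (induction P)
    case (Cons a P)
    obtain c ws where a: "a = (c, ws)" by (cases a)
    have "(\<Sum>m\<le>N. words_act act (filter (\<lambda>(c, ws). length ws = m) (a # P)) v) =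
       (\<Sum>m\<le>N. (if m = length ws then c *s foldr act ws v else 0) + words_act act (filter (\<lambda>(c, ws). length ws = m) P) v)"
      by (intro sum.cong refl) (simp add: a words_act_Cons)
    then show ?case using Cons a by (simp add: sum.distrib words_act_Cons)
  qed (simp add: words_act_Nil)
  define N where "N = max k (Max (insert 0 ((\<lambda>(c, ws). length ws) ` set P)))"
  have "\<forall>(c, ws)\<in>set P. length ws \<le> N"
  proof safe
    fix c ws assume "(c, ws) \<in> set P"
    then have "length ws \<in> insert 0 ((\<lambda>(c, ws). length ws) ` set P)" by force
    then have "length ws \<le> Max (insert 0 ((\<lambda>(c, ws). length ws) ` set P))" by (intro Max_ge) auto
    then show "length ws \<le> N" by (simp add: N_def)
  qed
  then have "words_act act P e = (\<Sum>m\<le>N. words_act act (H m) e)" unfolding H_def by (rule split)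
  also have "\<dots> = (\<Sum>m\<le>k. words_act act (H m) e)"
  proof (rule sum.mono_neutral_right)
    show "\<forall>m\<in>{..N} - {..k}. words_act act (H m) e = 0"
    proof
      fix m assume "m \<in> {..N} - {..k}"
      then have "V (2 * m) = {0}" using fm_graded by (simp add: graded_space_def)
      then show "words_act act (H m) e = 0" using deg[of m] by simp
    qed
  qed (auto simp: N_def)
  finally have "words_act act P e = (\<Sum>p\<le>k. f (2 * p))" by (simp add: f_def)
  from graded_space_part[OF fm_graded fV this u]
  show ?thesis by (simp add: f_def H_def)
qed

lemma word_adjoint: "set ws \<subseteq> V 2 \<Longrightarrow> B (foldr act ws u) v = B u (foldr act ws v)"
proof (induction ws arbitrary: u v)
  case (Cons w ws)
  have "w \<in> V 2" using Cons.prems by simp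
  then have "B (act w (foldr act ws u)) v = B (foldr act ws u) (act w v)"
    using fm unfolding frobenius_module_def by blast
  also have "\<dots> = B u (foldr act ws (act w v))" using Cons by simp
  also have "foldr act ws (act w v) = act w (foldr act ws v)"
    using Cons.prems word_intertwine[of "act w" ws v] act_clin act_commute by (metis list.set_intros(1) set_subset_Cons subset_iff)
  finally show ?case by simp
qed simp

lemma words_adjoint:
  assumes "words_over (V 2) P" shows "B (words_act act P u) v = B u (words_act act P v)"
proof -
  have "bilinear_form B" using fm unfolding frobenius_module_def by blast
  then have lin: "B (x + y) v = B x v + B y v" "B (c *s x) v = c * B x v" "B u (x + y) = B u x + B u y"
      "B u (c *s x) = c * B u x" for x y u v c
    by (simp_all add: bilinear_form_def functional_iff)
  show ?thesis
    using assms
proof (induction P)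
  case Nil
  have "B (0 *s u) v = 0 * B u v" "B u (0 *s v) = 0 * B u v" by (rule lin)+
  then show ?case by (simp add: words_act_Nil)
next
  case (Cons a P)
  obtain c ws where a: "a = (c, ws)" by (cases a)
  show ?case
    using Cons word_adjoint[of ws] by (simp add: a words_act_Cons words_over_simps lin)
qed
qed

theorem generated_frobenius_algebra:
  assumes gen: "generated_by (V 2) act e"
  shows "graded_frobenius_algebra k V B e (generated_mult (V 2) act e)"
proof -
  let ?m = "generated_mult (V 2) act e"
  have ex: "\<exists>P. words_over (V 2) P \<and> words_act act P e = u \<and> (\<forall>v. ?m u v = words_act act P v)" for u
    using gen generated_mult_words[OF gen] unfolding generated_by_def by metis
  have comm: "?m u v = ?m v u" for u v
  proof -
    obtain P R where "words_over (V 2) P" "words_act act P e = u" "\<And>v. ?m u v = words_act act P v"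
      and "words_over (V 2) R" "words_act act R e = v" "\<And>u. ?m v u = words_act act R u"
      using ex[of u] ex[of v] by blast
    then show ?thesis using words_act_commute[of P R e] by simp
  qed
  have lin: "clin (?m u)" for u
  proof -
    obtain P where P: "words_over (V 2) P" "\<And>v. ?m u v = words_act act P v" using ex[of u] by blast
    then have "?m u = words_act act P" by auto
    then show ?thesis using words_clin[OF P(1)] by simp
  qed
  have assoc: "?m (?m u v) w = ?m u (?m v w)" for u v w
  proof -
    obtain P R where P: "words_over (V 2) P" "words_act act P e = u" "\<And>v. ?m u v = words_act act P v"
      and R: "words_over (V 2) R" "words_act act R e = v" "\<And>u. ?m v u = words_act act R u"
      using ex[of u] ex[of v] by blast
    have "?m (words_act act P (words_act act R e)) w = words_act act P (words_act act R w)"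
    proof (rule generated_mult_eq[OF gen, of "\<lambda>v. words_act act P (words_act act R v)"])
      show "clin (\<lambda>v. words_act act P (words_act act R v))"
        using words_clin[OF P(1)] words_clin[OF R(1)] by (simp add: clin_iff)
    qed (simp_all add: words_act_commute_letter P(1) R(1))
    then show ?thesis using P R by simp
  qed
  have graded: "?m u v \<in> V (a + b)" if "u \<in> V a" "v \<in> V b" for a b u v
  proof (cases "even a")
    case True
    then obtain l where a: "a = 2 * l" by blast
    obtain P where P: "words_over (V 2) P" "words_act act P e = u" using ex[of u] by blast
    let ?P = "filter (\<lambda>(c, ws). length ws = l) P"
    have over: "words_over (V 2) ?P" using P(1) by (auto simp: words_over_def)
    have "words_act act ?P e = u" using words_homogeneous_part[OF P(1), of l] P(2) that(1) a by simp
    then have "?m u v = words_act act ?P v" using generated_mult_words[OF gen over, of v] by simp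
    also have "\<dots> \<in> V (b + 2 * l)" by (rule words_degree[OF over _ that(2)]) auto
    finally show ?thesis by (simp add: a add.commute)
  next
    case False
    then have "u = 0" using that(1) fm_graded by (auto simp: graded_space_def)
    then have "?m u v = 0" using clinD(3)[OF lin, of v] comm[of u v] by simp
    then show ?thesis by (simp add: vec.subspace_0 fm_subspace)
  qed
  have "?m e v = v" for v using generated_mult_words[OF gen, of "[(1, [])]" v]
    by (simp add: words_over_simps words_act_Cons words_act_Nil)
  moreover have "B (?m u v) w = B v (?m u w)" for u v w
    using ex[of u] words_adjoint by metis
  moreover have "bilinear_map ?m"
  proof -
    have "(\<lambda>u. ?m u v) = ?m v" for v using comm by blast
    then show ?thesis by (simp add: bilinear_map_def lin)
  qed
  ultimately show ?thesis
    unfolding graded_frobenius_algebra_def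
    using fm comm assoc graded by (simp add: frobenius_module_def)
qed

end

section \<open>Functions of q that vanish at the origin\<close>

text \<open>
  The part of the \<open>z\<close>-space that lies over a polydisc of the \<open>q\<close>-space.
\<close>
definition zdom :: "('n::finite \<Rightarrow> nat) \<Rightarrow> real \<Rightarrow> 'n cvec set" where
  "zdom td \<rho> = {z. qexp td z \<in> polydisc td \<rho>}"

lemma zdom_iff: "z \<in> zdom td \<rho> \<longleftrightarrow> (\<forall>j. td j = 2 \<longrightarrow> cmod (exp (2 * of_real pi * \<i> * z $ j)) < \<rho>)"
  by (auto simp: zdom_def polydisc_def qspace_def qexp_def)

lemma open_zdom: "open (zdom td \<rho>)"
proof -
  have "zdom td \<rho> = (\<Inter>j\<in>{j. td j = 2}. {z. cmod (exp (2 * of_real pi * \<i> * z $ j)) < \<rho>})"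
    by (auto simp: zdom_iff)
  also have "open \<dots>"
    by (intro open_INT ballI open_Collect_less continuous_intros) auto
  finally show ?thesis .
qed

lemma zdom_mono: "\<rho> \<le> \<rho>' \<Longrightarrow> zdom td \<rho> \<subseteq> zdom td \<rho>'"
  by (force simp: zdom_iff)

text \<open>
  Functions of \<open>q\<close>, pulled back to the \<open>z\<close>-space, which tend to 0 with \<open>q\<close>.  In contrast to a
  description by power series, these conditions are inherited by partial derivatives without any computation.
\<close>
definition qfun :: "('n::finite \<Rightarrow> nat) \<Rightarrow> real \<Rightarrow> ('n cvec \<Rightarrow> complex) \<Rightarrow> bool" where
  "qfun td \<rho> f \<longleftrightarrow> holo_on f (zdom td \<rho>) \<and>
     (\<forall>z\<in>zdom td \<rho>. \<forall>z'\<in>zdom td \<rho>. qexp td z = qexp td z' \<longrightarrow> f z = f z') \<and>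
     (\<forall>\<epsilon>>0. \<exists>\<eta>>0. \<eta> \<le> \<rho> \<and> (\<forall>z\<in>zdom td \<eta>. norm (f z) \<le> \<epsilon>))"

lemma qexp_shift:
  "qexp td (z + t *s axis j 1) = (\<chi> a. if a = j then exp (2 * of_real pi * \<i> * t) * qexp td z $ a else qexp td z $ a)"
  by (simp add: vec_eq_iff qexp_def axis_def exp_add algebra_simps)

lemma qfun_pd_zero:
  assumes "qfun td \<rho> f" "td j \<noteq> 2" "z \<in> zdom td \<rho>" shows "pd j f z = 0"
proof -
  have q: "qexp td (z + t *s axis j 1) = qexp td z" for t
    using assms(2) by (simp add: vec_eq_iff qexp_def axis_def)
  then have "z + t *s axis j 1 \<in> zdom td \<rho>" for t using assms(3) by (simp add: zdom_def)
  then have "f (z + t *s axis j 1) = f z" for t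
    using assms(1,3) q unfolding qfun_def by blast
  then show ?thesis by (simp add: pd_def)
qed

lemma qfun_zero: "0 < \<rho> \<Longrightarrow> qfun td \<rho> (\<lambda>_. 0)"
  by (auto simp: qfun_def holo_on_const)

lemma qfun_add:
  assumes f: "qfun td \<rho> f" and g: "qfun td \<rho> g" shows "qfun td \<rho> (\<lambda>z. f z + g z)"
  unfolding qfun_def
proof (intro conjI ballI allI impI)
  show "holo_on (\<lambda>z. f z + g z) (zdom td \<rho>)"
    using f g by (intro holo_on_add open_zdom) (auto simp: qfun_def)
  show "f z + g z = f z' + g z'" if "z \<in> zdom td \<rho>" "z' \<in> zdom td \<rho>" "qexp td z = qexp td z'" for z z'
    using f g that unfolding qfun_def by metis
  fix \<epsilon> :: real assume e: "0 < \<epsilon>"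
  then have "0 < \<epsilon> / 2" by simp
  obtain \<eta>1 where 1: "\<eta>1 > 0" "\<eta>1 \<le> \<rho>" "\<forall>z\<in>zdom td \<eta>1. norm (f z) \<le> \<epsilon> / 2" using f \<open>0 < \<epsilon> / 2\<close> unfolding qfun_def by blast
  obtain \<eta>2 where 2: "\<eta>2 > 0" "\<eta>2 \<le> \<rho>" "\<forall>z\<in>zdom td \<eta>2. norm (g z) \<le> \<epsilon> / 2" using g \<open>0 < \<epsilon> / 2\<close> unfolding qfun_def by blast
  have "norm (f z + g z) \<le> \<epsilon>" if "z \<in> zdom td (min \<eta>1 \<eta>2)" for z
  proof -
    have "z \<in> zdom td \<eta>1" "z \<in> zdom td \<eta>2" using that zdom_mono[of "min \<eta>1 \<eta>2" \<eta>1 td] zdom_mono[of "min \<eta>1 \<eta>2" \<eta>2 td] by auto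
    then have "norm (f z) \<le> \<epsilon> / 2" "norm (g z) \<le> \<epsilon> / 2" using 1 2 by auto
    then show ?thesis using norm_triangle_ineq[of "f z" "g z"] by linarith
  qed
  then show "\<exists>\<eta>>0. \<eta> \<le> \<rho> \<and> (\<forall>z\<in>zdom td \<eta>. norm (f z + g z) \<le> \<epsilon>)"
    using 1 2 by (intro exI[of _ "min \<eta>1 \<eta>2"]) auto
qed

text \<open>
  Moving one coordinate of \<open>z\<close> by at most 1 multiplies the corresponding coordinate of \<open>q\<close> by at most
  \<open>exp (2 * pi)\<close> in absolute value.  So Cauchy's estimate on the unit disc bounds the derivative over a smaller
  polydisc by the function over the given one.
\<close>
lemma qfun_pd:
  assumes f: "qfun td \<rho> f" shows "qfun td \<rho> (pd j f)"
  unfolding qfun_def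
proof (intro conjI ballI allI impI)
  have holo: "holo_on f (zdom td \<rho>)" using f by (simp add: qfun_def)
  show "holo_on (pd j f) (zdom td \<rho>)" by (rule holo_on_partial[OF holo open_zdom])
  show "pd j f z = pd j f z'" if z: "z \<in> zdom td \<rho>" "z' \<in> zdom td \<rho>" "qexp td z = qexp td z'" for z z'
    unfolding pd_def
  proof (rule deriv_cong_ev[OF _ refl])
    have "\<forall>\<^sub>F t in nhds 0. z + t *s axis j 1 \<in> zdom td \<rho>"
      by (rule eventually_coordinate_line[OF open_zdom]) (simp add: z)
    then show "\<forall>\<^sub>F t in nhds 0. f (z + t *s axis j 1) = f (z' + t *s axis j 1)"
    proof eventually_elim
      case (elim t)
      have q: "qexp td (z + t *s axis j 1) = qexp td (z' + t *s axis j 1)" by (simp only: qexp_shift z(3))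
      then have "z' + t *s axis j 1 \<in> zdom td \<rho>" using elim by (simp add: zdom_def)
      then show ?case using f elim q unfolding qfun_def by blast
    qed
  qed
  fix \<epsilon> :: real assume "0 < \<epsilon>"
  then obtain \<eta> where \<eta>: "\<eta> > 0" "\<eta> \<le> \<rho>" "\<forall>z\<in>zdom td \<eta>. norm (f z) \<le> \<epsilon>" using f unfolding qfun_def by blast
  have shift: "z + t *s axis j 1 \<in> zdom td \<eta>" if z: "z \<in> zdom td (\<eta> * exp (- (2 * pi)))" and t: "norm t \<le> 1" for z t
    unfolding zdom_iff
  proof (intro allI impI)
    fix a assume a: "td a = 2"
    have za: "cmod (exp (2 * of_real pi * \<i> * z $ a)) < \<eta> * exp (- (2 * pi))" using z a by (simp add: zdom_iff)
    have le: "\<eta> * exp (- (2 * pi)) \<le> \<eta>" using \<eta>(1) by (simp add: mult_le_cancel_left1)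
    show "cmod (exp (2 * of_real pi * \<i> * (z + t *s axis j 1) $ a)) < \<eta>"
    proof (cases "a = j")
      case True
      have "cmod (exp (2 * of_real pi * \<i> * t)) \<le> exp (2 * pi)"
      proof -
        have "- Im t \<le> 1" using t abs_Im_le_cmod[of t] by linarith
        then show ?thesis by (simp add: norm_exp_eq_Re) (use mult_left_mono[of "- Im t" 1 "2 * pi"] in simp)
      qed
      then have "cmod (exp (2 * of_real pi * \<i> * z $ a)) * cmod (exp (2 * of_real pi * \<i> * t)) < (\<eta> * exp (- (2 * pi))) * exp (2 * pi)"
        using za by (intro mult_less_le_imp_less) auto
      then show ?thesis
        using True by (simp add: axis_def distrib_left exp_add norm_mult mult.assoc flip: exp_add[of _ "_::real"])
    next
      case False
      then show ?thesis using za le by (simp add: axis_def)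
    qed
  qed
  have "norm (pd j f z) \<le> \<epsilon>" if z: "z \<in> zdom td (\<eta> * exp (- (2 * pi)))" for z
  proof -
    have "norm (pd j f z) \<le> \<epsilon> / 1"
      by (rule pd_norm_le[OF holo open_zdom]) (use shift[OF z] \<eta> zdom_mono[OF \<eta>(2)] in auto)
    then show ?thesis by simp
  qed
  moreover have "\<eta> * exp (- (2 * pi)) \<le> \<eta>" using \<eta>(1) by (simp add: mult_le_cancel_left1)
  moreover have "\<eta> * exp (- (2 * pi)) \<le> \<rho>" using calculation(2) \<eta>(2) by linarith
  ultimately show "\<exists>\<eta>>0. \<eta> \<le> \<rho> \<and> (\<forall>z\<in>zdom td \<eta>. norm (pd j f z) \<le> \<epsilon>)"
    using \<eta> by (intro exI[of _ "\<eta> * exp (- (2 * pi))"]) auto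
qed

lemma holo_on_power: "holo_on f Z \<Longrightarrow> open Z \<Longrightarrow> holo_on (\<lambda>x. f x ^ n) Z"
  by (induction n) (auto intro: holo_on_const holo_on_mult)

lemma holo_on_exp_coordinate: "holo_on (\<lambda>z::complex^'n. exp (c * z $ j)) Z"
proof (rule holo_onI)
  fix x :: "complex^'n"
  have "((\<lambda>z::complex^'n. c * z $ j) has_derivative (\<lambda>v. c * v $ j)) (at x)"
    by (intro bounded_linear_imp_has_derivative bounded_linear_const_mult bounded_linear_vec_nth)
  then have "((\<lambda>z. exp (c * z $ j)) has_derivative (\<lambda>v. exp (c * x $ j) * (c * v $ j))) (at x)"
    by (rule has_derivative_compose[OF _ DERIV_exp[unfolded has_field_derivative_def]])
  moreover have "(\<lambda>v. exp (c * x $ j) * (c * v $ j)) = (\<lambda>v. \<Sum>i\<in>UNIV. v $ i * (if i = j then c * exp (c * x $ j) else 0))"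
    by (simp add: fun_eq_iff if_distrib[of "(*) _"] cong: if_cong)
  ultimately show "((\<lambda>z. exp (c * z $ j)) has_derivative (\<lambda>v. \<Sum>i\<in>UNIV. v $ i * (if i = j then c * exp (c * x $ j) else 0))) (at x)"
    by simp
qed

text \<open>
  The series is dominated by its absolutely convergent value at the point all of whose coordinates are
  \<open>\<rho>\<close>, so it converges uniformly.  When the coordinates of \<open>q\<close> are bounded by \<open>\<theta> * \<rho>\<close>, every monomial
  except the constant one gains a factor \<open>\<theta>\<close>.
\<close>
lemma Rprime_imp_qfun:
  assumes f: "f \<in> Rprime td D" and D: "polydisc td \<rho>' \<subseteq> D" and \<rho>: "0 < \<rho>" "\<rho> < \<rho>'"
  shows "qfun td \<rho> f"
proof -
  let ?J = "{j. td j = 2}"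
  define I where "I = {\<alpha> :: 'a \<Rightarrow> nat. \<forall>a. td a \<noteq> 2 \<longrightarrow> \<alpha> a = 0}"
  define mono where "mono \<alpha> z = (\<Prod>j\<in>?J. (qexp td z $ j) ^ \<alpha> j)" for \<alpha> z
  obtain c where c0: "c (\<lambda>_. 0) = 0"
    and sumD: "\<And>z. qexp td z \<in> D \<Longrightarrow> ((\<lambda>\<alpha>. c \<alpha> * mono \<alpha> z) has_sum f z) I"
    using f unfolding Rprime_def I_def mono_def by blast
  have sum: "((\<lambda>\<alpha>. c \<alpha> * mono \<alpha> z) has_sum f z) I" if "z \<in> zdom td \<rho>" for z
    using sumD that zdom_mono[of \<rho> \<rho>' td] D \<rho> by (auto simp: zdom_def)
  define m where "m \<alpha> = norm (c \<alpha>) * (\<Prod>j\<in>?J. \<rho> ^ \<alpha> j)" for \<alpha>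
  have m: "m summable_on I" "\<And>\<alpha>. 0 \<le> m \<alpha>"
  proof -
    \<comment> \<open>a point over the one all of whose coordinates are \<open>\<rho>\<close>\<close>
    define z0 :: "'a cvec" where "z0 = (\<chi> j. - \<i> * of_real (ln \<rho>) / (2 * of_real pi))"
    have q: "qexp td z0 $ j = of_real \<rho>" if "td j = 2" for j
    proof -
      have "2 * of_real pi * \<i> * z0 $ j = of_real (ln \<rho>)" by (simp add: z0_def field_simps)
      moreover have "exp (of_real (ln \<rho>)) = (of_real \<rho> :: complex)"
        using \<rho> by (metis exp_ln exp_of_real)
      ultimately show ?thesis using that by (simp add: qexp_def)
    qed
    have "qexp td z0 \<in> polydisc td \<rho>'"
      using q \<rho> by (auto simp: polydisc_def qspace_def) (simp add: qexp_def)
    then have "(\<lambda>\<alpha>. c \<alpha> * mono \<alpha> z0) summable_on I" using D sumD has_sum_imp_summable by blast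
    then have "(\<lambda>\<alpha>. norm (c \<alpha> * mono \<alpha> z0)) summable_on I" by (simp add: summable_on_iff_abs_summable_on_complex)
    moreover have "norm (c \<alpha> * mono \<alpha> z0) = m \<alpha>" for \<alpha>
      using \<rho> q by (simp add: m_def mono_def norm_mult prod_norm[symmetric] norm_power)
    ultimately show "m summable_on I" by simp
    show "0 \<le> m \<alpha>" for \<alpha> using \<rho> by (simp add: m_def prod_nonneg)
  qed
  have mono_le: "norm (mono \<alpha> z) \<le> (\<Prod>j\<in>?J. r ^ \<alpha> j)" if "z \<in> zdom td r" for \<alpha> z r
    unfolding mono_def prod_norm[symmetric] norm_power
  proof (intro prod_mono conjI power_mono)
    show "norm (qexp td z $ j) \<le> r" if "j \<in> ?J" for j
      using \<open>z \<in> zdom td r\<close> that by (auto simp: zdom_iff qexp_def intro: less_imp_le simp del: norm_exp_eq_Re)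
  qed auto
  have term_le: "norm (c \<alpha> * mono \<alpha> z) \<le> m \<alpha>" if "z \<in> zdom td \<rho>" for \<alpha> z
    using mono_le[OF that, of \<alpha>] by (simp add: norm_mult m_def mult_left_mono)
  have ul: "uniform_limit (zdom td \<rho>) (\<lambda>X z. \<Sum>\<alpha>\<in>X. c \<alpha> * mono \<alpha> z) f (finite_subsets_at_top I)"
    by (rule Weierstrass_m_test_general'[OF term_le sum m(1)])
  have part: "holo_on (\<lambda>z. \<Sum>\<alpha>\<in>X. c \<alpha> * mono \<alpha> z) Z" if "open Z" for X Z
  proof -
    have "holo_on (\<lambda>z. qexp td z $ j) Z" if "td j = 2" for j
      using holo_on_exp_coordinate[of "2 * of_real pi * \<i>" j Z] that by (simp add: qexp_def)
    then show ?thesis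
      unfolding mono_def by (intro holo_on_sum holo_on_cmult holo_on_prod holo_on_power that) auto
  qed
  have partsep: "sepholo (\<lambda>z. \<Sum>\<alpha>\<in>X. c \<alpha> * mono \<alpha> z) (zdom td \<rho>)" for X
    by (intro holo_on_imp_sepholo part open_zdom)
  have "sepholo f (zdom td \<rho>)"
    unfolding sepholo_def
  proof (intro conjI ballI allI)
    show "continuous_on (zdom td \<rho>) f"
      by (rule uniform_limit_theorem[OF _ ul]) (use partsep in \<open>auto simp: sepholo_def\<close>)
    fix x i assume x: "x \<in> zdom td \<rho>"
    obtain r where r: "0 < r" "cball x r \<subseteq> zdom td \<rho>" using open_zdom x open_contains_cball by blast
    have line: "x + t *s axis i 1 \<in> zdom td \<rho>" if "t \<in> cball 0 r" for t
      using norm_coordinate_step[of x t i x] that r by (auto simp: dist_norm norm_minus_commute)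
    have "(\<lambda>t. f (x + t *s axis i 1)) holomorphic_on ball 0 r"
    proof (rule holomorphic_uniform_limit)
      show "\<forall>\<^sub>F X in finite_subsets_at_top I. continuous_on (cball 0 r) (\<lambda>t. \<Sum>\<alpha>\<in>X. c \<alpha> * mono \<alpha> (x + t *s axis i 1)) \<and>
          (\<lambda>t. \<Sum>\<alpha>\<in>X. c \<alpha> * mono \<alpha> (x + t *s axis i 1)) holomorphic_on ball 0 r"
      proof (intro always_eventually allI)
        fix X
        have "(\<lambda>t. \<Sum>\<alpha>\<in>X. c \<alpha> * mono \<alpha> (x + t *s axis i 1)) holomorphic_on cball 0 r"
          by (rule sepholo_line(1)[OF partsep line])
        then show "continuous_on (cball 0 r) (\<lambda>t. \<Sum>\<alpha>\<in>X. c \<alpha> * mono \<alpha> (x + t *s axis i 1)) \<and>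
          (\<lambda>t. \<Sum>\<alpha>\<in>X. c \<alpha> * mono \<alpha> (x + t *s axis i 1)) holomorphic_on ball 0 r"
          by (auto intro: holomorphic_on_imp_continuous_on holomorphic_on_subset)
      qed
      show "uniform_limit (cball 0 r) (\<lambda>X t. \<Sum>\<alpha>\<in>X. c \<alpha> * mono \<alpha> (x + t *s axis i 1)) (\<lambda>t. f (x + t *s axis i 1)) (finite_subsets_at_top I)"
        using ul line unfolding uniform_limit_iff by (fast elim: eventually_mono)
    qed auto
    then show "(\<lambda>t. f (x + t *s axis i 1)) field_differentiable at 0"
      using r by (intro holomorphic_on_imp_differentiable_at[of _ "ball 0 r"]) auto
  qed
  then have holo: "holo_on f (zdom td \<rho>)" by (rule sepholo_imp_holo_on[OF _ open_zdom])
  have inv: "f z = f z'" if "z \<in> zdom td \<rho>" "z' \<in> zdom td \<rho>" "qexp td z = qexp td z'" for z z'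
  proof (rule has_sum_unique)
    show "((\<lambda>\<alpha>. c \<alpha> * mono \<alpha> z) has_sum f z) I" by (rule sum[OF that(1)])
    show "((\<lambda>\<alpha>. c \<alpha> * mono \<alpha> z) has_sum f z') I" using sum[OF that(2)] by (simp add: mono_def that(3))
  qed
  have small: "\<exists>\<eta>>0. \<eta> \<le> \<rho> \<and> (\<forall>z\<in>zdom td \<eta>. norm (f z) \<le> \<epsilon>)" if \<epsilon>: "0 < \<epsilon>" for \<epsilon>
  proof -
    define S where "S = infsum m I"
    have S: "0 \<le> S" unfolding S_def by (intro infsum_nonneg m)
    \<comment> \<open>\<open>S + 1\<close> because \<open>S\<close> may be zero\<close>
    define \<theta> where "\<theta> = min 1 (\<epsilon> / (S + 1))"
    have \<theta>: "0 < \<theta>" "\<theta> \<le> 1" "\<theta> * S \<le> \<epsilon>"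
    proof -
      show "0 < \<theta>" "\<theta> \<le> 1" using \<epsilon> S by (auto simp: \<theta>_def)
      have "\<theta> * S \<le> \<epsilon> / (S + 1) * (S + 1)" using \<epsilon> S by (intro mult_mono) (auto simp: \<theta>_def)
      then show "\<theta> * S \<le> \<epsilon>" using S by simp
    qed
    have "norm (f z) \<le> \<epsilon>" if z: "z \<in> zdom td (\<theta> * \<rho>)" for z
    proof -
      have "\<theta> * \<rho> \<le> \<rho>" using \<theta> \<rho> by (simp add: mult_le_cancel_right1)
      then have z': "z \<in> zdom td \<rho>" using z zdom_mono by blast
      have le: "norm (c \<alpha> * mono \<alpha> z) \<le> \<theta> * m \<alpha>" if \<alpha>: "\<alpha> \<in> I" for \<alpha>
      proof (cases "\<alpha> = (\<lambda>_. 0)")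
        case True
        then show ?thesis using c0 m(2) \<theta> by simp
      next
        case False
        then obtain a where a: "\<alpha> a \<noteq> 0" by auto
        then have aJ: "a \<in> ?J" using \<alpha> by (auto simp: I_def)
        have "(\<Prod>j\<in>?J. \<theta> ^ \<alpha> j) = \<theta> ^ \<alpha> a * (\<Prod>j\<in>?J - {a}. \<theta> ^ \<alpha> j)"
          using aJ by (intro prod.remove) auto
        also have "\<dots> \<le> \<theta> * 1"
        proof (intro mult_mono prod_le_1)
          show "\<theta> ^ \<alpha> a \<le> \<theta>" using \<theta> a power_decreasing[of 1 "\<alpha> a" \<theta>] by simp
        qed (use \<theta> in \<open>auto simp: power_le_one prod_nonneg\<close>)
        finally have "(\<Prod>j\<in>?J. \<theta> ^ \<alpha> j) \<le> \<theta>" by simp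
        then have "(\<Prod>j\<in>?J. (\<theta> * \<rho>) ^ \<alpha> j) \<le> \<theta> * (\<Prod>j\<in>?J. \<rho> ^ \<alpha> j)"
          using \<rho> by (simp add: power_mult_distrib prod.distrib mult_right_mono prod_nonneg)
        then have "norm (mono \<alpha> z) \<le> \<theta> * (\<Prod>j\<in>?J. \<rho> ^ \<alpha> j)" using mono_le[OF z, of \<alpha>] by linarith
        then have "norm (c \<alpha>) * norm (mono \<alpha> z) \<le> norm (c \<alpha>) * (\<theta> * (\<Prod>j\<in>?J. \<rho> ^ \<alpha> j))"
          by (rule mult_left_mono) simp
        then show ?thesis by (simp add: norm_mult m_def mult.left_commute)
      qed
      have "norm (f z) \<le> \<theta> * S"
        unfolding S_def
        by (rule norm_infsum_le[OF sum[OF z'] has_sum_cmult_right[OF has_sum_infsum[OF m(1)]] le])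
      then show ?thesis using \<theta>(3) by simp
    qed
    moreover have "\<theta> * \<rho> \<le> \<rho>" using \<theta> \<rho> by (simp add: mult_le_cancel_right1)
    ultimately show ?thesis using \<theta> \<rho> by (intro exI[of _ "\<theta> * \<rho>"]) auto
  qed
  show ?thesis unfolding qfun_def using holo inv small by blast
qed

section \<open>Third derivatives of cubic forms\<close>

lemma sum_if_const: "(\<Sum>j\<in>S. if P then f j else 0) = (if P then sum f S else (0::'a::comm_monoid_add))"
  by simp

lemma pd_linear_form: "pd j (\<lambda>z::complex^'n. \<Sum>l\<in>UNIV. M l * z $ l) = (\<lambda>z. M j)"
proof
  fix x :: "complex^'n"
  have "pd j (\<lambda>z::complex^'n. \<Sum>l\<in>UNIV. M l * z $ l) x = (\<Sum>l\<in>UNIV. M l * (if j = l then 1 else 0))"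
    by (simp add: pd_sum[of _ _ UNIV] holo_on_cmult holo_on_coordinate pd_cmult[of _ UNIV] pd_coordinate)
  then show "pd j (\<lambda>z::complex^'n. \<Sum>l\<in>UNIV. M l * z $ l) x = M j"
    by (simp add: delta_mult cong: if_cong)
qed

lemma holo_on_monomial2: "holo_on (\<lambda>z. c * z $ i * z $ l) Z" if "open Z"
  by (intro holo_on_mult holo_on_const holo_on_coordinate that)

lemma holo_on_monomial3: "holo_on (\<lambda>z. c * z $ i * z $ j * z $ l) Z" if "open Z"
  by (intro holo_on_mult holo_on_const holo_on_coordinate that)

lemma pd_quadratic_form:
  "pd a (\<lambda>z::complex^'n. \<Sum>j\<in>UNIV. \<Sum>l\<in>UNIV. L j l * z $ j * z $ l) = (\<lambda>z. \<Sum>l\<in>UNIV. (L a l + L l a) * z $ l)"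
proof
  fix x :: "complex^'n"
  have m: "pd a (\<lambda>z::complex^'n. c * z $ j * z $ l) x = (if a = j then c * x $ l else 0) + (if a = l then c * x $ j else 0)" for c j l
    by (simp add: pd_mult[of _ UNIV] holo_on_mult holo_on_const holo_on_coordinate pd_const pd_coordinate)
  show "pd a (\<lambda>z::complex^'n. \<Sum>j\<in>UNIV. \<Sum>l\<in>UNIV. L j l * z $ j * z $ l) x = (\<Sum>l\<in>UNIV. (L a l + L l a) * x $ l)"
    by (simp add: pd_sum[of _ _ UNIV] holo_on_sum holo_on_monomial2 m sum.distrib sum_if_const distrib_right del: sum.delta' cong: if_cong)
       (simp add: sum_if_const)
qed

lemma pd_cubic_form:
  "pd b (\<lambda>z::complex^'n. \<Sum>i\<in>UNIV. \<Sum>j\<in>UNIV. \<Sum>l\<in>UNIV. K i j l * z $ i * z $ j * z $ l) =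
    (\<lambda>z. \<Sum>j\<in>UNIV. \<Sum>l\<in>UNIV. (K b j l + K j b l + K j l b) * z $ j * z $ l)"
proof
  fix x :: "complex^'n"
  have m: "pd b (\<lambda>z::complex^'n. c * z $ i * z $ j * z $ l) x = (if b = i then c * x $ j * x $ l else 0)
      + (if b = j then c * x $ i * x $ l else 0) + (if b = l then c * x $ i * x $ j else 0)" for c i j l
    by (simp add: pd_mult[of _ UNIV] holo_on_mult holo_on_const holo_on_coordinate pd_const pd_coordinate)
  show "pd b (\<lambda>z::complex^'n. \<Sum>i\<in>UNIV. \<Sum>j\<in>UNIV. \<Sum>l\<in>UNIV. K i j l * z $ i * z $ j * z $ l) x =
    (\<Sum>j\<in>UNIV. \<Sum>l\<in>UNIV. (K b j l + K j b l + K j l b) * x $ j * x $ l)"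
    by (simp add: pd_sum[of _ _ UNIV] holo_on_sum holo_on_monomial3 m sum.distrib sum_if_const distrib_right)
qed

section \<open>Third derivatives of quantum potentials\<close>

locale framed_module =
  fixes k :: nat and V :: "nat \<Rightarrow> 'n::{finite,linorder} cvec set"
    and B :: "'n cvec \<Rightarrow> 'n cvec \<Rightarrow> complex" and e :: "'n cvec"
    and act :: "'n cvec \<Rightarrow> 'n cvec \<Rightarrow> 'n cvec"
    and td :: "'n \<Rightarrow> nat" and T :: "'n \<Rightarrow> 'n cvec" and \<delta> :: "'n \<Rightarrow> 'n"
  assumes fm: "frobenius_module k V B e act" and ab: "adapted_basis V B e td T \<delta>"
begin

lemma graded: "graded_space k V" using fm by (simp add: frobenius_module_def)
lemma subspace_V: "vec.subspace (V d)" using graded by (simp add: graded_space_def)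
lemma T_deg: "T a \<in> V (td a)" using ab by (simp add: adapted_basis_def)
lemma B_T: "B (T (\<delta> a)) (T b) = (if a = b then 1 else 0)" using ab unfolding adapted_basis_def by blast
lemma B_sym: "B u v = B v u" using fm unfolding frobenius_module_def by blast
lemma B_lin: "B (x + y) v = B x v + B y v" "B (c *s x) v = c * B x v" "B u (x + y) = B u x + B u y"
      "B u (c *s x) = c * B u x"
proof -
  have "bilinear_form B" using fm unfolding frobenius_module_def by blast
  then show "B (x + y) v = B x v + B y v" "B (c *s x) v = c * B x v" "B u (x + y) = B u x + B u y"
      "B u (c *s x) = c * B u x"
    by (simp_all add: bilinear_form_def functional_iff)
qed
lemma B_degree: "u \<in> V a \<Longrightarrow> v \<in> V b \<Longrightarrow> B u v \<noteq> 0 \<Longrightarrow> a + b = 2 * k"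
  using fm unfolding frobenius_module_def by blast

lemma delta_delta: "\<delta> (\<delta> a) = a"
proof -
  have "B (T (\<delta> (\<delta> a))) (T (\<delta> a)) = 1" by (simp add: B_T)
  then have "B (T (\<delta> a)) (T (\<delta> (\<delta> a))) \<noteq> 0" using B_sym by (metis zero_neq_one)
  then show ?thesis by (metis B_T)
qed

lemma td_delta: "td (\<delta> a) + td a = 2 * k"
  by (rule B_degree[OF T_deg T_deg]) (simp add: B_T)

text \<open>
  The structure constants of the classical module, known as Yukawa couplings.
\<close>
definition yukawa :: "'n \<Rightarrow> 'n \<Rightarrow> 'n \<Rightarrow> complex" where "yukawa j a b = B (act (T j) (T a)) (T b)"

lemma T_2: "td j = 2 \<Longrightarrow> T j \<in> V 2" using T_deg[of j] by simp

lemma yukawa_sym: "td j = 2 \<Longrightarrow> yukawa j a b = yukawa j b a"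
proof -
  assume "td j = 2"
  then have "B (act (T j) (T a)) (T b) = B (T a) (act (T j) (T b))"
    using fm T_2 unfolding frobenius_module_def by blast
  then show ?thesis by (simp add: yukawa_def B_sym)
qed

lemma yukawa_swap: assumes "td j = 2" "td a = 2" shows "yukawa j a b = yukawa a j b"
proof -
  have *: "T j \<in> V 2" "T a \<in> V 2" using assms T_2 by auto
  have e: "act w e = w" if "w \<in> V 2" for w using fm that unfolding frobenius_module_def by blast
  have "act (T j) (act (T a) e) = act (T a) (act (T j) e)"
    using fm * unfolding frobenius_module_def sym_module_def by blast
  then show ?thesis by (simp add: yukawa_def e *)
qed

lemma classical_as_cubic:
  "classical_potential k B act td T = (\<lambda>z. \<Sum>i\<in>UNIV. \<Sum>j\<in>UNIV. \<Sum>l\<in>UNIV.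
      (if td i = 2 then C_coeff k (td j) / 12 * yukawa i j l else 0) * z $ i * z $ j * z $ l)"
proof
  fix z
  have "classical_potential k B act td T z = (\<Sum>i\<in>UNIV. if td i = 2 then \<Sum>j\<in>UNIV. \<Sum>l\<in>UNIV.
      z $ i * z $ j * z $ l * (C_coeff k (td j) / 12) * yukawa i j l else 0)"
    unfolding classical_potential_def yukawa_def by (rule sum.mono_neutral_cong_left) auto
  also have "\<dots> = (\<Sum>i\<in>UNIV. \<Sum>j\<in>UNIV. \<Sum>l\<in>UNIV.
      (if td i = 2 then C_coeff k (td j) / 12 * yukawa i j l else 0) * z $ i * z $ j * z $ l)"
    by (intro sum.cong refl) (simp add: algebra_simps)
  finally show "classical_potential k B act td T z = \<dots>" .
qed

lemma classical_holo: "open Z \<Longrightarrow> holo_on (classical_potential k B act td T) Z"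
  unfolding classical_as_cubic by (intro holo_on_sum holo_on_monomial3)

text \<open>
  Differentiating the cubic form produces one term for each order of \<open>j\<close>, \<open>a\<close>, \<open>b\<close> that starts with an
  index of degree 2, and the constants \<open>C_coeff\<close> are such that these terms add up to 12.
\<close>
lemma classical_third_derivative:
  assumes j: "td j = 2" and ab: "td a + td b + 2 = 2 * k"
  shows "pd j (pd a (pd b (classical_potential k B act td T))) z = yukawa j a b"
proof -
  let ?K = "\<lambda>i j l. if td i = 2 then C_coeff k (td j) / 12 * yukawa i j l else 0"
  have "pd j (pd a (pd b (classical_potential k B act td T))) z =
      ?K b a j + ?K a b j + ?K a j b + (?K b j a + ?K j b a + ?K j a b)"
    unfolding classical_as_cubic pd_cubic_form pd_quadratic_form pd_linear_form by simp
  also have "\<dots> = yukawa j a b"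
  proof -
    consider "td a = 2" "td b = 2" | "td a = 2" "td b \<noteq> 2" | "td a \<noteq> 2" "td b = 2" | "td a \<noteq> 2" "td b \<noteq> 2" by blast
    then show ?thesis
    proof cases
      case 1
      have "k = 3" using 1 ab by simp
      moreover have "yukawa b a j = yukawa j a b" "yukawa a b j = yukawa j a b" "yukawa a j b = yukawa j a b" "yukawa b j a = yukawa j a b" "yukawa j b a = yukawa j a b"
        using 1 j yukawa_sym yukawa_swap by metis+
      ultimately show ?thesis using 1 j by (simp add: C_coeff_def)
    next
      case 2
      then have "k \<noteq> 3" "td b + 4 = 2 * k" using ab by auto
      moreover have "yukawa a b j = yukawa j a b" "yukawa a j b = yukawa j a b" "yukawa j b a = yukawa j a b"
        using 2 j yukawa_sym yukawa_swap by metis+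
      ultimately show ?thesis using 2 j by (simp add: C_coeff_def)
    next
      case 3
      then have "k \<noteq> 3" "td a + 4 = 2 * k" using ab by auto
      moreover have "yukawa b a j = yukawa j a b" "yukawa b j a = yukawa j a b" "yukawa j b a = yukawa j a b"
        using 3 j yukawa_sym yukawa_swap by metis+
      ultimately show ?thesis using 3 j by (simp add: C_coeff_def)
    next
      case 4
      then have "C_coeff k (td a) = 6" "C_coeff k (td b) = 6"
        using ab by (auto simp: C_coeff_def)
      moreover have "yukawa j b a = yukawa j a b" using yukawa_sym[OF j] by metis
      ultimately show ?thesis using 4 j by simp
    qed
  qed
  finally show ?thesis .
qed

text \<open>
  The statement about degree 0 expresses that the unit receives no quantum correction.
\<close>
definition quantum_part :: "real \<Rightarrow> ('n cvec \<Rightarrow> complex) \<Rightarrow> bool" where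
  "quantum_part \<rho> \<phi>h \<longleftrightarrow> holo_on \<phi>h (zdom td \<rho>) \<and>
    (\<forall>j a b. td j = 2 \<longrightarrow> td a + td b + 2 = 2 * k \<longrightarrow>
       (\<exists>f. qfun td \<rho> f \<and> (\<forall>z\<in>zdom td \<rho>. pd j (pd a (pd b \<phi>h)) z = f z \<and> (td a = 0 \<longrightarrow> f z = 0))))"

lemma quantum_part_qfun: "qfun td \<rho> h \<Longrightarrow> quantum_part \<rho> h"
  unfolding quantum_part_def
proof (intro conjI allI impI)
  assume h: "qfun td \<rho> h"
  then show "holo_on h (zdom td \<rho>)" by (simp add: qfun_def)
  fix j a b
  have "pd j (pd a (pd b h)) z = 0" if "td a = 0" "z \<in> zdom td \<rho>" for z
  proof -
    have "pd j (pd a (pd b h)) z = pd j (\<lambda>_. 0) z"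
      by (rule pd_cong[OF open_zdom that(2)]) (simp add: qfun_pd_zero[OF qfun_pd[OF h]] that(1))
    then show ?thesis by (simp add: pd_const)
  qed
  then show "\<exists>f. qfun td \<rho> f \<and> (\<forall>z\<in>zdom td \<rho>. pd j (pd a (pd b h)) z = f z \<and> (td a = 0 \<longrightarrow> f z = 0))"
    using qfun_pd[OF qfun_pd[OF qfun_pd[OF h]]] by blast
qed

text \<open>
  For \<open>k > 3\<close> at least one of \<open>a\<close>, \<open>b\<close> has a degree other than 2, and by symmetry it may be \<open>b\<close>.  The
  coefficient functions do not depend on that coordinate, so the derivative in direction \<open>b\<close> is again
  linear in the coordinates with coefficients of the same kind.  The degrees exclude all terms of the next
  derivative which still contain a coordinate as a factor.
\<close>
lemma quantum_part_polynomial: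
  assumes k: "3 < k" and \<rho>: "0 < \<rho>" and h1: "\<And>a. qfun td \<rho> (h1 a)" and h2: "\<And>a b. qfun td \<rho> (h2 a b)"
  shows "quantum_part \<rho> (\<lambda>z. (\<Sum>a\<in>{a. td a + 4 = 2 * k}. z $ a * h1 a z) +
      (\<Sum>(a, b)\<in>{(a, b). 2 < td a \<and> td a + 4 < 2 * k \<and> td a + td b + 2 = 2 * k}. z $ a * z $ b * h2 a b z))"
    (is "quantum_part \<rho> ?\<phi>h")
proof -
  let ?Z = "zdom td \<rho>"
  define g1 where "g1 a = (if td a + 4 = 2 * k then h1 a else (\<lambda>_. 0))" for a
  define g2 where "g2 a b = (if 2 < td a \<and> td a + 4 < 2 * k \<and> td a + td b + 2 = 2 * k then h2 a b else (\<lambda>_. 0))" for a b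
  have g1: "qfun td \<rho> (g1 a)" and g2: "qfun td \<rho> (g2 a b)" for a b
    using h1 h2 qfun_zero[OF \<rho>] by (auto simp: g1_def g2_def)
  have g1h: "holo_on (g1 a) ?Z" and g2h: "holo_on (g2 a b) ?Z" for a b
    using g1 g2 by (auto simp: qfun_def)
  have eq: "?\<phi>h = (\<lambda>z. (\<Sum>a\<in>UNIV. z $ a * g1 a z) + (\<Sum>a\<in>UNIV. \<Sum>b\<in>UNIV. z $ a * z $ b * g2 a b z))"
  proof
    fix z
    have 1: "(\<Sum>a\<in>{a. td a + 4 = 2 * k}. z $ a * h1 a z) = (\<Sum>a\<in>UNIV. z $ a * g1 a z)"
      by (rule sum.mono_neutral_cong_left) (auto simp: g1_def)
    have "(\<Sum>(a, b)\<in>{(a, b). 2 < td a \<and> td a + 4 < 2 * k \<and> td a + td b + 2 = 2 * k}. z $ a * z $ b * h2 a b z)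
        = (\<Sum>(a, b)\<in>UNIV \<times> UNIV. z $ a * z $ b * g2 a b z)"
      by (rule sum.mono_neutral_cong_left) (auto simp: g2_def split: if_splits)
    also have "\<dots> = (\<Sum>a\<in>UNIV. \<Sum>b\<in>UNIV. z $ a * z $ b * g2 a b z)" by (simp add: sum.cartesian_product)
    finally show "?\<phi>h z = (\<Sum>a\<in>UNIV. z $ a * g1 a z) + (\<Sum>a\<in>UNIV. \<Sum>b\<in>UNIV. z $ a * z $ b * g2 a b z)"
      using 1 by simp
  qed
  have m1: "holo_on (\<lambda>z. z $ a * g1 a z) ?Z" and m2: "holo_on (\<lambda>z. z $ a * z $ b * g2 a b z) ?Z" for a b
    by (intro holo_on_mult holo_on_coordinate g1h g2h open_zdom)+
  have holo: "holo_on ?\<phi>h ?Z"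
    unfolding eq by (intro holo_on_add holo_on_sum m1 m2 open_zdom)
  have first: "pd b ?\<phi>h z = g1 b z + (\<Sum>a\<in>UNIV. z $ a * (g2 a b z + g2 b a z))"
    if b: "td b \<noteq> 2" and z: "z \<in> ?Z" for b z
  proof -
    have p1: "pd b (\<lambda>z. z $ a * g1 a z) z = (if b = a then g1 a z else 0)" for a
      using pd_mult[OF holo_on_coordinate g1h open_zdom z, of b a a] qfun_pd_zero[OF g1 b z]
      by (simp add: pd_coordinate)
    have p2: "pd b (\<lambda>z. z $ a * z $ c * g2 a c z) z = (if b = a then z $ c * g2 a c z else 0) + (if b = c then z $ a * g2 a c z else 0)" for a c
      using pd_mult[OF holo_on_mult[OF holo_on_coordinate holo_on_coordinate open_zdom] g2h open_zdom z, of b a c a c]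
        pd_mult[OF holo_on_coordinate holo_on_coordinate open_zdom z, of b a c] qfun_pd_zero[OF g2 b z]
      by (simp add: pd_coordinate)
    have "pd b ?\<phi>h z = (\<Sum>a\<in>UNIV. pd b (\<lambda>z. z $ a * g1 a z) z) + (\<Sum>a\<in>UNIV. \<Sum>c\<in>UNIV. pd b (\<lambda>z. z $ a * z $ c * g2 a c z) z)"
      unfolding eq by (simp add: pd_add[of _ ?Z] holo_on_sum m1 m2 open_zdom z pd_sum[of _ _ ?Z])
    also have "\<dots> = g1 b z + (\<Sum>a\<in>UNIV. z $ a * (g2 a b z + g2 b a z))"
      unfolding p1 p2 by (simp add: sum.distrib sum_if_const distrib_left)
    finally show ?thesis .
  qed
  have second: "pd a (pd b ?\<phi>h) z = pd a (g1 b) z + (g2 a b z + g2 b a z)"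
    if b: "td b \<noteq> 2" and ab: "td a + td b + 2 = 2 * k" and z: "z \<in> ?Z" for a b z
  proof -
    define g where "g c z = g2 c b z + g2 b c z" for c z
    have gq: "qfun td \<rho> (g c)" for c unfolding g_def by (intro qfun_add g2)
    then have gh: "holo_on (g c) ?Z" for c by (simp add: qfun_def)
    have g0: "pd a (g c) z = 0" for c
    proof (cases "td a = 2")
      case True
      then have "g c = (\<lambda>_. 0)" using ab by (auto simp: g_def g2_def fun_eq_iff)
      then show ?thesis by (simp add: pd_const)
    next
      case False
      then show ?thesis by (rule qfun_pd_zero[OF gq _ z])
    qed
    have mh: "holo_on (\<lambda>z. z $ c * g c z) ?Z" for c by (intro holo_on_mult holo_on_coordinate gh open_zdom)
    have "pd a (pd b ?\<phi>h) z = pd a (\<lambda>z. g1 b z + (\<Sum>c\<in>UNIV. z $ c * g c z)) z"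
      by (rule pd_cong[OF open_zdom z]) (simp only: first[OF b] g_def)
    also have "\<dots> = pd a (g1 b) z + (\<Sum>c\<in>UNIV. pd a (\<lambda>z. z $ c * g c z) z)"
      by (simp add: pd_add[of _ ?Z] pd_sum[of _ _ ?Z] holo_on_sum g1h mh open_zdom z)
    also have "(\<Sum>c\<in>UNIV. pd a (\<lambda>z. z $ c * g c z) z) = (\<Sum>c\<in>UNIV. if a = c then g c z else 0)"
      using pd_mult[OF holo_on_coordinate gh open_zdom z, of a _ _] g0
      by (intro sum.cong refl) (simp add: pd_coordinate)
    finally show ?thesis by (simp add: g_def)
  qed
  have third: "\<exists>f. qfun td \<rho> f \<and> (\<forall>z\<in>?Z. pd j (pd a (pd b ?\<phi>h)) z = f z \<and> (td a = 0 \<longrightarrow> f z = 0))"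
    if b: "td b \<noteq> 2" and ab: "td a + td b + 2 = 2 * k" for j a b
  proof (intro exI conjI ballI)
    show "qfun td \<rho> (pd j (\<lambda>z. pd a (g1 b) z + (g2 a b z + g2 b a z)))"
      by (intro qfun_pd qfun_add g1 g2)
    show "pd j (pd a (pd b ?\<phi>h)) z = pd j (\<lambda>z. pd a (g1 b) z + (g2 a b z + g2 b a z)) z" if "z \<in> ?Z" for z
      by (rule pd_cong[OF open_zdom that]) (rule second[OF b ab])
    show "td a = 0 \<longrightarrow> pd j (\<lambda>z. pd a (g1 b) z + (g2 a b z + g2 b a z)) z = 0" if "z \<in> ?Z" for z
    proof
      assume a: "td a = 0"
      have "pd j (\<lambda>z. pd a (g1 b) z + (g2 a b z + g2 b a z)) z = pd j (\<lambda>_. 0) z"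
        by (rule pd_cong[OF open_zdom that]) (use ab in \<open>simp add: qfun_pd_zero[OF g1] a g2_def\<close>)
      then show "pd j (\<lambda>z. pd a (g1 b) z + (g2 a b z + g2 b a z)) z = 0" by (simp add: pd_const)
    qed
  qed
  show ?thesis
    unfolding quantum_part_def
  proof (intro conjI allI impI holo)
    fix j a b assume ab: "td a + td b + 2 = 2 * k"
    show "\<exists>f. qfun td \<rho> f \<and> (\<forall>z\<in>?Z. pd j (pd a (pd b ?\<phi>h)) z = f z \<and> (td a = 0 \<longrightarrow> f z = 0))"
    proof (cases "td b = 2")
      case False
      then show ?thesis by (rule third[OF _ ab])
    next
      case True
      then have a: "td a \<noteq> 2" "td b + td a + 2 = 2 * k" and "td a \<noteq> 0" using ab k by auto
      from third[OF a, of j] obtain f where f: "qfun td \<rho> f" "\<And>z. z \<in> ?Z \<Longrightarrow> pd j (pd b (pd a ?\<phi>h)) z = f z" by blast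
      have "pd j (pd a (pd b ?\<phi>h)) z = pd j (pd b (pd a ?\<phi>h)) z" if "z \<in> ?Z" for z
        by (rule pd_cong[OF open_zdom that]) (rule pd_commute[OF holo open_zdom])
      then show ?thesis using f \<open>td a \<noteq> 0\<close> by auto
    qed
  qed
qed

lemma polydisc_neighbourhood:
  assumes "openin (top_of_set (qspace td)) D" "0 \<in> D"
  obtains \<rho> where "0 < \<rho>" "polydisc td \<rho> \<subseteq> D"
proof -
  obtain r where r: "0 < r" "ball 0 r \<inter> qspace td \<subseteq> D"
    using assms unfolding openin_contains_ball by blast
  define \<rho> where "\<rho> = r / (real CARD('n) + 1)"
  have \<rho>: "0 < \<rho>" using r by (simp add: \<rho>_def)
  have "polydisc td \<rho> \<subseteq> D"
  proof
    fix q assume q: "q \<in> polydisc td \<rho>"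
    have "norm (q $ a) \<le> \<rho>" for a
      using q \<rho> by (cases "td a = 2") (auto simp: polydisc_def qspace_def less_imp_le)
    then have "(\<Sum>a\<in>UNIV. norm (q $ a)) \<le> real CARD('n) * \<rho>"
      using sum_bounded_above[of UNIV "\<lambda>a. norm (q $ a)" \<rho>] by simp
    moreover have "norm q \<le> (\<Sum>a\<in>UNIV. norm (q $ a))"
      unfolding norm_vec_def by (rule L2_set_le_sum) simp
    moreover have "real CARD('n) * \<rho> < r" using r by (simp add: \<rho>_def field_simps)
    ultimately have "q \<in> ball 0 r" by simp
    then show "q \<in> D" using r q by (auto simp: polydisc_def)
  qed
  then show thesis using that \<rho> by blast
qed

lemma quantum_third_derivatives:
  assumes qp: "quantum_potential k V B e act td T \<delta> D \<phi>"
  obtains \<rho> where "0 < \<rho>" "polydisc td \<rho> \<subseteq> D" "holo_on \<phi> (zdom td \<rho>)"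
    "\<And>j a b. td j = 2 \<Longrightarrow> td a + td b + 2 = 2 * k \<Longrightarrow>
       \<exists>f. qfun td \<rho> f \<and> (\<forall>z\<in>zdom td \<rho>. pd j (pd a (pd b \<phi>)) z = yukawa j a b + f z \<and> (td a = 0 \<longrightarrow> f z = 0))"
proof -
  have D: "openin (top_of_set (qspace td)) D" "0 \<in> D" using qp by (auto simp: quantum_potential_def)
  obtain \<rho>' where \<rho>': "0 < \<rho>'" "polydisc td \<rho>' \<subseteq> D" using polydisc_neighbourhood[OF D] .
  define \<rho> where "\<rho> = \<rho>' / 2"
  have \<rho>: "0 < \<rho>" "\<rho> < \<rho>'" using \<rho>' by (auto simp: \<rho>_def)
  have sub: "polydisc td \<rho> \<subseteq> D" using \<rho>' \<rho> by (force simp: polydisc_def)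
  note R = Rprime_imp_qfun[OF _ \<rho>'(2) \<rho>]
  define P where "P \<phi>h \<longleftrightarrow> (\<exists>h1 h2. (\<forall>a. h1 a \<in> Rprime td D) \<and> (\<forall>a b. h2 a b \<in> Rprime td D) \<and>
      \<phi>h = (\<lambda>z. (\<Sum>a\<in>{a. td a + 4 = 2 * k}. z $ a * h1 a z) +
                        (\<Sum>(a, b)\<in>{(a, b). 2 < td a \<and> td a + 4 < 2 * k \<and> td a + td b + 2 = 2 * k}.
                           z $ a * z $ b * h2 a b z)))" for \<phi>h
  have "\<exists>\<phi>h. (\<forall>z. qexp td z \<in> D \<longrightarrow> \<phi> z = classical_potential k B act td T z + \<phi>h z) \<and>
      (k \<le> 2 \<longrightarrow> \<phi>h = (\<lambda>_. 0)) \<and> (k = 3 \<longrightarrow> \<phi>h \<in> Rprime td D) \<and>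
      (3 < k \<longrightarrow> P \<phi>h \<and> (\<forall>z. qexp td z \<in> D \<longrightarrow> frobenius_module k V B e (quantum_act_z td T \<delta> \<phi> z)))"
    using qp unfolding quantum_potential_def P_def[symmetric] by (elim conjE)
  then obtain \<phi>h where *: "(\<forall>z. qexp td z \<in> D \<longrightarrow> \<phi> z = classical_potential k B act td T z + \<phi>h z) \<and>
      (k \<le> 2 \<longrightarrow> \<phi>h = (\<lambda>_. 0)) \<and> (k = 3 \<longrightarrow> \<phi>h \<in> Rprime td D) \<and>
      (3 < k \<longrightarrow> P \<phi>h \<and> (\<forall>z. qexp td z \<in> D \<longrightarrow> frobenius_module k V B e (quantum_act_z td T \<delta> \<phi> z)))"
    by (rule exE)
  have \<phi>: "\<And>z. qexp td z \<in> D \<Longrightarrow> \<phi> z = classical_potential k B act td T z + \<phi>h z"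
    and h0: "k \<le> 2 \<Longrightarrow> \<phi>h = (\<lambda>_. 0)" and h3: "k = 3 \<Longrightarrow> \<phi>h \<in> Rprime td D"
    and h4: "3 < k \<Longrightarrow> P \<phi>h"
    using * by simp_all
  have part: "quantum_part \<rho> \<phi>h"
  proof -
    consider "k \<le> 2" | "k = 3" | "3 < k" by linarith
    then show ?thesis
    proof cases
      case 1
      then show ?thesis using h0 quantum_part_qfun[OF qfun_zero[OF \<rho>(1)]] by simp
    next
      case 2
      then show ?thesis using R[OF h3] quantum_part_qfun by blast
    next
      case 3
      then have "P \<phi>h" by (rule h4)
      then show ?thesis
        unfolding P_def
      proof (elim exE conjE)
        fix h1 h2 assume h: "\<forall>a. h1 a \<in> Rprime td D" "\<forall>a b. h2 a b \<in> Rprime td D"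
          and eq: "\<phi>h = (\<lambda>z. (\<Sum>a\<in>{a. td a + 4 = 2 * k}. z $ a * h1 a z) +
                        (\<Sum>(a, b)\<in>{(a, b). 2 < td a \<and> td a + 4 < 2 * k \<and> td a + td b + 2 = 2 * k}.
                           z $ a * z $ b * h2 a b z))"
        show "quantum_part \<rho> \<phi>h"
          unfolding eq by (rule quantum_part_polynomial[OF 3 \<rho>(1)]) (use R h in auto)
      qed
    qed
  qed
  let ?Z = "zdom td \<rho>"
  have eq: "\<phi> z = classical_potential k B act td T z + \<phi>h z" if "z \<in> ?Z" for z
    using \<phi> that sub by (auto simp: zdom_def)
  have hh: "holo_on \<phi>h ?Z" using part by (simp add: quantum_part_def)
  have hc: "holo_on (classical_potential k B act td T) ?Z" by (rule classical_holo[OF open_zdom])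
  have holo: "holo_on \<phi> ?Z"
    using holo_on_cong[of ?Z \<phi>, OF eq] holo_on_add[OF hc hh open_zdom] by blast
  show thesis
  proof (rule that[OF \<rho>(1) sub holo])
    fix j a b assume j: "td j = 2" and ab: "td a + td b + 2 = 2 * k"
    obtain f where f: "qfun td \<rho> f" "\<And>z. z \<in> ?Z \<Longrightarrow> pd j (pd a (pd b \<phi>h)) z = f z \<and> (td a = 0 \<longrightarrow> f z = 0)"
      using part[unfolded quantum_part_def, THEN conjunct2, rule_format, OF j ab] by auto
    have add: "pd i \<psi> z = pd i \<alpha> z + pd i \<beta> z" if "\<And>z. z \<in> ?Z \<Longrightarrow> \<psi> z = \<alpha> z + \<beta> z" "holo_on \<alpha> ?Z" "holo_on \<beta> ?Z" "z \<in> ?Z"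
      for i z and \<psi> \<alpha> \<beta> :: "'n cvec \<Rightarrow> complex"
      using pd_cong[OF open_zdom that(4), of \<psi> "\<lambda>z. \<alpha> z + \<beta> z" i] that(1) pd_add[OF that(2,3) open_zdom that(4), of i]
      by simp
    have "pd j (pd a (pd b \<phi>)) z = pd j (pd a (pd b (classical_potential k B act td T))) z + pd j (pd a (pd b \<phi>h)) z"
      if "z \<in> ?Z" for z
    proof -
      have 1: "pd b \<phi> y = pd b (classical_potential k B act td T) y + pd b \<phi>h y" if "y \<in> ?Z" for y
        by (rule add[OF eq hc hh that])
      have 2: "pd a (pd b \<phi>) y = pd a (pd b (classical_potential k B act td T)) y + pd a (pd b \<phi>h) y" if "y \<in> ?Z" for y
        by (rule add[OF 1 holo_on_partial[OF hc open_zdom] holo_on_partial[OF hh open_zdom] that])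
      show ?thesis
        by (rule add[OF 2 holo_on_partial[OF holo_on_partial[OF hc open_zdom] open_zdom]
              holo_on_partial[OF holo_on_partial[OF hh open_zdom] open_zdom] that])
    qed
    then show "\<exists>f. qfun td \<rho> f \<and> (\<forall>z\<in>?Z. pd j (pd a (pd b \<phi>)) z = yukawa j a b + f z \<and> (td a = 0 \<longrightarrow> f z = 0))"
      using f classical_third_derivative[OF j ab] by auto
  qed
qed

end

section \<open>Coordinates in the adapted basis\<close>

lemma span_image_finite:
  assumes "finite L" "x \<in> vec.span (g ` L)"
  shows "\<exists>q. x = (\<Sum>w\<in>L. q w *s g w)"
proof -
  let ?S = "{\<Sum>w\<in>L. q w *s g w | q. True}"
  have "vec.subspace ?S"
  proof (rule vec.subspaceI)
    show "0 \<in> ?S" by (auto intro!: exI[of _ "\<lambda>_. 0"])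
    fix x y assume "x \<in> ?S" "y \<in> ?S"
    then obtain q r where "x = (\<Sum>w\<in>L. q w *s g w)" "y = (\<Sum>w\<in>L. r w *s g w)" by auto
    then have "x + y = (\<Sum>w\<in>L. (q w + r w) *s g w)" by (simp add: vec.scale_left_distrib sum.distrib)
    then show "x + y \<in> ?S" by (auto intro!: exI[of _ "\<lambda>w. q w + r w"])
  next
    fix c x assume "x \<in> ?S"
    then obtain q where "x = (\<Sum>w\<in>L. q w *s g w)" by auto
    then have "c *s x = (\<Sum>w\<in>L. (c * q w) *s g w)" by (simp add: vec.scale_sum_right)
    then show "c *s x \<in> ?S" by (auto intro!: exI[of _ "\<lambda>w. c * q w"])
  qed
  moreover have "g ` L \<subseteq> ?S"
  proof
    fix y assume "y \<in> g ` L"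
    then obtain v where v: "v \<in> L" "y = g v" by auto
    have "g v = (\<Sum>w\<in>L. (if w = v then 1 else 0) *s g w)"
      using v assms(1) by (simp add: if_distrib[of "\<lambda>c. c *s _"] cong: if_cong)
    then show "y \<in> ?S" using v(2) by (auto intro!: exI[of _ "\<lambda>w. if w = v then 1 else 0"])
  qed
  ultimately have "vec.span (g ` L) \<subseteq> ?S" by (intro vec.span_minimal)
  then show ?thesis using assms(2) by auto
qed

context framed_module
begin

abbreviation iu :: 'n where "iu \<equiv> Min UNIV"

lemma T_iu: "T iu = e" and inj_T: "inj T" and indep_T: "vec.independent (range T)" and span_T: "vec.span (range T) = UNIV"
  using ab by (simp_all add: adapted_basis_def)

lemma coord_add: "coord T (x + y) a = coord T x a + coord T y a"
  and coord_scale: "coord T (c *s x) a = c * coord T x a"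
  unfolding coord_def using vec.representation_add[OF indep_T] vec.representation_scale[OF indep_T]
  by (simp_all add: span_T)

lemma coord_T: "coord T (T b) a = (if a = b then 1 else 0)"
  unfolding coord_def using vec.representation_basis[OF indep_T, of "T b"] by (auto dest: injD[OF inj_T])

lemma coord_zero: "coord T 0 a = 0" using coord_scale[of 0 0 a] by simp

lemma coord_sum: "coord T (\<Sum>i\<in>I. f i) a = (\<Sum>i\<in>I. coord T (f i) a)"
  by (induction I rule: infinite_finite_induct) (simp_all add: coord_zero coord_add)

definition \<tau> :: "'n cvec \<Rightarrow> 'n cvec" where "\<tau> v = (\<Sum>a\<in>UNIV. v $ a *s T a)"
definition cv :: "'n cvec \<Rightarrow> 'n cvec" where "cv v = (\<chi> a. coord T v a)"

lemma coord_tau: "coord T (\<tau> v) a = v $ a"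
  by (simp add: \<tau>_def coord_sum coord_scale coord_T delta_mult cong: if_cong)

lemma cv_tau [simp]: "cv (\<tau> v) = v" by (simp add: cv_def coord_tau vec_eq_iff)

lemma tau_cv [simp]: "\<tau> (cv v) = v"
proof -
  have "(\<Sum>b\<in>range T. vec.representation (range T) v b *s b) = v"
    using indep_T span_T by (intro vec.sum_representation_eq) auto
  then show ?thesis by (simp add: \<tau>_def cv_def coord_def sum.reindex[OF inj_T])
qed

lemma tau_linear: "\<tau> (x + y) = \<tau> x + \<tau> y" "\<tau> (c *s x) = c *s \<tau> x"
  by (simp_all add: \<tau>_def vec.scale_left_distrib sum.distrib vec.scale_sum_right)

lemma tau_clin: "clin \<tau>" by (simp add: clin_iff tau_linear)
lemma cv_clin: "clin cv" by (simp add: clin_iff cv_def vec_eq_iff coord_add coord_scale)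

lemma bij_tau: "bij \<tau>" by (rule bij_betw_byWitness[of _ cv]) auto

lemma tau_axis: "\<tau> (axis a 1) = T a"
  by (simp add: \<tau>_def axis_def if_distrib[of "\<lambda>c. c *s _"] cong: if_cong)

lemma cv_T: "cv (T a) = axis a 1" by (metis cv_tau tau_axis)

lemma degree_unique:
  assumes "v \<in> V a" "v \<in> V b" "v \<noteq> 0" shows "a = b"
proof -
  have zero: "V d = {0}" if "odd d \<or> 2 * k < d" for d using graded that unfolding graded_space_def by blast
  have even: "even a" "even b" "b \<le> 2 * k" using zero assms by (auto simp: not_le[symmetric])
  then obtain l m where lm: "a = 2 * l" "b = 2 * m" by (auto elim!: evenE)
  have m: "m \<le> k" using even(3) lm by simp
  define f where "f d = (if d = b then v else 0)" for d
  have "f (2 * l) = v"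
  proof (rule graded_space_part[OF graded])
    show "f d \<in> V d" for d using assms subspace_V by (simp add: f_def vec.subspace_0)
    have "(\<Sum>p\<le>k. f (2 * p)) = (\<Sum>p\<le>k. if p = m then v else 0)"
      by (intro sum.cong refl) (auto simp: f_def lm)
    then show "v = (\<Sum>p\<le>k. f (2 * p))" using m by simp
    show "v \<in> V (2 * l)" using assms lm by simp
  qed
  then show ?thesis using assms(3) lm by (auto simp: f_def split: if_splits)
qed

lemma T_nonzero: "T a \<noteq> 0" using coord_T[of a a] by (auto simp: coord_zero)

lemma e_deg: "e \<in> V 0"
proof -
  have "V 0 = vec.span {e}" using fm unfolding frobenius_module_def by blast
  then show ?thesis using vec.span_base[of e "{e}"] by simp
qed

lemma td_props: "td a \<le> 2 * k" "even (td a)"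
proof -
  have "V d = {0}" if "odd d \<or> 2 * k < d" for d using graded that unfolding graded_space_def by blast
  then show "td a \<le> 2 * k" "even (td a)" using T_deg[of a] T_nonzero[of a] by (metis not_le singletonD)+
qed

lemma td_zero_iff: "td a = 0 \<longleftrightarrow> a = iu"
proof
  assume "td a = 0"
  then have "T a \<in> V 0" using T_deg[of a] by simp
  moreover have "V 0 = vec.span {e}" using fm unfolding frobenius_module_def by blast
  ultimately obtain c where "T a = c *s e" by (auto simp: vec.span_singleton)
  then have "coord T (T a) a = c * coord T (T iu) a" by (simp add: coord_scale T_iu)
  then show "a = iu" by (auto simp: coord_T split: if_splits)
next
  assume "a = iu"
  then show "td a = 0" using degree_unique[OF T_deg[of iu], of 0] e_deg T_iu T_nonzero[of iu] by simp
qed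

sublocale grad: grading td k iu
  by unfold_locales (rule td_props td_zero_iff)+

text \<open>
  Grouping the expansion of \<open>v\<close> in the basis by degrees gives its decomposition into homogeneous
  components, which is unique.
\<close>
lemma coord_degree:
  assumes v: "v \<in> V d" and a: "td a \<noteq> d" shows "coord T v a = 0"
proof (cases "even d")
  case True
  then obtain l where d: "d = 2 * l" by (auto elim!: evenE)
  define f where "f d' = (\<Sum>a | td a = d'. coord T v a *s T a)" for d'
  have fd: "f d = v"
    unfolding d
  proof (rule graded_space_part[OF graded])
    show "f d' \<in> V d'" for d'
      unfolding f_def
      by (intro vec.subspace_sum[OF subspace_V] vec.subspace_scale[OF subspace_V]) (use T_deg in auto)
    have "v = (\<Sum>a\<in>UNIV. coord T v a *s T a)" using tau_cv[of v] by (simp add: \<tau>_def cv_def)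
    also have "\<dots> = (\<Sum>p\<in>{..k}. \<Sum>a | a \<in> UNIV \<and> td a div 2 = p. coord T v a *s T a)"
    proof (rule sum.group[symmetric])
      show "(\<lambda>a. td a div 2) ` UNIV \<subseteq> {..k}"
      proof clarsimp
        show "td a div 2 \<le> k" for a using td_props(1)[of a] by linarith
      qed
    qed auto
    also have "\<dots> = (\<Sum>p\<le>k. f (2 * p))"
    proof (intro sum.cong refl)
      fix p
      have "{a. a \<in> UNIV \<and> td a div 2 = p} = {a. td a = 2 * p}" using td_props(2) by (auto elim!: evenE)
      then show "(\<Sum>a | a \<in> UNIV \<and> td a div 2 = p. coord T v a *s T a) = f (2 * p)" by (simp add: f_def)
    qed
    finally show "v = (\<Sum>p\<le>k. f (2 * p))" .
    show "v \<in> V (2 * l)" using v d by simp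
  qed
  have "coord T (f d) a = (\<Sum>b | td b = d. coord T v b * (if a = b then 1 else 0))"
    by (simp add: f_def coord_sum coord_scale coord_T)
  also have "\<dots> = 0" using a by (intro sum.neutral) auto
  finally show ?thesis by (simp add: fd)
next
  case False
  then have "V d = {0}" using graded unfolding graded_space_def by blast
  then show ?thesis using v by (simp add: coord_zero)
qed

lemma tau_degree: "(\<And>a. td a \<noteq> d \<Longrightarrow> u $ a = 0) \<Longrightarrow> \<tau> u \<in> V d"
proof -
  assume u: "\<And>a. td a \<noteq> d \<Longrightarrow> u $ a = 0"
  have "u $ a *s T a \<in> V d" for a
    using T_deg[of a] u[of a] subspace_V[of d] by (cases "td a = d") (auto simp: vec.subspace_0 intro: vec.subspace_scale)
  then show ?thesis unfolding \<tau>_def by (intro vec.subspace_sum[OF subspace_V])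
qed

lemma V2_expand: assumes "w \<in> V 2" shows "w = (\<Sum>j\<in>grad.J. coord T w j *s T j)"
proof -
  have "w = (\<Sum>a\<in>UNIV. coord T w a *s T a)" using tau_cv[of w] by (simp add: \<tau>_def cv_def)
  also have "\<dots> = (\<Sum>j\<in>grad.J. coord T w j *s T j)"
    by (rule sum.mono_neutral_right) (use coord_degree[OF assms] in \<open>auto simp: grad.J_iff\<close>)
  finally show ?thesis .
qed

lemma B_sum_left: "B (\<Sum>i\<in>I. f i) v = (\<Sum>i\<in>I. B (f i) v)" and B_sum_right: "B v (\<Sum>i\<in>I. f i) = (\<Sum>i\<in>I. B v (f i))"
proof -
  have z: "B 0 v = 0" "B v 0 = 0" for v using B_lin(2)[of 0 0] B_lin(4)[of _ 0 0] by simp_all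
  show "B (\<Sum>i\<in>I. f i) v = (\<Sum>i\<in>I. B (f i) v)" "B v (\<Sum>i\<in>I. f i) = (\<Sum>i\<in>I. B v (f i))"
    by (induction I rule: infinite_finite_induct) (simp_all add: B_lin z)
qed

lemma B_TT: "B (T a) (T b) = (if b = \<delta> a then 1 else 0)"
  using B_T[of "\<delta> a" b] by (auto simp: delta_delta)

lemma B_tau: "B (\<tau> u) (\<tau> v) = (\<Sum>a\<in>UNIV. u $ a * v $ \<delta> a)"
proof -
  have "B (\<tau> u) (\<tau> v) = (\<Sum>a\<in>UNIV. u $ a * (\<Sum>b\<in>UNIV. v $ b * B (T a) (T b)))"
    unfolding \<tau>_def B_sum_left B_lin by (simp only: B_sum_right B_lin)
  then show ?thesis by (simp add: B_TT delta_mult cong: if_cong)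
qed

lemma coord_as_pairing: "coord T v c = B v (T (\<delta> c))"
proof -
  have "B (\<tau> (cv v)) (\<tau> (axis (\<delta> c) 1)) = (\<Sum>a\<in>UNIV. cv v $ a * (if a = c then 1 else 0))"
    unfolding B_tau
  proof (intro sum.cong refl)
    fix a
    have "\<delta> a = \<delta> c \<longleftrightarrow> a = c" by (metis delta_delta)
    then show "cv v $ a * axis (\<delta> c) 1 $ \<delta> a = cv v $ a * (if a = c then 1 else 0)" by (simp add: axis_def)
  qed
  moreover have "cv v $ a = coord T v a" for a by (simp add: cv_def)
  ultimately show ?thesis by (simp add: tau_axis delta_mult cong: if_cong)
qed

section \<open>Generation of the classical module by words\<close>

definition classical_op :: "'n \<Rightarrow> 'n op" where
  "classical_op j = Op (\<lambda>c a. if td c = td a + 2 then yukawa j a (\<delta> c) else 0)"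

lemma fm_sym: "sym_module V act" using fm unfolding frobenius_module_def by (elim conjE)

lemma fm_action: "commuting_action (V 2) act" by (rule frobenius_module_action[OF fm])

lemma tau_classical_op:
  assumes "j \<in> grad.J" shows "\<tau> (app (classical_op j) u) = act (T j) (\<tau> u)"
proof -
  have j: "T j \<in> V 2" using assms T_deg[of j] by (simp add: grad.J_iff)
  have lin: "clin (act (T j))" using commuting_action.act_clin[OF fm_action j] .
  have entry: "entry (classical_op j) c a = coord T (act (T j) (T a)) c" for c a
  proof -
    have "act (T j) (T a) \<in> V (td a + 2)" using fm_sym j T_deg[of a] unfolding sym_module_def by blast
    then show ?thesis using coord_degree[of _ "td a + 2" c] by (simp add: classical_op_def coord_as_pairing yukawa_def)
  qed
  have eq: "act (T j) (\<tau> u) = (\<Sum>a\<in>UNIV. u $ a *s act (T j) (T a))"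
    by (simp add: \<tau>_def clin_sum[OF lin] clinD[OF lin])
  have "coord T (act (T j) (\<tau> u)) c = app (classical_op j) u $ c" for c
    unfolding eq by (simp add: app_nth entry coord_sum coord_scale mult.commute)
  then have "cv (act (T j) (\<tau> u)) = app (classical_op j) u" by (simp add: vec_eq_iff cv_def)
  then show ?thesis by (metis tau_cv)
qed

lemma word_span:
  assumes "set ws \<subseteq> V 2"
  shows "foldr act ws e \<in> vec.span ((\<lambda>js. \<tau> (app (grad.wprod classical_op js) (axis iu 1))) ` {js. set js \<subseteq> grad.J \<and> length js = length ws})"
    (is "_ \<in> vec.span (?g ` ?L (length ws))")
  using assms
proof (induction ws)
  case Nil
  have "e = ?g []" by (simp add: app_simps tau_axis T_iu)
  then show ?case by (auto intro!: vec.span_base)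
next
  case (Cons w ws)
  let ?W = "vec.span (?g ` ?L (length (w # ws)))"
  have step: "act (T j) x \<in> ?W" if j: "j \<in> grad.J" and x: "x \<in> vec.span (?g ` ?L (length ws))" for j x
    using x
  proof (induction rule: vec.span_induct_alt)
    case base
    have "T j \<in> V 2" using j T_deg[of j] by (simp add: grad.J_iff)
    then show ?case using clinD(3)[OF commuting_action.act_clin[OF fm_action]] vec.span_zero by simp
  next
    case (step c x y)
    have "T j \<in> V 2" using j T_deg[of j] by (simp add: grad.J_iff)
    note lin = clinD[OF commuting_action.act_clin[OF fm_action this]]
    obtain js where js: "js \<in> ?L (length ws)" "x = ?g js" using step by auto
    have "act (T j) x = ?g (j # js)" using j by (simp add: js app_simps tau_classical_op)
    moreover have "?g (j # js) \<in> ?W" by (intro vec.span_base imageI) (use js j in simp)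
    ultimately have "act (T j) x \<in> ?W" by simp
    then show ?case using step by (simp add: lin vec.span_add vec.span_scale)
  qed
  have w: "w \<in> V 2" "set ws \<subseteq> V 2" using Cons.prems by auto
  let ?x = "foldr act ws e"
  have lin1: "act (\<Sum>j\<in>I. c j *s T j) ?x = (\<Sum>j\<in>I. c j *s act (T j) ?x)" if "I \<subseteq> grad.J" for I c
  proof -
    note sm = fm_sym
    have mem: "(\<Sum>j\<in>I. c j *s T j) \<in> V 2" if "I \<subseteq> grad.J" for I
      by (intro vec.subspace_sum[OF subspace_V] vec.subspace_scale[OF subspace_V]) (use that T_2 grad.J_iff in blast)
    have z: "act 0 ?x = 0"
    proof -
      have "act (0 *s e') ?x = 0 *s act e' ?x" if "e' \<in> V 2" for e' using sm that unfolding sym_module_def by blast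
      then show ?thesis using w(1) by (metis vec.scale_zero_left)
    qed
    have "finite I" by simp
    then show ?thesis using that
    proof (induction I)
      case (insert j I)
      then have "T j \<in> V 2" using T_deg[of j] by (simp add: grad.J_iff)
      then have "act (c j *s T j + (\<Sum>j\<in>I. c j *s T j)) ?x = act (c j *s T j) ?x + act (\<Sum>j\<in>I. c j *s T j) ?x"
        using sm mem[of I] insert.prems vec.subspace_scale[OF subspace_V] unfolding sym_module_def by blast
      moreover have "act (c j *s T j) ?x = c j *s act (T j) ?x"
        using sm \<open>T j \<in> V 2\<close> unfolding sym_module_def by blast
      ultimately show ?case using insert by simp
    qed (simp add: z)
  qed
  have "act w ?x = (\<Sum>j\<in>grad.J. coord T w j *s act (T j) ?x)"
    using lin1[of grad.J "coord T w"] V2_expand[OF w(1)] by simp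
  also have "\<dots> \<in> ?W" by (intro vec.span_sum vec.span_scale step Cons.IH w)
  finally show ?case by simp
qed

text \<open>
  Only words of the right length contribute to the component of degree \<open>td a\<close>, and by multilinearity the letters may
  be taken from the basis of \<open>V 2\<close>.  The conclusion says that the frame of the classical operators is the identity.
\<close>
lemma generating_words:
  assumes gen: "generated_by (V 2) act e"
  shows "\<exists>p. \<forall>a c. (\<Sum>ws\<in>grad.wordset a. p a ws * entry (grad.wprod classical_op ws) c iu) = (if c = a then 1 else 0)"
proof -
  have "\<exists>q. \<forall>c. (\<Sum>ws\<in>grad.wordset a. q ws * entry (grad.wprod classical_op ws) c iu) = (if c = a then 1 else 0)" for a
  proof -
    let ?g = "\<lambda>js. \<tau> (app (grad.wprod classical_op js) (axis iu 1))"
    interpret act: commuting_action "V 2" act by (rule fm_action)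
    obtain P where P: "words_over (V 2) P" "words_act act P e = T a" using gen unfolding generated_by_def by blast
    define P' where "P' = filter (\<lambda>(c, ws). length ws = td a div 2) P"
    have "2 * (td a div 2) = td a" using td_props(2) by simp
    then have "words_act act P e \<in> V (2 * (td a div 2))" using P(2) T_deg[of a] by simp
    from words_homogeneous_part[OF fm P(1) this] have Ta: "words_act act P' e = T a" by (simp add: P'_def P(2))
    have fin: "finite (grad.wordset a)"
      unfolding grad.wordset_def by (intro finite_lists_length_eq) simp
    have span: "words_act act R e \<in> vec.span (?g ` grad.wordset a)"
      if "\<forall>(c, ws)\<in>set R. set ws \<subseteq> V 2 \<and> length ws = td a div 2" for R
      using that
    proof (induction R)
      case Nil
      then show ?case by (simp add: act.words_act_Nil vec.span_zero)
    next
      case (Cons x R)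
      obtain c ws where x: "x = (c, ws)" by (cases x)
      then have "foldr act ws e \<in> vec.span (?g ` grad.wordset a)"
        using Cons.prems word_span[of ws] by (simp add: grad.wordset_def)
      then show ?case using Cons by (simp add: x act.words_act_Cons vec.span_add vec.span_scale)
    qed
    have "\<forall>(c, ws)\<in>set P'. set ws \<subseteq> V 2 \<and> length ws = td a div 2"
      using P(1) by (auto simp: P'_def words_over_def)
    from span[OF this] have "T a \<in> vec.span (?g ` grad.wordset a)" by (simp only: Ta)
    then obtain q where q: "T a = (\<Sum>ws\<in>grad.wordset a. q ws *s ?g ws)" using span_image_finite[OF fin] by blast
    have "coord T (T a) c = (\<Sum>ws\<in>grad.wordset a. q ws * entry (grad.wprod classical_op ws) c iu)" for c
      unfolding q by (simp add: coord_sum coord_scale coord_tau app_axis)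
    then have "\<forall>c. (\<Sum>ws\<in>grad.wordset a. q ws * entry (grad.wprod classical_op ws) c iu) = (if c = a then 1 else 0)"
      by (simp add: coord_T)
    then show ?thesis by blast
  qed
  then show ?thesis by metis
qed

end

section \<open>Operators of the quantum module\<close>

locale quantum_module = framed_module k V B e act td T \<delta>
  for k and V :: "nat \<Rightarrow> 'n::{finite,linorder} cvec set" and B e act td T \<delta> +
  fixes \<phi> :: "'n cvec \<Rightarrow> complex" and \<rho> :: real
  assumes rho: "0 < \<rho>" and phi_holo: "holo_on \<phi> (zdom td \<rho>)"
    and third: "\<And>j a b. td j = 2 \<Longrightarrow> td a + td b + 2 = 2 * k \<Longrightarrow>
       \<exists>f. qfun td \<rho> f \<and> (\<forall>z\<in>zdom td \<rho>. pd j (pd a (pd b \<phi>)) z = yukawa j a b + f z \<and> (td a = 0 \<longrightarrow> f z = 0))"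
    and big_k: "\<And>z. 3 < k \<Longrightarrow> z \<in> zdom td \<rho> \<Longrightarrow> frobenius_module k V B e (quantum_act_z td T \<delta> \<phi> z)"
begin

abbreviation "Z \<equiv> zdom td \<rho>"

definition F :: "'n \<Rightarrow> 'n \<Rightarrow> 'n \<Rightarrow> 'n cvec \<Rightarrow> complex" where "F j a b = pd j (pd a (pd b \<phi>))"

definition Q :: "'n \<Rightarrow> 'n cvec \<Rightarrow> 'n op" where
  "Q j z = Op (\<lambda>c a. if td c = td a + 2 then F j a (\<delta> c) z else 0)"

lemma F_holo: "holo_on (F j a b) Z"
  unfolding F_def by (intro holo_on_partial phi_holo open_zdom)

lemma F_swap: "z \<in> Z \<Longrightarrow> F j a b z = F a j b z"
  unfolding F_def by (rule pd_commute[OF holo_on_partial[OF phi_holo open_zdom] open_zdom])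

lemma F_sym: "z \<in> Z \<Longrightarrow> F j a b z = F j b a z"
  unfolding F_def by (rule pd_cong[OF open_zdom], assumption, rule pd_commute[OF phi_holo open_zdom])

lemma Q_sum: "td c = td a + 2 \<Longrightarrow> td a + td (\<delta> c) + 2 = 2 * k"
  using td_delta[of c] by simp

lemma Q_unit: assumes j: "j \<in> grad.J" and z: "z \<in> Z" shows "entry (Q j z) c iu = (if c = j then 1 else 0)"
proof (cases "td c = 2")
  case True
  have jj: "td j = 2" using j by (simp add: grad.J_iff)
  have "F j iu (\<delta> c) z = yukawa j iu (\<delta> c)"
    using third[of j iu "\<delta> c"] jj z Q_sum[of c iu] True by (auto simp: F_def)
  also have "\<dots> = coord T (act (T j) e) c" by (simp add: yukawa_def coord_as_pairing T_iu)
  also have "act (T j) e = T j" using fm T_2[OF jj] unfolding frobenius_module_def by blast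
  finally show ?thesis using True by (simp add: Q_def coord_T)
next
  case False
  then show ?thesis using j by (auto simp: Q_def grad.J_iff)
qed

lemma Q_adj: assumes z: "z \<in> Z" shows "entry (Q j z) (\<delta> a) (\<delta> c) = entry (Q j z) c a"
proof -
  have "td (\<delta> a) = td (\<delta> c) + 2 \<longleftrightarrow> td c = td a + 2" using td_delta[of a] td_delta[of c] by linarith
  then show ?thesis by (simp add: Q_def delta_delta F_sym[OF z, of j a])
qed

lemma Q_deg: "entry (Q j z) c a \<noteq> 0 \<Longrightarrow> td c = td a + 2" by (simp add: Q_def split: if_splits)

lemma quantum_act_z_tau:
  "quantum_act_z td T \<delta> \<phi> z w v = (\<Sum>j\<in>grad.J. coord T w j *s \<tau> (app (Q j z) (cv v)))"
proof -
  have basis: "quantum_act_basis td T \<delta> \<phi> z j a = \<tau> (\<chi> c. entry (Q j z) c a)" for j a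
    unfolding quantum_act_basis_def \<tau>_def
    by (rule sum.mono_neutral_cong_left) (auto simp: Q_def F_def)
  have "app (Q j z) (cv v) = (\<Sum>a\<in>UNIV. coord T v a *s (\<chi> c. entry (Q j z) c a))" for j
    by (simp add: vec_eq_iff app_nth cv_def mult.commute)
  then have "\<tau> (app (Q j z) (cv v)) = (\<Sum>a\<in>UNIV. coord T v a *s quantum_act_basis td T \<delta> \<phi> z j a)" for j
    by (simp add: basis clin_sum[OF tau_clin] tau_linear)
  then show ?thesis
    unfolding quantum_act_z_def grad.J_def by (simp add: vec.scale_sum_right vec.scale_scale)
qed

lemma quantum_act_z_basis:
  assumes "j \<in> grad.J" shows "quantum_act_z td T \<delta> \<phi> z (T j) (\<tau> u) = \<tau> (app (Q j z) u)"
  using assms unfolding quantum_act_z_tau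
  by (simp add: coord_T if_distrib[of "\<lambda>c. c *s _"] cong: if_cong)

lemma op_eq_tauI: "(\<And>u. \<tau> (app X u) = \<tau> (app Y u)) \<Longrightarrow> X = Y"
  by (rule op_eqI) (metis app_axis cv_tau)

text \<open>
  For \<open>k > 3\<close> this is part of the definition of a quantum potential.  For \<open>k \<le> 3\<close> a product of two of
  the operators either starts in degree 0 or ends in degree \<open>2 * k\<close>.  In the first case it is
  computed from \<open>Q j e = T j\<close> and the symmetry of third derivatives; the second case is adjoint to the first.
\<close>
lemma Q_comm: assumes i: "i \<in> grad.J" and j: "j \<in> grad.J" and z: "z \<in> Z" shows "Q i z * Q j z = Q j z * Q i z"
proof (cases "3 < k")
  case True
  have "T i \<in> V 2" "T j \<in> V 2" using i j T_deg[of i] T_deg[of j] by (simp_all add: grad.J_iff)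
  then have c: "quantum_act_z td T \<delta> \<phi> z (T i) (quantum_act_z td T \<delta> \<phi> z (T j) v)
      = quantum_act_z td T \<delta> \<phi> z (T j) (quantum_act_z td T \<delta> \<phi> z (T i) v)" for v
    using big_k[OF True z] unfolding frobenius_module_def sym_module_def by blast
  show ?thesis
    by (rule op_eq_tauI) (use c[of "\<tau> _"] in \<open>simp add: app_simps quantum_act_z_basis i j\<close>)
next
  case False
  have half: "entry (Q i z * Q j z) c a = entry (Q j z * Q i z) c a"
    if a: "td a = 0 \<or> td c = 2 * k" and i: "i \<in> grad.J" and j: "j \<in> grad.J" for a c i j
  proof -
    have col: "entry (Q i z * Q j z) c iu = entry (Q i z) c j" if "i \<in> grad.J" "j \<in> grad.J" for i j c
      using that z by (simp add: entry_mult Q_unit delta_mult cong: if_cong)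
    have swap: "entry (Q i z) c j = entry (Q j z) c i" if "i \<in> grad.J" "j \<in> grad.J" for c i j
      using that F_swap[OF z, of i j] by (simp add: Q_def grad.J_iff)
    show ?thesis
    proof (cases "td a = 0")
      case True
      then have "a = iu" using td_zero_iff by simp
      then show ?thesis using col[OF i j] col[OF j i] swap[OF i j] by simp
    next
      case False
      then have "td (\<delta> c) = 0" using a td_delta[of c] by simp
      then have c: "\<delta> c = iu" using td_zero_iff by simp
      have row: "entry (Q i z * Q j z) c a = entry (Q j z) (\<delta> a) i" if "i \<in> grad.J" "j \<in> grad.J" for i j
      proof -
        have "entry (Q i z) c b = (if \<delta> b = i then 1 else 0)" for b
          using Q_adj[OF z, of i b c] Q_unit[OF that(1) z, of "\<delta> b"] c by simp
        moreover have "\<delta> b = i \<longleftrightarrow> b = \<delta> i" for b by (metis delta_delta)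
        ultimately have "entry (Q i z * Q j z) c a = entry (Q j z) (\<delta> i) a"
          by (simp add: entry_mult delta_mult cong: if_cong)
        then show ?thesis using Q_adj[OF z, of j i "\<delta> a"] by (simp add: delta_delta)
      qed
      show ?thesis using row[OF i j] row[OF j i] swap[OF i j] by simp
    qed
  qed
  show ?thesis
  proof (rule op_eqI)
    fix c a
    show "entry (Q i z * Q j z) c a = entry (Q j z * Q i z) c a"
    proof (cases "td a = 0 \<or> td c = 2 * k")
      case True
      then show ?thesis by (rule half[OF _ i j])
    next
      case no: False
      have "entry (Q i z * Q j z) c a = 0" for i j
        unfolding entry_mult
      proof (intro sum.neutral ballI)
        fix b
        show "entry (Q i z) c b * entry (Q j z) b a = 0"
        proof (rule ccontr)
          assume "entry (Q i z) c b * entry (Q j z) b a \<noteq> 0"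
          then have "td c = td b + 2" "td b = td a + 2" using Q_deg by auto
          then show False using no False td_props[of a] td_props[of c] by (auto elim!: evenE)
        qed
      qed
      then show ?thesis by simp
    qed
  qed
qed

definition Qw :: "'n cvec \<Rightarrow> 'n cvec \<Rightarrow> 'n op" where "Qw z w = (\<Sum>j\<in>grad.J. sc (coord T w j) (Q j z))"

lemma quantum_act_z_Qw: "quantum_act_z td T \<delta> \<phi> z w v = \<tau> (app (Qw z w) (cv v))"
  by (simp add: quantum_act_z_tau Qw_def app_sum app_simps clin_sum[OF tau_clin] tau_linear)

theorem quantum_frobenius_module:
  assumes z: "z \<in> Z" shows "frobenius_module k V B e (quantum_act_z td T \<delta> \<phi> z)"
proof -
  have lin: "Qw z (w + w') = Qw z w + Qw z w'" "Qw z (c *s w) = sc c (Qw z w)" for w w' c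
    by (rule op_eqI; simp add: Qw_def coord_add coord_scale algebra_simps sum.distrib sum_distrib_left)+
  have comm: "Qw z w * Qw z w' = Qw z w' * Qw z w" for w w'
  proof -
    have prod: "Qw z w * Qw z w' = (\<Sum>i\<in>grad.J. \<Sum>j\<in>grad.J. sc (coord T w i * coord T w' j) (Q i z * Q j z))" for w w'
      by (simp add: Qw_def sum_product sc_mult_left sc_mult_right sc_sc mult.commute)
    have "Qw z w * Qw z w' = (\<Sum>j\<in>grad.J. \<Sum>i\<in>grad.J. sc (coord T w i * coord T w' j) (Q i z * Q j z))"
      unfolding prod by (rule sum.swap)
    also have "\<dots> = (\<Sum>j\<in>grad.J. \<Sum>i\<in>grad.J. sc (coord T w' j * coord T w i) (Q j z * Q i z))"
      by (intro sum.cong refl) (simp only: Q_comm[OF _ _ z] mult.commute)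
    finally show ?thesis unfolding prod[of w' w] .
  qed
  have "sym_module V (quantum_act_z td T \<delta> \<phi> z)"
    unfolding sym_module_def quantum_act_z_Qw
  proof (intro conjI ballI allI)
    show "clin (\<lambda>v. \<tau> (app (Qw z w) (cv v)))" for w
      using cv_clin by (simp add: clin_iff app_simps tau_linear)
    show "\<tau> (app (Qw z (w + w')) (cv v)) = \<tau> (app (Qw z w) (cv v)) + \<tau> (app (Qw z w') (cv v))" for w w' v
      by (simp add: lin app_simps tau_linear)
    show "\<tau> (app (Qw z (c *s w)) (cv v)) = c *s \<tau> (app (Qw z w) (cv v))" for c w v
      by (simp add: lin app_simps tau_linear)
    show "\<tau> (app (Qw z w) (cv (\<tau> (app (Qw z w') (cv v))))) = \<tau> (app (Qw z w') (cv (\<tau> (app (Qw z w) (cv v)))))" for w w' v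
      by (simp add: comm flip: app_simps(7))
    fix w d v assume v: "v \<in> V d"
    show "\<tau> (app (Qw z w) (cv v)) \<in> V (d + 2)"
    proof (rule tau_degree)
      fix c assume c: "td c \<noteq> d + 2"
      have "entry (Qw z w) c b * cv v $ b = 0" for b
      proof (cases "td b = d")
        case True
        then have "entry (Q j z) c b = 0" for j using c by (auto simp: Q_def)
        then show ?thesis by (simp add: Qw_def)
      next
        case False
        then show ?thesis using coord_degree[OF v] by (simp add: cv_def)
      qed
      then show "app (Qw z w) (cv v) $ c = 0" unfolding app_nth by (intro sum.neutral) blast
    qed
  qed
  moreover have "B (\<tau> (app (Qw z w) (cv u))) v = B u (\<tau> (app (Qw z w) (cv v)))" for w u v
  proof -
    have X: "entry (Qw z w) (\<delta> a) (\<delta> b) = entry (Qw z w) b a" for a b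
      by (simp add: Qw_def Q_adj[OF z])
    have bij: "bij \<delta>" using delta_delta by (metis bijI')
    have "B (\<tau> (cv u)) (\<tau> (app (Qw z w) (cv v))) = (\<Sum>b\<in>UNIV. \<Sum>c\<in>UNIV. cv u $ b * (entry (Qw z w) (\<delta> b) c * cv v $ c))"
      by (simp only: B_tau app_nth sum_distrib_left)
    also have "\<dots> = (\<Sum>b\<in>UNIV. \<Sum>a\<in>UNIV. cv u $ b * (entry (Qw z w) (\<delta> b) (\<delta> a) * cv v $ \<delta> a))"
      using sum.reindex_bij_betw[OF bij, of "\<lambda>c. cv u $ _ * (entry (Qw z w) (\<delta> _) c * cv v $ c)"] by simp
    also have "\<dots> = (\<Sum>b\<in>UNIV. \<Sum>a\<in>UNIV. entry (Qw z w) a b * cv u $ b * cv v $ \<delta> a)"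
      by (simp add: X algebra_simps)
    also have "\<dots> = B (\<tau> (app (Qw z w) (cv u))) (\<tau> (cv v))"
      by (subst sum.swap) (simp only: B_tau app_nth sum_distrib_right)
    finally show ?thesis by simp
  qed
  moreover have "\<tau> (app (Qw z w) (cv e)) = w" if w: "w \<in> V 2" for w
  proof -
    have cve: "cv e = axis iu 1" using cv_T[of iu] by (simp add: T_iu)
    have "app (Q j z) (cv e) = axis j 1" if "j \<in> grad.J" for j
    proof -
      have "app (Q j z) (cv e) $ c = (if c = j then 1 else 0)" for c
        by (simp add: cve app_axis Q_unit[OF that z])
      then show ?thesis by (simp add: vec_eq_iff axis_def)
    qed
    then have "\<tau> (app (Qw z w) (cv e)) = (\<Sum>j\<in>grad.J. coord T w j *s T j)"
      by (simp add: Qw_def app_sum app_simps clin_sum[OF tau_clin] tau_linear tau_axis)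
    then show ?thesis using V2_expand[OF w] by simp
  qed
  ultimately show ?thesis
    using fm unfolding frobenius_module_def quantum_act_z_Qw by blast
qed

lemma Q_holo: "holo_op (Q j) Z"
  unfolding holo_op_def
proof (intro allI)
  fix c a
  show "holo_on (\<lambda>z. entry (Q j z) c a) Z" 
    using F_holo[of j a "\<delta> c"] by (cases "td c = td a + 2") (simp_all add: Q_def holo_on_const)
qed

lemma Q_entry:
  assumes j: "j \<in> grad.J"
  obtains f where "qfun td \<rho> f" "\<And>z. z \<in> Z \<Longrightarrow> entry (Q j z) c a = entry (classical_op j) c a + f z"
proof (cases "td c = td a + 2")
  case True
  have "td j = 2" using j by (simp add: grad.J_iff)
  from third[OF this Q_sum[OF True]] that True show ?thesis
    by (auto simp: Q_def classical_op_def F_def)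
next
  case False
  then show ?thesis using that[OF qfun_zero[OF rho]] by (simp add: Q_def classical_op_def)
qed

lemma Q_const: assumes j: "j \<in> grad.J" and z: "z \<in> Z" and i: "i \<notin> grad.J" shows "pdo i (Q j) z = 0"
proof (rule op_eqI)
  fix c a
  obtain f where f: "qfun td \<rho> f" "\<And>z. z \<in> Z \<Longrightarrow> entry (Q j z) c a = entry (classical_op j) c a + f z"
    using Q_entry[OF j] by blast
  have fh: "holo_on f Z" using f(1) by (simp add: qfun_def)
  have "pd i (\<lambda>z. entry (Q j z) c a) z = pd i (\<lambda>z. entry (classical_op j) c a + f z) z"
    by (rule pd_cong[OF open_zdom z]) (rule f(2))
  also have "\<dots> = 0"
    using pd_add[OF holo_on_const fh open_zdom z] qfun_pd_zero[OF f(1) _ z, of i] i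
    by (simp add: pd_const grad.J_iff)
  finally show "entry (pdo i (Q j) z) c a = entry 0 c a" by (simp add: pdo_def)
qed

lemma Q_closed: assumes z: "z \<in> Z" shows "pdo i (Q j) z = pdo j (Q i) z"
proof (rule op_eqI)
  fix c a
  show "entry (pdo i (Q j) z) c a = entry (pdo j (Q i) z) c a"
  proof (cases "td c = td a + 2")
    case True
    have "holo_on (pd a (pd (\<delta> c) \<phi>)) Z" by (intro holo_on_partial phi_holo open_zdom)
    from pd_commute[OF this open_zdom z, of i j] show ?thesis using True by (simp add: pdo_def Q_def F_def)
  qed (simp add: pdo_def Q_def pd_const)
qed

lemma Q_periodic: assumes j: "j \<in> grad.J" and "z \<in> Z" "z' \<in> Z" "qexp td z = qexp td z'" shows "Q j z = Q j z'"
proof (rule op_eqI)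
  fix c a
  obtain f where f: "qfun td \<rho> f" "\<And>z. z \<in> Z \<Longrightarrow> entry (Q j z) c a = entry (classical_op j) c a + f z"
    using Q_entry[OF j] by blast
  have "f z = f z'" using f(1) assms unfolding qfun_def by blast
  then show "entry (Q j z) c a = entry (Q j z') c a" using f(2) assms by simp
qed

text \<open>
  The filter of the limit \<open>q \<rightarrow> 0\<close>, in the \<open>z\<close>-space.
\<close>
definition q_to_zero :: "'n cvec filter" where
  "q_to_zero = (INF \<eta>\<in>{0<..}. principal (zdom td \<eta>))"

lemma eventually_q_to_zero: "eventually P q_to_zero \<longleftrightarrow> (\<exists>\<eta>>0. \<forall>z\<in>zdom td \<eta>. P z)"
proof -
  have "eventually P q_to_zero \<longleftrightarrow> (\<exists>\<eta>\<in>{0<..}. eventually P (principal (zdom td \<eta>)))"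
    unfolding q_to_zero_def
  proof (rule eventually_INF_base)
    fix a b :: real assume "a \<in> {0<..}" "b \<in> {0<..}"
    then show "\<exists>x\<in>{0<..}. principal (zdom td x) \<le> inf (principal (zdom td a)) (principal (zdom td b))"
      using zdom_mono[of "min a b" a td] zdom_mono[of "min a b" b td] by (intro bexI[of _ "min a b"]) auto
  qed auto
  then show ?thesis by (auto simp: eventually_principal)
qed

lemma Q_tendsto: assumes j: "j \<in> grad.J" shows "((\<lambda>z. entry (Q j z) c a) \<longlongrightarrow> entry (classical_op j) c a) q_to_zero"
proof -
  obtain f where f: "qfun td \<rho> f" "\<And>z. z \<in> Z \<Longrightarrow> entry (Q j z) c a = entry (classical_op j) c a + f z"
    using Q_entry[OF j] by blast
  have "(f \<longlongrightarrow> 0) q_to_zero"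
  proof (rule tendstoI)
    fix \<epsilon> :: real assume "0 < \<epsilon>"
    then have "0 < \<epsilon> / 2" by simp
    then obtain \<eta> where "\<eta> > 0" "\<forall>z\<in>zdom td \<eta>. norm (f z) \<le> \<epsilon> / 2" using f(1) unfolding qfun_def by blast
    then show "\<forall>\<^sub>F z in q_to_zero. dist (f z) 0 < \<epsilon>"
      unfolding eventually_q_to_zero using \<open>0 < \<epsilon>\<close> by (intro exI[of _ \<eta>]) (auto simp: dist_norm intro: le_less_trans)
  qed
  then have "((\<lambda>z. entry (classical_op j) c a + f z) \<longlongrightarrow> entry (classical_op j) c a + 0) q_to_zero"
    by (intro tendsto_intros)
  moreover have "\<forall>\<^sub>F z in q_to_zero. entry (classical_op j) c a + f z = entry (Q j z) c a"
    unfolding eventually_q_to_zero using f(2) rho by auto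
  ultimately show ?thesis by (simp add: tendsto_cong)
qed

lemma wprod_tendsto:
  "set ws \<subseteq> grad.J \<Longrightarrow> ((\<lambda>z. entry (grad.wprod (\<lambda>j. Q j z) ws) c a) \<longlongrightarrow> entry (grad.wprod classical_op ws) c a) q_to_zero"
  by (induction ws arbitrary: c) (auto simp: entry_mult intro!: tendsto_sum tendsto_mult Q_tendsto)

text \<open>
  In the limit \<open>q \<rightarrow> 0\<close> the frame of the quantum operators tends to that of the classical operators, which is
  the identity, so it stays invertible for small \<open>q\<close>.
\<close>
theorem higgs_field:
  assumes gen: "generated_by (V 2) act e"
  obtains p \<rho>' where "0 < \<rho>'" "\<rho>' \<le> \<rho>" "graded_higgs td k iu p \<delta> (zdom td \<rho>') Q"
proof -
  obtain p where p: "\<And>a c. (\<Sum>ws\<in>grad.wordset a. p a ws * entry (grad.wprod classical_op ws) c iu) = (if c = a then 1 else 0)"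
    using generating_words[OF gen] by blast
  interpret pus: word_polynomials td k iu p by unfold_locales
  have frame: "((\<lambda>z. entry (pus.frame (\<lambda>j. Q j z)) c a) \<longlongrightarrow> entry 1 c a) q_to_zero" for c a
  proof -
    have "((\<lambda>z. \<Sum>ws\<in>grad.wordset a. p a ws * entry (grad.wprod (\<lambda>j. Q j z) ws) c iu) \<longlongrightarrow>
        (\<Sum>ws\<in>grad.wordset a. p a ws * entry (grad.wprod classical_op ws) c iu)) q_to_zero"
      by (intro tendsto_sum tendsto_mult tendsto_const wprod_tendsto grad.wordset_length)
    then show ?thesis by (simp add: p pus.frame_def pus.pw_def entry_one)
  qed
  have "((\<lambda>z. op_det (pus.frame (\<lambda>j. Q j z))) \<longlongrightarrow> op_det (1 :: 'n op)) q_to_zero"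
    unfolding op_det_def det_def vec_lambda_beta
  by (intro tendsto_sum tendsto_mult tendsto_prod tendsto_const frame)
  moreover have "op_det (1 :: 'n op) \<noteq> 0" by (rule op_det_nonzero[of 1 1]) simp
  ultimately have "\<forall>\<^sub>F z in q_to_zero. op_det (pus.frame (\<lambda>j. Q j z)) \<noteq> 0"
    by (rule tendsto_imp_eventually_ne)
  then obtain \<eta> where \<eta>: "\<eta> > 0" "\<And>z. z \<in> zdom td \<eta> \<Longrightarrow> op_det (pus.frame (\<lambda>j. Q j z)) \<noteq> 0"
    unfolding eventually_q_to_zero by blast
  define \<rho>' where "\<rho>' = min \<eta> \<rho>"
  have sub: "zdom td \<rho>' \<subseteq> Z" "zdom td \<rho>' \<subseteq> zdom td \<eta>" unfolding \<rho>'_def by (intro zdom_mono; simp)+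
  have "graded_higgs td k iu p \<delta> (zdom td \<rho>') Q"
  proof
    show "open (zdom td \<rho>')" by (rule open_zdom)
    show "\<delta> (\<delta> a) = a" "td (\<delta> a) + td a = 2 * k" for a by (rule delta_delta, rule td_delta)
    show "holo_op (Q j) (zdom td \<rho>')" for j
      using Q_holo[of j] sub(1) by (auto simp: holo_op_def intro: holo_on_subset)
    show "entry (Q j z) c a \<noteq> 0 \<Longrightarrow> td c = td a + 2" for j z c a by (rule Q_deg)
    fix j z assume j: "j \<in> grad.J" and z: "z \<in> zdom td \<rho>'"
    then have z': "z \<in> Z" using sub by blast
    show "c \<notin> grad.J \<Longrightarrow> pdo c (Q j) z = 0" for c by (rule Q_const[OF j z'])
    show "i \<in> grad.J \<Longrightarrow> comm (Q i z) (Q j z) = 0" for i using Q_comm[OF _ j z'] by (simp add: comm_def)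
    show "pdo i (Q j) z = pdo j (Q i) z" for i by (rule Q_closed[OF z'])
    show "entry (Q j z) c iu = (if c = j then 1 else 0)" for c by (rule Q_unit[OF j z'])
    show "entry (Q j z) (\<delta> a) (\<delta> c) = entry (Q j z) c a" for a c by (rule Q_adj[OF z'])
  next
    show "op_det (pus.frame (\<lambda>j. Q j z)) \<noteq> 0" if "z \<in> zdom td \<rho>'" for z using \<eta>(2) sub that by blast
  qed
  from that[OF _ _ this] show thesis using \<eta>(1) rho by (simp add: \<rho>'_def)
qed

end

section \<open>A logarithmic chart of the q-space\<close>

lemma holo_on_relative_line:
  fixes f :: "'n::finite cvec \<Rightarrow> complex"
  assumes f: "holo_on f W" and W: "W = qspace td \<inter> O'" "open O'" and q: "q \<in> W" and j: "td j = 2"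
  shows "((\<lambda>t. f (q + t *s axis j 1)) has_field_derivative pd j f q) (at 0)"
proof -
  obtain D where D: "Vector_Spaces.linear (*s) (*) D" "(f has_derivative D) (at q within W)"
    using f q by (auto simp: holo_on_def)
  interpret D: Vector_Spaces.linear "(*s)" "(*)" D by (rule D(1))
  let ?l = "\<lambda>t. q + t *s axis j 1"
  have "\<forall>\<^sub>F t in nhds 0. ?l t \<in> O'"
    by (rule eventually_coordinate_line[OF W(2)]) (use q W in simp)
  then obtain U where U: "open U" "0 \<in> U" "\<And>t. t \<in> U \<Longrightarrow> ?l t \<in> O'" unfolding eventually_nhds by blast
  have "?l t \<in> qspace td" for t using q W j by (auto simp: qspace_def axis_def)
  then have sub: "?l ` U \<subseteq> W" using U(3) W(1) by auto
  have "(?l has_derivative (\<lambda>t. t *s axis j 1)) (at 0 within U)"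
    by (rule has_derivative_at_withinI[OF coordinate_line_has_derivative])
  moreover have "(f has_derivative D) (at (?l 0) within ?l ` U)"
    using has_derivative_subset[OF D(2) sub] by simp
  ultimately have "((\<lambda>t. f (?l t)) has_derivative (\<lambda>t. D (t *s axis j 1))) (at 0 within U)"
    by (rule has_derivative_in_compose)
  moreover have "(\<lambda>t. D (t *s axis j 1)) = (*) (D (axis j 1))" by (rule ext) (simp only: D.scale mult.commute)
  ultimately have "((\<lambda>t. f (?l t)) has_field_derivative D (axis j 1)) (at 0)"
    unfolding has_field_derivative_def by (simp only: at_within_open[OF U(2,1)])
  then show ?thesis by (simp add: pd_def DERIV_imp_deriv)
qed

text \<open>
  On a polydisc around \<open>s\<close> whose radius does not exceed the coordinates of \<open>s\<close>, the quotients of the coordinates of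
  \<open>q\<close> and \<open>s\<close> have positive real part.  Taking the principal logarithm of these quotients gives a
  holomorphic branch even if the principal branch is cut near \<open>s\<close>.
\<close>
locale logarithm_chart =
  fixes td :: "'n::finite \<Rightarrow> nat" and s :: "'n cvec" and \<eta> :: real
  assumes s: "s \<in> qspace td" and eta: "0 < \<eta>" "\<And>j. td j = 2 \<Longrightarrow> \<eta> \<le> cmod (s $ j)"
begin

definition box :: "'n cvec set" where "box = {q. \<forall>j\<in>{j. td j = 2}. cmod (q $ j - s $ j) < \<eta>}"
definition W :: "'n cvec set" where "W = qspace td \<inter> box"

definition log_at :: "'n cvec \<Rightarrow> 'n \<Rightarrow> complex" where
  "log_at q j = (Ln (q $ j / s $ j) + Ln (s $ j)) / (2 * of_real pi * \<i>)"

definition \<iota> :: "'n cvec \<Rightarrow> 'n cvec" where "\<iota> q = (\<chi> j. if td j = 2 then log_at q j else 0)"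

definition M :: "'n cvec set" where
  "M = {z. \<forall>j\<in>{j. td j = 2}. cmod (exp (2 * of_real pi * \<i> * z $ j) - s $ j) < \<eta> \<and>
          \<bar>Im (2 * of_real pi * \<i> * z $ j - Ln (s $ j))\<bar> < pi}"

lemma open_box: "open box"
proof -
  have "box = (\<Inter>j\<in>{j. td j = 2}. {q. cmod (q $ j - s $ j) < \<eta>})" by (auto simp: box_def)
  also have "open \<dots>" by (intro open_INT ballI open_Collect_less continuous_intros) auto
  finally show ?thesis .
qed

lemma open_M: "open M"
proof -
  have "M = (\<Inter>j\<in>{j. td j = 2}. {z. cmod (exp (2 * of_real pi * \<i> * z $ j) - s $ j) < \<eta>} \<inter>
      {z. \<bar>Im (2 * of_real pi * \<i> * z $ j - Ln (s $ j))\<bar> < pi})" by (auto simp: M_def)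
  also have "open \<dots>" by (intro open_INT ballI open_Int open_Collect_less continuous_intros) auto
  finally show ?thesis .
qed

lemma s_nonzero: "td j = 2 \<Longrightarrow> s $ j \<noteq> 0" using eta by force

lemma ratio:
  assumes "q \<in> W" "td j = 2"
  shows "0 < Re (q $ j / s $ j)" "q $ j / s $ j \<noteq> 0" "q $ j / s $ j \<notin> \<real>\<^sub>\<le>\<^sub>0" "q $ j \<noteq> 0"
proof -
  have "cmod (q $ j / s $ j - 1) = cmod (q $ j - s $ j) / cmod (s $ j)"
    using s_nonzero[OF assms(2)] by (simp add: diff_divide_distrib flip: norm_divide)
  also have "\<dots> < 1" using assms eta(2)[OF assms(2)] s_nonzero[OF assms(2)]
    by (auto simp: W_def box_def)
  finally have "cmod (q $ j / s $ j - 1) < 1" .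
  then have "\<bar>Re (q $ j / s $ j - 1)\<bar> < 1" using abs_Re_le_cmod order_le_less_trans by blast
  then show pos: "0 < Re (q $ j / s $ j)" by auto
  then show "q $ j / s $ j \<noteq> 0" "q $ j / s $ j \<notin> \<real>\<^sub>\<le>\<^sub>0" "q $ j \<noteq> 0" by (auto simp: complex_nonpos_Reals_iff)
qed

lemma exp_log_at: "q \<in> W \<Longrightarrow> td j = 2 \<Longrightarrow> exp (2 * of_real pi * \<i> * log_at q j) = q $ j"
  using ratio(2)[of q j] s_nonzero[of j] by (simp add: log_at_def exp_add)

lemma qexp_iota: assumes "q \<in> W" shows "qexp td (\<iota> q) = q"
proof -
  have "q $ a = 0" if "td a \<noteq> 2" for a using assms that by (auto simp: W_def qspace_def)
  then show ?thesis using exp_log_at[OF assms] by (simp add: vec_eq_iff qexp_def \<iota>_def)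
qed

lemma iota_in_M: assumes "q \<in> W" shows "\<iota> q \<in> M"
  unfolding M_def
proof (intro CollectI ballI conjI)
  fix j assume "j \<in> {j. td j = 2}"
  then have j: "td j = 2" by simp
  show "cmod (exp (2 * of_real pi * \<i> * \<iota> q $ j) - s $ j) < \<eta>"
    using assms j by (simp add: \<iota>_def exp_log_at W_def box_def)
  have "2 * of_real pi * \<i> * \<iota> q $ j - Ln (s $ j) = Ln (q $ j / s $ j)" by (simp add: \<iota>_def j log_at_def)
  moreover have "\<bar>Im (Ln (q $ j / s $ j))\<bar> < pi / 2"
    using Re_Ln_pos_lt ratio[OF assms j] by blast
  ultimately show "\<bar>Im (2 * of_real pi * \<i> * \<iota> q $ j - Ln (s $ j))\<bar> < pi" by simp
qed

lemma iota_qexp: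
  assumes z: "z \<in> M" "\<And>a. td a \<noteq> 2 \<Longrightarrow> z $ a = 0"
  shows "qexp td z \<in> W" "\<iota> (qexp td z) = z"
proof -
  show "qexp td z \<in> W" using z by (auto simp: W_def qspace_def box_def qexp_def M_def)
  have "log_at (qexp td z) j = z $ j" if j: "td j = 2" for j
  proof -
    let ?w = "2 * of_real pi * \<i> * z $ j"
    have "qexp td z $ j / s $ j = exp (?w - Ln (s $ j))"
      using j s_nonzero[OF j] by (simp add: qexp_def exp_diff)
    moreover have "Ln (exp (?w - Ln (s $ j))) = ?w - Ln (s $ j)"
      by (rule Ln_exp) (use z j in \<open>force simp: M_def\<close>)+
    ultimately show ?thesis by (simp add: log_at_def)
  qed
  then show "\<iota> (qexp td z) = z" using z(2) by (auto simp: vec_eq_iff \<iota>_def)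
qed

lemma iota_image: "\<iota> ` W = M \<inter> {z. \<forall>a. td a \<noteq> 2 \<longrightarrow> z $ a = 0}"
proof
  show "\<iota> ` W \<subseteq> M \<inter> {z. \<forall>a. td a \<noteq> 2 \<longrightarrow> z $ a = 0}" using iota_in_M by (auto simp: \<iota>_def)
  show "M \<inter> {z. \<forall>a. td a \<noteq> 2 \<longrightarrow> z $ a = 0} \<subseteq> \<iota> ` W"
  proof
    fix z assume "z \<in> M \<inter> {z. \<forall>a. td a \<noteq> 2 \<longrightarrow> z $ a = 0}"
    then have "qexp td z \<in> W" "\<iota> (qexp td z) = z" using iota_qexp by auto
    then show "z \<in> \<iota> ` W" by (metis imageI)
  qed
qed

lemma iota_derivative:
  assumes q: "q \<in> W"
  shows "((\<lambda>q. \<iota> q $ l) has_derivative (\<lambda>v. \<Sum>i\<in>UNIV. v $ i * (if i = l \<and> td l = 2 then 1 / (2 * of_real pi * \<i> * q $ l) else 0))) (at q)"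
proof (cases "td l = 2")
  case True
  let ?L = "\<lambda>w. (Ln (w / s $ l) + Ln (s $ l)) / (2 * of_real pi * \<i>)"
  have "(?L has_field_derivative 1 / (2 * of_real pi * \<i> * q $ l)) (at (q $ l))"
    using ratio[OF q True] s_nonzero[OF True]
    by (auto intro!: derivative_eq_intros simp: field_simps)
  then have "(?L has_derivative (*) (1 / (2 * of_real pi * \<i> * q $ l))) (at (q $ l))"
    by (simp add: has_field_derivative_def)
  from has_derivative_compose[OF bounded_linear_imp_has_derivative[OF bounded_linear_vec_nth] this]
  have "((\<lambda>x. ?L (x $ l)) has_derivative (\<lambda>v. 1 / (2 * of_real pi * \<i> * q $ l) * v $ l)) (at q)" .
  moreover have "(\<lambda>v::'n cvec. 1 / (2 * of_real pi * \<i> * q $ l) * v $ l) = (\<lambda>v. \<Sum>i\<in>UNIV. v $ i * (if i = l \<and> td l = 2 then 1 / (2 * of_real pi * \<i> * q $ l) else 0))"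
    using True by (simp add: fun_eq_iff if_distrib[of "(*) _"] cong: if_cong)
  ultimately show ?thesis using True by (simp add: \<iota>_def log_at_def)
qed (simp add: \<iota>_def)

lemma vholo_iota: "vholo_on \<iota> W"
  unfolding vholo_on_def
proof
  fix l
  show "holo_on (\<lambda>q. \<iota> q $ l) W"
    by (rule holo_onI[where d = "\<lambda>i q. if i = l \<and> td l = 2 then 1 / (2 * of_real pi * \<i> * q $ l) else 0"])
      (rule iota_derivative)
qed

lemma vpd_iota:
  assumes "q \<in> W" "td j = 2" shows "vpd j \<iota> q = (1 / (2 * of_real pi * \<i> * q $ j)) *s axis j 1"
proof -
  have "pd j (\<lambda>q. \<iota> q $ l) q = (if j = l \<and> td l = 2 then 1 / (2 * of_real pi * \<i> * q $ l) else 0)" for l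
    by (rule pd_eqI[OF iota_derivative[OF assms(1)]])
  then show ?thesis using assms(2) by (auto simp: vpd_def vec_eq_iff axis_def)
qed

lemma embedding: "closed_embedding_germ td W s M (\<iota> s) \<iota>"
  unfolding closed_embedding_germ_def
proof (intro conjI ballI impI)
  show "openin (top_of_set (qspace td)) W" unfolding W_def using open_box by (rule openin_open_Int)
  show sW: "s \<in> W" using s eta by (simp add: W_def box_def)
  show "\<iota> s = \<iota> s" ..
  show "vholo_on \<iota> W" by (rule vholo_iota)
  show "v = 0" if q: "q \<in> W" and v: "v \<in> qspace td" and z: "(\<Sum>j\<in>{j. td j = 2}. v $ j *s vpd j \<iota> q) = 0" for q v
  proof -
    have "v $ l = 0" for l
    proof (cases "td l = 2")
      case True
      have "(\<Sum>j\<in>{j. td j = 2}. v $ j *s vpd j \<iota> q) $ l = (\<Sum>j\<in>{j. td j = 2}. if j = l then v $ j / (2 * of_real pi * \<i> * q $ j) else 0)"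
        unfolding sum_component by (rule sum.cong) (auto simp: vpd_iota q axis_def)
      then have "v $ l / (2 * of_real pi * \<i> * q $ l) = 0" using z True by simp
      then show ?thesis using ratio(4)[OF q True] by simp
    qed (use v in \<open>simp add: qspace_def\<close>)
    then show ?thesis by (simp add: vec_eq_iff)
  qed
  have "homeomorphism W (\<iota> ` W) \<iota> (qexp td)"
  proof (rule homeomorphismI)
    show "continuous_on W \<iota>"
    proof (rule continuous_at_imp_continuous_on, rule ballI)
      fix q assume "q \<in> W"
      then have "isCont (\<lambda>q. \<iota> q $ l) q" for l by (rule has_derivative_continuous[OF iota_derivative])
      then show "isCont \<iota> q" unfolding isCont_def by (intro vec_tendstoI) auto
    qed
    have "continuous_on UNIV (\<lambda>z. qexp td z $ a)" for a
      unfolding qexp_def by (cases "td a = 2") (auto intro!: continuous_intros)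
    then show "continuous_on (\<iota> ` W) (qexp td)"
      unfolding continuous_on_def by (auto intro!: vec_tendstoI intro: tendsto_within_subset)
  qed (auto simp: qexp_iota)
  then show "\<exists>\<kappa>. homeomorphism W (\<iota> ` W) \<iota> \<kappa>" by blast
  show "\<exists>M'. open M' \<and> \<iota> s \<in> M' \<and> M' \<subseteq> M \<and> closedin (top_of_set M') (\<iota> ` W)"
  proof (intro exI conjI)
    show "open M" by (rule open_M)
    show "\<iota> s \<in> M" by (rule iota_in_M[OF sW])
    have "{z::'n cvec. \<forall>a. td a \<noteq> 2 \<longrightarrow> z $ a = 0} = (\<Inter>a\<in>{a. td a \<noteq> 2}. {z. z $ a = 0})" by auto
    moreover have "closed \<dots>" by (intro closed_INT ballI closed_Collect_eq continuous_intros)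
    ultimately show "closedin (top_of_set M) (\<iota> ` W)" unfolding iota_image by (simp add: closedin_closed_Int)
  qed simp
qed

end

context quantum_module
begin

section \<open>Unfolding the quantum module\<close>

text \<open>
  The frame vectors are obtained from \<open>e\<close> by words in the quantum operators, and they span the space.
\<close>
lemma quantum_generated:
  assumes higgs: "graded_higgs td k iu p \<delta> (zdom td \<rho>') Q" and z: "z \<in> zdom td \<rho>'" and le: "\<rho>' \<le> \<rho>"
  shows "generated_by (V 2) (quantum_act_z td T \<delta> \<phi> z) e"
proof -
  interpret higgs: graded_higgs td k iu p \<delta> "zdom td \<rho>'" Q by (rule higgs)
  have z': "z \<in> Z" using z zdom_mono[OF le] by blast
  interpret act: commuting_action "V 2" "quantum_act_z td T \<delta> \<phi> z"
    by (rule frobenius_module_action[OF quantum_frobenius_module[OF z']])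
  let ?G = "higgs.frame (\<lambda>j. Q j z)"
  show ?thesis
  proof (rule act.generated_byI)
    fix S assume S: "\<And>x y. x \<in> S \<Longrightarrow> y \<in> S \<Longrightarrow> x + y \<in> S" "\<And>c x. x \<in> S \<Longrightarrow> c *s x \<in> S" "e \<in> S"
      "\<And>w x. w \<in> V 2 \<Longrightarrow> x \<in> S \<Longrightarrow> quantum_act_z td T \<delta> \<phi> z w x \<in> S" "0 \<in> S"
    have sum: "(\<Sum>i\<in>I. f i) \<in> S" if "\<And>i. i \<in> I \<Longrightarrow> f i \<in> S" for I and f :: "'z \<Rightarrow> 'n cvec"
      using that by (induction I rule: infinite_finite_induct) (auto intro: S)
    have word: "\<tau> (app (grad.wprod (\<lambda>j. Q j z) ws) (axis iu 1)) \<in> S" if "set ws \<subseteq> grad.J" for ws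
      using that
    proof (induction ws)
      case Nil
      then show ?case using S(3) by (simp add: app_simps tau_axis T_iu)
    next
      case (Cons j ws)
      then have j: "j \<in> grad.J" by simp
      then have "T j \<in> V 2" using T_2 by (simp add: grad.J_iff)
      then have "quantum_act_z td T \<delta> \<phi> z (T j) (\<tau> (app (grad.wprod (\<lambda>j. Q j z) ws) (axis iu 1))) \<in> S"
        using Cons S(4) by simp
      then show ?case by (simp add: quantum_act_z_basis[OF j] app_simps)
    qed
    have col: "\<tau> (app ?G (axis a 1)) \<in> S" for a
    proof -
      have "app ?G (axis a 1) = app (higgs.pw a (\<lambda>j. Q j z)) (axis iu 1)"
        by (simp add: vec_eq_iff app_axis higgs.frame_def)
      also have "\<dots> = (\<Sum>ws\<in>grad.wordset a. p a ws *s app (grad.wprod (\<lambda>j. Q j z) ws) (axis iu 1))"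
        by (simp add: higgs.pw_def app_sum app_simps)
      finally have "\<tau> (app ?G (axis a 1)) = (\<Sum>ws\<in>grad.wordset a. p a ws *s \<tau> (app (grad.wprod (\<lambda>j. Q j z) ws) (axis iu 1)))"
        by (simp add: clin_sum[OF tau_clin] tau_linear)
      also have "\<dots> \<in> S" by (intro sum S(2) word grad.wordset_length)
      finally show ?thesis .
    qed
    have "v \<in> S" for v
    proof -
      define u where "u = app (op_inv ?G) (cv v)"
      have "app ?G u = cv v"
        using op_inv(1)[OF higgs.A0_gen[OF z]] by (simp add: u_def app_simps flip: app_simps(7))
      then have "v = \<tau> (app ?G u)" by simp
      also have "app ?G u = (\<Sum>a\<in>UNIV. u $ a *s app ?G (axis a 1))"
        by (simp add: vec_eq_iff app_axis) (simp add: app_nth mult.commute)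
      also have "\<tau> \<dots> = (\<Sum>a\<in>UNIV. u $ a *s \<tau> (app ?G (axis a 1)))"
        by (simp add: clin_sum[OF tau_clin] tau_linear)
      also have "\<dots> \<in> S" by (intro sum S(2) col)
      finally show ?thesis .
    qed
    then show "S = UNIV" by blast
  qed
qed

definition unfoldable :: "'n cvec set \<Rightarrow> 'n cvec \<Rightarrow> bool" where
  "unfoldable D s \<longleftrightarrow>
     (\<exists>S. openin (top_of_set (qspace td)) S \<and> s \<in> S \<and> S \<subseteq> D \<inter> punctured_polydisc td 1 \<and>
        (\<forall>q\<in>S. generated_by (V 2) (quantum_act td T \<delta> \<phi> q) e \<and>
               graded_frobenius_algebra k V B e
                 (generated_mult (V 2) (quantum_act td T \<delta> \<phi> q) e)) \<and>
        (\<exists>M x mul E g \<Gamma>. x \<in> M \<and> frobenius_manifold M mul E g \<Gamma> \<and>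
           unfolds B e td T (\<lambda>q. generated_mult (V 2) (quantum_act td T \<delta> \<phi> q) e) S s
             M x mul E g \<Gamma>))"

text \<open>
  The Frobenius manifold lives on the domain \<open>chart.M\<close> of the flat coordinates, and the trivialization is the
  constant map \<open>\<tau>\<close> given by the basis \<open>T\<close>.  On the image of the chart the operators \<open>C a\<close> commute with
  the quantum operators, so the product on the manifold is the generated one by \<open>generated_mult_eq\<close>.
\<close>
theorem unfolding_exists:
  assumes gen: "generated_by (V 2) act e" and D: "polydisc td \<rho> \<subseteq> D"
  shows "\<exists>\<epsilon>>0. \<forall>s \<in> punctured_polydisc td 1 \<inter> polydisc td \<epsilon>. unfoldable D s"
proof -
  obtain p \<rho>' where \<rho>': "0 < \<rho>'" "\<rho>' \<le> \<rho>" and higgs: "graded_higgs td k iu p \<delta> (zdom td \<rho>') Q"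
    using higgs_field[OF gen] by blast
  interpret higgs: graded_higgs td k iu p \<delta> "zdom td \<rho>'" Q by (rule higgs)
  obtain C where C: "\<And>c. holo_op (C c) (zdom td \<rho>')"
    "\<And>z a b. z \<in> zdom td \<rho>' \<Longrightarrow> C a z * C b z = C b z * C a z"
    "\<And>z. z \<in> zdom td \<rho>' \<Longrightarrow> C iu z = 1"
    "\<And>z a c. z \<in> zdom td \<rho>' \<Longrightarrow> entry (C a z) c iu = (if c = a then 1 else 0)"
    "\<And>z a b. z \<in> zdom td \<rho>' \<Longrightarrow> C a z * C b z = (\<Sum>c\<in>UNIV. sc (entry (C a z) c b) (C c z))"
    "\<And>z a b. z \<in> zdom td \<rho>' \<Longrightarrow> pdo a (C b) z = pdo b (C a) z"
    "\<And>z a b c. z \<in> zdom td \<rho>' \<Longrightarrow> entry (C c z) (\<delta> a) (\<delta> b) = entry (C c z) b a"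
    "\<And>z j c. z \<in> zdom td \<rho>' \<Longrightarrow> j \<in> grad.J \<Longrightarrow> (\<And>c. 4 \<le> td c \<Longrightarrow> z $ c = 0) \<Longrightarrow> C c z * Q j z = Q j z * C c z"
    using higgs.potential_multiplication_exists by blast
  define \<epsilon> where "\<epsilon> = min 1 \<rho>'"
  have \<epsilon>: "0 < \<epsilon>" "\<epsilon> \<le> 1" "\<epsilon> \<le> \<rho>'" using \<rho>' by (auto simp: \<epsilon>_def)
  show ?thesis
  proof (rule exI[of _ \<epsilon>], intro conjI ballI)
    show "0 < \<epsilon>" by (rule \<epsilon>(1))
    fix s assume "s \<in> punctured_polydisc td 1 \<inter> polydisc td \<epsilon>"
    then have s: "s \<in> qspace td" "\<And>j. td j = 2 \<Longrightarrow> s $ j \<noteq> 0" "\<And>j. td j = 2 \<Longrightarrow> cmod (s $ j) < \<epsilon>"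
      by (auto simp: punctured_polydisc_def polydisc_def)
    define \<eta> where "\<eta> = Min (insert 1 ((\<lambda>j. min (cmod (s $ j)) (\<epsilon> - cmod (s $ j))) ` {j. td j = 2}))"
    have \<eta>: "0 < \<eta>" using s by (auto simp: \<eta>_def)
    have \<eta>_le: "\<eta> \<le> cmod (s $ j)" "cmod (s $ j) + \<eta> \<le> \<epsilon>" if "td j = 2" for j
    proof -
      have "\<eta> \<le> min (cmod (s $ j)) (\<epsilon> - cmod (s $ j))"
        unfolding \<eta>_def using that by (intro Min_le) auto
      then show "\<eta> \<le> cmod (s $ j)" "cmod (s $ j) + \<eta> \<le> \<epsilon>" by auto
    qed
    interpret chart: logarithm_chart td s \<eta> by unfold_locales (use s \<eta> \<eta>_le in auto)
    let ?W = chart.W and ?M = chart.M and ?i = chart.\<iota>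
    have norm_less: "cmod w < \<epsilon>" if "cmod (w - s $ j) < \<eta>" "td j = 2" for w j
    proof -
      have "cmod w \<le> cmod (s $ j) + cmod (w - s $ j)" using norm_triangle_ineq[of "s $ j" "w - s $ j"] by simp
      then show ?thesis using that \<eta>_le[OF that(2)] by linarith
    qed
    have W_poly: "q \<in> polydisc td \<epsilon>" if "q \<in> ?W" for q
      using that norm_less by (auto simp: chart.W_def chart.box_def polydisc_def)
    have M_sub: "?M \<subseteq> zdom td \<rho>'"
    proof
      fix z assume "z \<in> ?M"
      then have "cmod (exp (2 * of_real pi * \<i> * z $ j)) < \<epsilon>" if "td j = 2" for j
        using norm_less that unfolding chart.M_def by blast
      then show "z \<in> zdom td \<rho>'" using \<epsilon>(3) by (force simp: zdom_iff)
    qed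
    have i_dom: "?i q \<in> zdom td \<rho>'" if "q \<in> ?W" for q using chart.iota_in_M[OF that] M_sub by blast
    have qlog: "qexp td (qlog td q) = q" if "q \<in> ?W" for q
    proof -
      have "q $ a = 0" if "td a \<noteq> 2" for a using \<open>q \<in> ?W\<close> that by (auto simp: chart.W_def qspace_def)
      then show ?thesis using chart.ratio(4)[OF that] by (auto simp: vec_eq_iff qexp_def qlog_def)
    qed
    have qlog_dom: "qlog td q \<in> zdom td \<rho>'" if "q \<in> ?W" for q
      using i_dom[OF that] qlog[OF that] chart.qexp_iota[OF that] by (simp add: zdom_def)
    have sub: "zdom td \<rho>' \<subseteq> Z" by (rule zdom_mono[OF \<rho>'(2)])
    have gen_q: "generated_by (V 2) (quantum_act td T \<delta> \<phi> q) e" if "q \<in> ?W" for q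
      unfolding quantum_act_def by (rule quantum_generated[OF higgs qlog_dom[OF that] \<rho>'(2)])
    have fm_q: "frobenius_module k V B e (quantum_act td T \<delta> \<phi> q)" if "q \<in> ?W" for q
      unfolding quantum_act_def using qlog_dom[OF that] sub by (intro quantum_frobenius_module) auto
    interpret flat: flat_potential ?M C \<delta> iu
    proof
      show "open ?M" by (rule chart.open_M)
      show "\<delta> (\<delta> a) = a" for a by (rule delta_delta)
      show "holo_op (C c) ?M" for c
        using C(1)[of c] holo_on_subset[OF _ M_sub] by (auto simp: holo_op_def)
      fix z assume "z \<in> ?M"
      then have z: "z \<in> zdom td \<rho>'" using M_sub by blast
      show "C a z * C b z = C b z * C a z" for a b by (rule C(2)[OF z])
      show "C iu z = 1" by (rule C(3)[OF z])
      show "entry (C a z) c iu = (if c = a then 1 else 0)" for a c by (rule C(4)[OF z])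
      show "C a z * C b z = (\<Sum>c\<in>UNIV. sc (entry (C a z) c b) (C c z))" for a b by (rule C(5)[OF z])
      show "pdo a (C b) z = pdo b (C a) z" for a b by (rule C(6)[OF z])
      show "entry (C c z) (\<delta> a) (\<delta> b) = entry (C c z) b a" for a b c by (rule C(7)[OF z])
    qed
    have sW: "s \<in> ?W" using chart.embedding unfolding closed_embedding_germ_def by blast
    have mult: "\<tau> (flat.mul (?i q) u v) = generated_mult (V 2) (quantum_act td T \<delta> \<phi> q) e (\<tau> u) (\<tau> v)"
      if q: "q \<in> ?W" for q u v
    proof -
      interpret act: commuting_action "V 2" "quantum_act td T \<delta> \<phi> q"
        by (rule frobenius_module_action[OF fm_q[OF q]])
      let ?X = "\<lambda>x. \<tau> (app (flat.mulvec (?i q) u) (cv x))"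
      \<comment> \<open>the action uses the principal logarithm, which may differ from the chart by periods\<close>
      have Q_eq: "Q j (qlog td q) = Q j (?i q)" if "j \<in> grad.J" for j
        by (rule Q_periodic[OF that]) (use qlog_dom[OF q] i_dom[OF q] sub qlog[OF q] chart.qexp_iota[OF q] in auto)
      have "?i q $ c = 0" if "4 \<le> td c" for c using that by (simp add: chart.\<iota>_def)
      then have "C c (?i q) * Q j (?i q) = Q j (?i q) * C c (?i q)" if "j \<in> grad.J" for j c
        using C(8)[OF i_dom[OF q] that] by blast
      then have "flat.mulvec (?i q) u * Qw (qlog td q) w = Qw (qlog td q) w * flat.mulvec (?i q) u" for w
        by (simp add: flat.mulvec_def Qw_def Q_eq sum_product sc_mult_left sc_mult_right sc_sc mult.commute[of "coord T w _"])
           (rule sum.swap)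
      then have comm: "app (flat.mulvec (?i q) u) (app (Qw (qlog td q) w) x) = app (Qw (qlog td q) w) (app (flat.mulvec (?i q) u) x)" for w x
        by (metis app_simps(7))
      have "generated_mult (V 2) (quantum_act td T \<delta> \<phi> q) e (\<tau> u) (\<tau> v) = ?X (\<tau> v)"
      proof (rule act.generated_mult_eq[OF gen_q[OF q]])
        show "clin ?X" using cv_clin by (simp add: clin_iff app_simps tau_linear)
        show "?X (quantum_act td T \<delta> \<phi> q w x) = quantum_act td T \<delta> \<phi> q w (?X x)" for w x
          by (simp add: quantum_act_def quantum_act_z_Qw comm)
        have "cv e = axis iu 1" using cv_T[of iu] by (simp add: T_iu)
        moreover have "app (flat.mulvec (?i q) u) (axis iu 1) = u"
          using C(4)[OF i_dom[OF q]]
          by (simp add: vec_eq_iff app_axis flat.mulvec_def delta_mult cong: if_cong)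
        ultimately show "?X e = \<tau> u" by simp
      qed
      then show ?thesis by (simp add: flat.mul_def)
    qed
    have linear_part: "\<tau> (vpd j \<sigma> q) = vpd j (\<lambda>p. \<tau> (\<sigma> p)) q"
      if \<sigma>: "vholo_on \<sigma> ?W" and q: "q \<in> ?W" and j: "td j = 2" for \<sigma> q j
    proof (rule vec_eq_iff[THEN iffD2], rule allI)
      fix l
      have "((\<lambda>t. \<sigma> (q + t *s axis j 1) $ a) has_field_derivative pd j (\<lambda>p. \<sigma> p $ a) q) (at 0)" for a
        using \<sigma> by (intro holo_on_relative_line[OF _ chart.W_def chart.open_box q j]) (simp add: vholo_on_def)
      then have "((\<lambda>t. \<Sum>a\<in>UNIV. \<sigma> (q + t *s axis j 1) $ a * T a $ l) has_field_derivative
          (\<Sum>a\<in>UNIV. pd j (\<lambda>p. \<sigma> p $ a) q * T a $ l)) (at 0)"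
        by (intro DERIV_sum DERIV_cmult_right)
      then have "pd j (\<lambda>p. \<tau> (\<sigma> p) $ l) q = (\<Sum>a\<in>UNIV. pd j (\<lambda>p. \<sigma> p $ a) q * T a $ l)"
        unfolding pd_def[of j "\<lambda>p. \<tau> (\<sigma> p) $ l"] by (simp add: \<tau>_def DERIV_imp_deriv)
      then show "\<tau> (vpd j \<sigma> q) $ l = vpd j (\<lambda>p. \<tau> (\<sigma> p)) q $ l"
        by (simp add: \<tau>_def vpd_def)
    qed
    have unfolds: "unfolds B e td T (\<lambda>q. generated_mult (V 2) (quantum_act td T \<delta> \<phi> q) e) ?W s
        ?M (?i s) flat.mul (\<lambda>_. axis iu 1) flat.metric (\<lambda>_ _ _. 0)"
      unfolding unfolds_def
    proof (intro exI[of _ ?W] exI[of _ ?i] exI[of _ "\<lambda>_. \<tau>"] conjI ballI allI impI)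
      show "closed_embedding_germ td ?W s ?M (?i s) ?i" by (rule chart.embedding)
      show "clin \<tau>" "bij \<tau>" by (rule tau_clin, rule bij_tau)
      show "vholo_on (\<lambda>_. \<tau> (axis i 1)) ?W" for i by (simp add: vholo_on_def holo_on_const)
      show "\<tau> ((2 * of_real pi * \<i> * q $ j) *s vpd j ?i q) = T j" if "q \<in> ?W" "td j = 2" for q j
        using chart.ratio(4)[OF that] by (simp add: chart.vpd_iota[OF that] vec.scale_scale tau_axis)
      show "\<tau> (axis iu 1) = e" by (simp add: tau_axis T_iu)
      show "B (\<tau> u) (\<tau> v) = flat.metric (?i q) u v" for q u v by (simp add: B_tau flat.metric_def)
      show "\<tau> (flat.mul (?i q) u v) = generated_mult (V 2) (quantum_act td T \<delta> \<phi> q) e (\<tau> u) (\<tau> v)" if "q \<in> ?W" for q u v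
        by (rule mult[OF that])
      show "\<tau> (vpd j \<sigma> q + 0) = vpd j (\<lambda>p. \<tau> (\<sigma> p)) q" if "vholo_on \<sigma> ?W" "q \<in> ?W" "td j = 2" for \<sigma> q j
        using linear_part[OF that] by simp
    qed simp
    show "unfoldable D s"
      unfolding unfoldable_def
    proof (rule exI[of _ ?W], intro conjI)
      show "openin (top_of_set (qspace td)) ?W" using chart.embedding unfolding closed_embedding_germ_def by blast
      show "s \<in> ?W" by (rule sW)
      have mono: "polydisc td \<epsilon> \<subseteq> polydisc td r" if "\<epsilon> \<le> r" for r using that by (force simp: polydisc_def)
      have "\<epsilon> \<le> \<rho>" using \<epsilon>(3) \<rho>'(2) by simp
      then show "?W \<subseteq> D \<inter> punctured_polydisc td 1"
        using W_poly mono[of \<rho>] mono[of 1] \<epsilon>(2) D chart.ratio(4) unfolding punctured_polydisc_def by blast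
      show "\<forall>q\<in>?W. generated_by (V 2) (quantum_act td T \<delta> \<phi> q) e \<and>
               graded_frobenius_algebra k V B e (generated_mult (V 2) (quantum_act td T \<delta> \<phi> q) e)"
        using gen_q generated_frobenius_algebra[OF fm_q] by blast
      show "\<exists>M x mul E g \<Gamma>. x \<in> M \<and> frobenius_manifold M mul E g \<Gamma> \<and>
           unfolds B e td T (\<lambda>q. generated_mult (V 2) (quantum_act td T \<delta> \<phi> q) e) ?W s M x mul E g \<Gamma>"
        using chart.iota_in_M[OF sW] flat.flat_frobenius_manifold unfolds by blast
    qed
  qed
qed

end

theorem theorem5p8:
  fixes k :: nat
    and V :: "nat \<Rightarrow> 'n::{finite,linorder} cvec set"
    and B :: "'n cvec \<Rightarrow> 'n cvec \<Rightarrow> complex"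
    and e :: "'n cvec"
    and act :: "'n cvec \<Rightarrow> 'n cvec \<Rightarrow> 'n cvec"
    and VR :: "'n cvec set"
    and td :: "'n \<Rightarrow> nat"
    and T :: "'n \<Rightarrow> 'n cvec"
    and \<delta> :: "'n \<Rightarrow> 'n"
    and D :: "'n cvec set"
    and \<phi> :: "'n cvec \<Rightarrow> complex"
  assumes "framed_frobenius_module k V B e act VR {j. td j = 2} T"
    and "adapted_basis V B e td T \<delta>"
    and "quantum_potential k V B e act td T \<delta> D \<phi>"
    and "generated_by (V 2) act e"
  shows "\<exists>\<epsilon>>0. \<forall>s \<in> punctured_polydisc td 1 \<inter> polydisc td \<epsilon>.
     (\<exists>S. openin (top_of_set (qspace td)) S \<and> s \<in> S \<and> S \<subseteq> D \<inter> punctured_polydisc td 1 \<and>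
        (\<forall>q\<in>S. generated_by (V 2) (quantum_act td T \<delta> \<phi> q) e \<and>
               graded_frobenius_algebra k V B e
                 (generated_mult (V 2) (quantum_act td T \<delta> \<phi> q) e)) \<and>
        (\<exists>M x mul E g \<Gamma>. x \<in> M \<and> frobenius_manifold M mul E g \<Gamma> \<and>
           unfolds B e td T (\<lambda>q. generated_mult (V 2) (quantum_act td T \<delta> \<phi> q) e) S s
             M x mul E g \<Gamma>))"
proof -
  have "frobenius_module k V B e act"
    using assms(1) by (simp add: framed_frobenius_module_def real_frobenius_module_def)
  then interpret framed_module k V B e act td T \<delta> by unfold_locales (use assms(2) in auto)
  obtain \<rho> where \<rho>: "0 < \<rho>" "polydisc td \<rho> \<subseteq> D" "holo_on \<phi> (zdom td \<rho>)"
    "\<And>j a b. td j = 2 \<Longrightarrow> td a + td b + 2 = 2 * k \<Longrightarrow>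
       \<exists>f. qfun td \<rho> f \<and> (\<forall>z\<in>zdom td \<rho>. pd j (pd a (pd b \<phi>)) z = yukawa j a b + f z \<and> (td a = 0 \<longrightarrow> f z = 0))"
    by (rule quantum_third_derivatives[OF assms(3)]) blast
  interpret quantum_module k V B e act td T \<delta> \<phi> \<rho>
  proof
    show "frobenius_module k V B e (quantum_act_z td T \<delta> \<phi> z)" if "3 < k" "z \<in> zdom td \<rho>" for z
    proof -
      have "qexp td z \<in> D" using that(2) \<rho>(2) by (auto simp: zdom_def)
      then show ?thesis using assms(3) that(1) unfolding quantum_potential_def by blast
    qed
  qed (use \<rho> in auto)
  show ?thesis using unfolding_exists[OF assms(4) \<rho>(2)] unfolding unfoldable_def .
qed

end
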